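(* Let $\mathbb{F}$ be a field of characteristic zero and let $\mathfrak{p}=\coprod_{j\in\mathbb{Z}}\mathfrak{p}_j$ be a $\mathbb{Z}$-graded Lie algebra over $\mathbb{F}$, with $\mathfrak{p}^-=\coprod_{j<0}\mathfrak{p}_j$ and $\mathfrak{p}^+=\coprod_{j>0}\mathfrak{p}_j$. Let $\mathcal{A}_j$ ($j\in\mathbb{Z}$, $j>0$) and $\mathcal{B}_j$ ($j\in\mathbb{Z}$, $j<0$) be commuting formal variables. Fix $(p_1,p_2,\dots)\in\prod_{j>0}\mathfrak{p}_j$ and $(p_{-1},p_{-2},\dots)\in\prod_{j<0}\mathfrak{p}_j$, and set $$g^+=\sum_{j>0}\mathcal{A}_jp_j,\qquad g^-=\sum_{j<0}\mathcal{B}_jp_j$$ in $\mathfrak{p}[[\mathcal{A},\mathcal{B}]]$. Then there exist unique elements $\Psi^-\in\mathfrak{p}^-[[\mathcal{A},\mathcal{B}]]$, $\Psi^0\in\mathfrak{p}_0[[\mathcal{A},\mathcal{B}]]$ and $\Psi^+\in\mathfrak{p}^+[[\mathcal{A},\mathcal{B}]]$ of the form $$\Psi^-=\sum_{j<0}\mathcal{B}_jp_j+\mathcal{Q}^-(\mathcal{A},\mathcal{B}),\qquad \Psi^0=\mathcal{Q}^0(\mathcal{A},\mathcal{B}),\qquad \Psi^+=\sum_{j>0}\mathcal{A}_jp_j+\mathcal{Q}^+(\mathcal{A},\mathcal{B}),$$ where $\mathcal{Q}^-(\mathcal{A},\mathcal{B})\in\mathfrak{p}^-[[\mathcal{A},\mathcal{B}]]$,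 $\mathcal{Q}^0(\mathcal{A},\mathcal{B})\in\mathfrak{p}_0[[\mathcal{A},\mathcal{B}]]$, $\mathcal{Q}^+(\mathcal{A},\mathcal{B})\in\mathfrak{p}^+[[\mathcal{A},\mathcal{B}]]$ contain only terms of order at least one in the $\mathcal{A}_j$'s and order at least one in the $\mathcal{B}_j$'s, such that $$e^{g^+}e^{g^-}=e^{\Psi^-}e^{\Psi^+}e^{\Psi^0}$$ in $U(\mathfrak{p})[[\mathcal{A},\mathcal{B}]]$. Moreover, $$\Psi^-,\Psi^0,\Psi^+\in\mathbb{F}\langle\langle g^-,g^+;\pi^-,\pi^0,\pi^+\rangle\rangle,$$ and $$\Psi^-=\sum_{j<0}\mathcal{B}_jp_j+\sum_{\substack{j>0,\ m<0\\ j+m<0}}\mathcal{A}_j\mathcal{B}_m[p_j,p_m]+\mathcal{P}^-(\mathcal{A},\mathcal{B}),$$ $$\Psi^0=\sum_{j>0}\mathcal{A}_j\mathcal{B}_{-j}[p_j,p_{-j}]+\mathcal{P}^0(\mathcal{A},\mathcal{B}),$$ $$\Psi^+=\sum_{j>0}\mathcal{A}_jp_j+\sum_{\substack{j>0,\ m<0\\ j+m>0}}\mathcal{A}_j\mathcal{B}_m[p_j,p_m]+\mathcal{P}^+(\mathcal{A},\mathcal{B}),$$ where $\mathcal{P}^-(\mathcal{A},\mathcal{B}),\mathcal{P}^0(\mathcal{A},\mathcal{B}),\mathcal{P}^+(\mathcal{A},\mathcal{B})\in\mathfrak{p}[[\mathcal{A},\mathcal{B}]]$ each contain only terms of total order three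 or more in the $\mathcal{A}_j$'s and $\mathcal{B}_j$'s, with order at least one in the $\mathcal{A}_j$'s and at least one in the $\mathcal{B}_j$'s.
   Context: For a vector space $V$, $V[[\mathcal{A},\mathcal{B}]]$ is the space of formal power series in the infinitely many commuting variables $\mathcal{A}_j$ ($j>0$), $\mathcal{B}_j$ ($j<0$) with coefficients in $V$, i.e. arbitrary (possibly infinite) formal sums of monomials with coefficients in $V$; each monomial involves finitely many variables. Each $\mathcal{A}_j$ and each $\mathcal{B}_j$ has order one; the order in the $\mathcal{A}_j$'s (resp. order in the $\mathcal{B}_j$'s, resp. total order) of a monomial is its degree in the $\mathcal{A}_j$'s (resp. in the $\mathcal{B}_j$'s, resp. its total degree). $\mathfrak{p}[[\mathcal{A},\mathcal{B}]]$ is a Lie algebra in the canonical way, and $U(\mathfrak{p})$ is the universal enveloping algebra of $\mathfrak{p}$. The exponentials of $g^\pm$ and of elements $\Psi^-,\Psi^+,\Psi^0$ of the stated form are well defined in $U(\mathfrak{p})[[\mathcal{A},\mathcal{B}]]$ since these series have no constant term. There is the decomposition $\mathfrak{p}[[\mathcal{A},\mathcal{B}]]=\mathfrak{p}^-[[\mathcal{A},\mathcal{B}]]\oplus\mathfrak{p}_0[[\mathcal{A},\mathcal{B}]]\oplus\mathfrak{p}^+[[\mathcal{A},\mathcal{B}]]$ into Lie subalgebras; $\pi^-,\pi^0,\pi^+$ denote the corresponding projections. $\mathbb{F}\langle\langle g^-,g^+;\pi^-,\pi^0,\pi^+\rangle\rangle\subset\mathfrak{p}[[\mathcal{A},\mathcal{B}]]$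 denotes the set of formal (possibly infinite) linear combinations of words built from $g^-$ and $g^+$ by repeatedly applying the bracket and the projections $\pi^-,\pi^0,\pi^+$; that is, all sums $\sum_{m,n\ge0}w_{m,n}$ where $w_{m,n}$ is in the $\mathbb{F}$-span of such words involving exactly $m$ occurrences of $g^-$ and exactly $n$ occurrences of $g^+$ (such words being homogeneous of order $m$ in the $\mathcal{B}_j$'s and order $n$ in the $\mathcal{A}_j$'s). *)

theory Defs
  imports
    Complex_Main
    "HOL-Library.Multiset"
    "HOL-Library.Poly_Mapping"
    "HOL-Library.Function_Algebras"
    "HOL-Algebra.QuotRing"
begin

section \<open>Graded Lie algebras\<close>

locale lie_algebra = vector_space scale
  for scale :: "'f::field_char_0 \<Rightarrow> 'p::ab_group_add \<Rightarrow> 'p" +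
  fixes bracket :: "'p \<Rightarrow> 'p \<Rightarrow> 'p"
  assumes bracket_add_left: "bracket (x + y) z = bracket x z + bracket y z"
    and bracket_add_right: "bracket x (y + z) = bracket x y + bracket x z"
    and bracket_scale_left: "bracket (scale c x) y = scale c (bracket x y)"
    and bracket_scale_right: "bracket x (scale c y) = scale c (bracket x y)"
    and bracket_self: "bracket x x = 0"
    and jacobi: "bracket x (bracket y z) + bracket y (bracket z x) + bracket z (bracket x y) = 0"

text \<open>\<open>c\<close> is a decomposition of \<open>x\<close> into homogeneous components for the family
  \<open>P\<close> of homogeneous subspaces.\<close>

definition homogeneous_decomp :: "(int \<Rightarrow> 'p::ab_group_add set) \<Rightarrow> 'p \<Rightarrow> (int \<Rightarrow> 'p) \<Rightarrow> bool" where
  "homogeneous_decomp P x c \<longleftrightarrow>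
    (\<forall>j. c j \<in> P j) \<and> finite {j. c j \<noteq> 0} \<and> x = (\<Sum>j\<in>{j. c j \<noteq> 0}. c j)"

locale graded_lie_algebra = lie_algebra scale bracket
  for scale :: "'f::field_char_0 \<Rightarrow> 'p::ab_group_add \<Rightarrow> 'p" and bracket :: "'p \<Rightarrow> 'p \<Rightarrow> 'p" +
  fixes P :: "int \<Rightarrow> 'p set"
  assumes subspace_P: "subspace (P j)"
    and direct_sum: "\<exists>!c. homogeneous_decomp P x c"
    and bracket_P: "x \<in> P i \<Longrightarrow> y \<in> P j \<Longrightarrow> bracket x y \<in> P (i + j)"

text \<open>\<open>graded_part scale P J\<close> is the coproduct of the \<open>P j\<close> with \<open>j \<in> J\<close>, as a subspace, and
  \<open>graded_proj P J\<close> is the projection onto it along the remaining \<open>P j\<close>.\<close>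

definition graded_part ::
    "('f::field \<Rightarrow> 'p::ab_group_add \<Rightarrow> 'p) \<Rightarrow> (int \<Rightarrow> 'p set) \<Rightarrow> int set \<Rightarrow> 'p set" where
  "graded_part scale P J = module.span scale (\<Union>j\<in>J. P j)"

definition graded_proj :: "(int \<Rightarrow> 'p::ab_group_add set) \<Rightarrow> int set \<Rightarrow> 'p \<Rightarrow> 'p" where
  "graded_proj P J x =
    (let c = (THE c. homogeneous_decomp P x c) in \<Sum>j\<in>{j \<in> J. c j \<noteq> 0}. c j)"


section \<open>Formal power series in the variables \<open>A\<close>, \<open>B\<close>\<close>

text \<open>The variable with index \<open>j\<close> is \<open>A\<^sub>j\<close> if \<open>j > 0\<close> and \<open>B\<^sub>j\<close> if \<open>j < 0\<close>. A monomial is the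
  finite multiset of the variables occurring in it, so the product of monomials is \<open>+\<close> and the
  total order is \<open>size\<close>. A series is the function of its coefficients; sums of series are
  pointwise.\<close>

typedef var = "{j::int. j \<noteq> 0}"
  morphisms index mk_var
  by (rule exI[of _ 1]) simp

type_synonym monomial = "var multiset"

type_synonym 'v series = "monomial \<Rightarrow> 'v"

definition indet :: "int \<Rightarrow> monomial" where
  "indet j = {#mk_var j#}"

definition ordA :: "monomial \<Rightarrow> nat" where
  "ordA M = size {#v \<in># M. index v > 0#}"

definition ordB :: "monomial \<Rightarrow> nat" where
  "ordB M = size {#v \<in># M. index v < 0#}"

text \<open>\<open>V[[A,B]]\<close> for a subspace \<open>V\<close> of the coefficient space.\<close>

definition series_in :: "'v set \<Rightarrow> 'v series set" where
  "series_in V = {f. \<forall>M. f M \<in> V}"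

text \<open>The possibly infinite sum of the terms \<open>c i\<close> times the monomial \<open>X i\<close>, for \<open>i \<in> I\<close>. It is
  meaningful when each monomial is \<open>X i\<close> for only finitely many \<open>i\<close>.\<close>

definition formal_sum :: "'i set \<Rightarrow> ('i \<Rightarrow> monomial) \<Rightarrow> ('i \<Rightarrow> 'v::comm_monoid_add) \<Rightarrow> 'v series" where
  "formal_sum I X c = (\<lambda>M. \<Sum>i\<in>{i \<in> I. X i = M}. c i)"

definition only_mixed_terms :: "'v::zero series \<Rightarrow> bool" where
  "only_mixed_terms f \<longleftrightarrow> (\<forall>M. f M \<noteq> 0 \<longrightarrow> ordA M \<ge> 1 \<and> ordB M \<ge> 1)"

definition only_terms_from_order :: "nat \<Rightarrow> 'v::zero series \<Rightarrow> bool" where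
  "only_terms_from_order k f \<longleftrightarrow> (\<forall>M. f M \<noteq> 0 \<longrightarrow> size M \<ge> k)"

definition series_scale :: "('f \<Rightarrow> 'p \<Rightarrow> 'p) \<Rightarrow> 'f \<Rightarrow> 'p series \<Rightarrow> 'p series" where
  "series_scale scale c f = (\<lambda>M. scale c (f M))"

definition series_bracket ::
    "('p \<Rightarrow> 'p \<Rightarrow> 'p::ab_group_add) \<Rightarrow> 'p series \<Rightarrow> 'p series \<Rightarrow> 'p series" where
  "series_bracket bracket f g = (\<lambda>M. \<Sum>(K, L)\<in>{(K, L). K + L = M}. bracket (f K) (g L))"

definition series_proj :: "(int \<Rightarrow> 'p::ab_group_add set) \<Rightarrow> int set \<Rightarrow> 'p series \<Rightarrow> 'p series" where
  "series_proj P J f = (\<lambda>M. graded_proj P J (f M))"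

definition g_plus :: "(int \<Rightarrow> 'p::ab_group_add) \<Rightarrow> 'p series" where
  "g_plus p = formal_sum {j. j > 0} indet p"

definition g_minus :: "(int \<Rightarrow> 'p::ab_group_add) \<Rightarrow> 'p series" where
  "g_minus p = formal_sum {j. j < 0} indet p"


section \<open>Words in two series under the bracket and the projections\<close>

text \<open>\<open>pword bracket P a b m n w\<close>: \<open>w\<close> is a word with \<open>m\<close> occurrences of \<open>a\<close> and \<open>n\<close>
  occurrences of \<open>b\<close>.\<close>

inductive pword ::
    "('p::ab_group_add \<Rightarrow> 'p \<Rightarrow> 'p) \<Rightarrow> (int \<Rightarrow> 'p set) \<Rightarrow> 'p series \<Rightarrow> 'p series \<Rightarrow>
      nat \<Rightarrow> nat \<Rightarrow> 'p series \<Rightarrow> bool"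
  for bracket P a b where
  first: "pword bracket P a b 1 0 a"
| second: "pword bracket P a b 0 1 b"
| bracket: "pword bracket P a b m n u \<Longrightarrow> pword bracket P a b m' n' v \<Longrightarrow>
    pword bracket P a b (m + m') (n + n') (series_bracket bracket u v)"
| proj_minus: "pword bracket P a b m n u \<Longrightarrow> pword bracket P a b m n (series_proj P {..<0} u)"
| proj_zero: "pword bracket P a b m n u \<Longrightarrow> pword bracket P a b m n (series_proj P {0} u)"
| proj_plus: "pword bracket P a b m n u \<Longrightarrow> pword bracket P a b m n (series_proj P {0<..} u)"

text \<open>For \<open>a = g_minus p\<close> and \<open>b = g_plus p\<close> the summand \<open>w m n\<close> is homogeneous of order \<open>m\<close> in
  the \<open>B\<close>'s and \<open>n\<close> in the \<open>A\<close>'s, so at most one summand contributes to each coefficient.\<close>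

definition pword_series ::
    "('f::field \<Rightarrow> 'p::ab_group_add \<Rightarrow> 'p) \<Rightarrow> ('p \<Rightarrow> 'p \<Rightarrow> 'p) \<Rightarrow> (int \<Rightarrow> 'p set) \<Rightarrow>
      'p series \<Rightarrow> 'p series \<Rightarrow> 'p series set" where
  "pword_series scale bracket P a b =
    {f. \<exists>w. (\<forall>m n. w m n \<in> module.span (series_scale scale) {u. pword bracket P a b m n u}) \<and>
        f = (\<lambda>M. \<Sum>(m, n)\<in>{(m, n). w m n M \<noteq> 0}. w m n M)}"


section \<open>The universal enveloping algebra\<close>

text \<open>The free unital associative algebra on the set of elements of the Lie algebra is the monoid
  algebra of the free monoid, with the convolution product of \<open>Poly_Mapping\<close>.\<close>

datatype 'a free_monoid = Word "'a list"

instantiation free_monoid :: (type) monoid_add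
begin

definition zero_free_monoid :: "'a free_monoid" where
  "zero_free_monoid = Word []"

fun plus_free_monoid :: "'a free_monoid \<Rightarrow> 'a free_monoid \<Rightarrow> 'a free_monoid" where
  "plus_free_monoid (Word u) (Word v) = Word (u @ v)"

instance
proof
  fix a b c :: "'a free_monoid"
  show "a + b + c = a + (b + c)" by (cases a; cases b; cases c) simp
  show "0 + a = a" by (cases a) (simp add: zero_free_monoid_def)
  show "a + 0 = a" by (cases a) (simp add: zero_free_monoid_def)
qed

end

type_synonym ('f, 'p) free_alg = "'p free_monoid \<Rightarrow>\<^sub>0 'f"

definition gen :: "'p \<Rightarrow> ('f::field, 'p) free_alg" where
  "gen x = Poly_Mapping.single (Word [x]) 1"

definition const :: "'f::field \<Rightarrow> ('f, 'p) free_alg" where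
  "const c = Poly_Mapping.single 0 c"

definition free_ring :: "('f::field, 'p) free_alg ring" where
  "free_ring = \<lparr>carrier = UNIV, monoid.mult = (*), one = 1, zero = 0, add = (+)\<rparr>"

text \<open>The first two families of relations present the tensor algebra, the third one its quotient
  by \<open>x \<otimes> y - y \<otimes> x - [x, y]\<close>.\<close>

definition uea_ideal ::
    "('f::field \<Rightarrow> 'p::ab_group_add \<Rightarrow> 'p) \<Rightarrow> ('p \<Rightarrow> 'p \<Rightarrow> 'p) \<Rightarrow> ('f, 'p) free_alg set" where
  "uea_ideal scale bracket = genideal free_ring
    ({gen (x + y) - gen x - gen y | x y. True} \<union>
     {gen (scale c x) - const c * gen x | c x. True} \<union>
     {gen x * gen y - gen y * gen x - gen (bracket x y) | x y. True})"

definition uea ::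
    "('f::field \<Rightarrow> 'p::ab_group_add \<Rightarrow> 'p) \<Rightarrow> ('p \<Rightarrow> 'p \<Rightarrow> 'p) \<Rightarrow> ('f, 'p) free_alg set ring" where
  "uea scale bracket = free_ring Quot uea_ideal scale bracket"

definition uea_class ::
    "('f::field \<Rightarrow> 'p::ab_group_add \<Rightarrow> 'p) \<Rightarrow> ('p \<Rightarrow> 'p \<Rightarrow> 'p) \<Rightarrow>
      ('f, 'p) free_alg \<Rightarrow> ('f, 'p) free_alg set" where
  "uea_class scale bracket t = uea_ideal scale bracket +>\<^bsub>free_ring\<^esub> t"

text \<open>The product of series over a ring is the Cauchy product.\<close>

definition series_ring :: "('a, 'm) ring_scheme \<Rightarrow> 'a series ring" where
  "series_ring R =
    \<lparr>carrier = series_in (carrier R),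
     monoid.mult = (\<lambda>f g M. \<Oplus>\<^bsub>R\<^esub>KL\<in>{(K, L). K + L = M}. f (fst KL) \<otimes>\<^bsub>R\<^esub> g (snd KL)),
     one = (\<lambda>M. if M = {#} then \<one>\<^bsub>R\<^esub> else \<zero>\<^bsub>R\<^esub>),
     zero = (\<lambda>M. \<zero>\<^bsub>R\<^esub>),
     add = (\<lambda>f g M. f M \<oplus>\<^bsub>R\<^esub> g M)\<rparr>"

abbreviation uea_series ::
    "('f::field \<Rightarrow> 'p::ab_group_add \<Rightarrow> 'p) \<Rightarrow> ('p \<Rightarrow> 'p \<Rightarrow> 'p) \<Rightarrow>
      ('f, 'p) free_alg set series ring" where
  "uea_series scale bracket \<equiv> series_ring (uea scale bracket)"

text \<open>The exponential in \<open>U(\<pp>)[[A,B]]\<close> of a series over \<open>\<pp>\<close>, which enters through the canonical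
  map from \<open>\<pp>\<close> to \<open>U(\<pp>)\<close>. If \<open>f\<close> has no constant term, then only the powers \<open>n \<le> size M\<close>
  contribute to the coefficient at \<open>M\<close>.\<close>

definition uea_embed ::
    "('f::field \<Rightarrow> 'p::ab_group_add \<Rightarrow> 'p) \<Rightarrow> ('p \<Rightarrow> 'p \<Rightarrow> 'p) \<Rightarrow>
      'p series \<Rightarrow> ('f, 'p) free_alg set series" where
  "uea_embed scale bracket f = (\<lambda>M. uea_class scale bracket (gen (f M)))"

definition uea_exp ::
    "('f::field_char_0 \<Rightarrow> 'p::ab_group_add \<Rightarrow> 'p) \<Rightarrow> ('p \<Rightarrow> 'p \<Rightarrow> 'p) \<Rightarrow>
      'p series \<Rightarrow> ('f, 'p) free_alg set series" where
  "uea_exp scale bracket f =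
    (let U = uea scale bracket;
         pow = (\<lambda>n::nat. uea_embed scale bracket f [^]\<^bsub>uea_series scale bracket\<^esub> n)
     in (\<lambda>M. \<Oplus>\<^bsub>U\<^esub>n\<in>{n. pow n M \<noteq> \<zero>\<^bsub>U\<^esub>}. uea_class scale bracket (const (1 / fact n)) \<otimes>\<^bsub>U\<^esub> pow n M))"


section \<open>The factorization\<close>

definition is_factorization ::
    "('f::field_char_0 \<Rightarrow> 'p::ab_group_add \<Rightarrow> 'p) \<Rightarrow> ('p \<Rightarrow> 'p \<Rightarrow> 'p) \<Rightarrow> (int \<Rightarrow> 'p set) \<Rightarrow>
      (int \<Rightarrow> 'p) \<Rightarrow> 'p series \<Rightarrow> 'p series \<Rightarrow> 'p series \<Rightarrow> bool" where
  "is_factorization scale bracket P p \<Psi>m \<Psi>0 \<Psi>p \<longleftrightarrow>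
    \<Psi>m \<in> series_in (graded_part scale P {..<0}) \<and>
    \<Psi>0 \<in> series_in (P 0) \<and>
    \<Psi>p \<in> series_in (graded_part scale P {0<..}) \<and>
    (\<exists>Qm Q0 Qp.
      Qm \<in> series_in (graded_part scale P {..<0}) \<and> only_mixed_terms Qm \<and>
      Q0 \<in> series_in (P 0) \<and> only_mixed_terms Q0 \<and>
      Qp \<in> series_in (graded_part scale P {0<..}) \<and> only_mixed_terms Qp \<and>
      \<Psi>m = g_minus p + Qm \<and> \<Psi>0 = Q0 \<and> \<Psi>p = g_plus p + Qp) \<and>
    uea_exp scale bracket (g_plus p) \<otimes>\<^bsub>uea_series scale bracket\<^esub> uea_exp scale bracket (g_minus p) =
    uea_exp scale bracket \<Psi>m \<otimes>\<^bsub>uea_series scale bracket\<^esub> uea_exp scale bracket \<Psi>p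
      \<otimes>\<^bsub>uea_series scale bracket\<^esub> uea_exp scale bracket \<Psi>0"

end

theory Submission
  imports Defs
begin

text \<open>Let \<open>D\<close> be the Euler derivation that multiplies a monomial by its order in the \<open>A\<close>'s. Then
  \<open>G = e\<^sup>g\<^sup>+ e\<^sup>g\<^sup>-\<close> is the solution of \<open>D G = g\<^sup>+ G\<close> with \<open>G = e\<^sup>g\<^sup>-\<close> at \<open>A = 0\<close>. With \<open>\<phi>(z) = (e\<^sup>z - 1) / z\<close>, the
  formula \<open>D e\<^sup>a = \<phi>(ad a)(D a) e\<^sup>a\<close> turns \<open>D X = g\<^sup>+ X\<close> for \<open>X = e\<^sup>a e\<^sup>b e\<^sup>c\<close> into the equation
  \<open>\<phi>(ad a)(D a) + e\<^bsup>ad a\<^esup> (\<phi>(ad b)(D b) + e\<^bsup>ad b\<^esup> \<phi>(ad c)(D c)) = g\<^sup>+\<close> over the Lie algebra. Its linear part is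
  \<open>D (a + b + c)\<close>, so it determines \<open>a + b + c\<close>, and hence its projections \<open>a, b, c\<close>, recursively by
  brackets and projections; no Baker--Campbell--Hausdorff formula is needed. For uniqueness, the
  coefficients of \<open>e\<^sup>a e\<^sup>b e\<^sup>c\<close> determine those of \<open>a + b + c\<close> recursively, because the Lie algebra embeds
  into its universal enveloping algebra.\<close>

section \<open>Formal power series over a ring\<close>

text \<open>The derivation counts only the A's, so it kills g^- and fixes g^+. Monomials without an
  A therefore impose no condition, and g^- enters as the initial value there; at all others the
  recursion divides by the order in the A's, which is where characteristic zero is used. Beyond the
  linear part, every term of the equation is a bracket of series without constant term, so at a
  given monomial it involves only proper divisors. This makes the recursion well founded.
  Calculations in U(p)[[A,B]] take place over the free algebra, modulo its ideal coefficient by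
  coefficient, because the product there is a type class operation and the quotient is only a
  record. Uniqueness does not pass through the differential equation: where two triples first
  differ, the product of exponentials depends linearly on their coefficients. The embedding of p
  into U(p) comes from an action of p on its symmetric algebra, in which the commutation rule
  dictates how a basis element acts on an ordered monomial; the work lies in the Jacobi identity
  argument that this is a representation.\<close>

lemma finite_submultisets: "finite {K. K \<subseteq># (M :: 'a multiset)}"
proof -
  have "{K. K \<subseteq># M} \<subseteq> mset ` {xs. set xs \<subseteq> set_mset M \<and> length xs \<le> size M}"
  proof
    fix K assume "K \<in> {K. K \<subseteq># M}"
    then have K: "K \<subseteq># M" by simp
    obtain xs where xs: "mset xs = K" by (metis ex_mset)
    have "set xs \<subseteq> set_mset M" using K xs by (metis set_mset_mono set_mset_mset)
    moreover have "length xs \<le> size M" using K xs by (metis size_mset size_mset_mono)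
    ultimately show "K \<in> mset ` {xs. set xs \<subseteq> set_mset M \<and> length xs \<le> size M}"
      using xs by blast
  qed
  moreover have "finite {xs. set xs \<subseteq> set_mset M \<and> length xs \<le> size M}"
    by (rule finite_lists_length_le) simp
  ultimately show ?thesis by (meson finite_imageI finite_subset)
qed

abbreviation splits :: "'a multiset \<Rightarrow> ('a multiset \<times> 'a multiset) set" where
  "splits M \<equiv> {(K, L). K + L = M}"

lemma finite_splits [simp]: "finite (splits M)"
proof (rule finite_subset)
  show "splits M \<subseteq> {K. K \<subseteq># M} \<times> {K. K \<subseteq># M}" by auto
  show "finite ({K. K \<subseteq># M} \<times> {K. K \<subseteq># M})" by (simp add: finite_submultisets)
qed

lemma finite_splits' [simp]: "finite {p. fst p + snd p = (M :: 'a multiset)}"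
  using finite_splits[of M] by (simp add: case_prod_unfold)

lemma sum_splits_swap: "(\<Sum>(K, L)\<in>splits M. f K L) = (\<Sum>(K, L)\<in>splits M. f L K)"
  by (rule sum.reindex_bij_witness[of _ "\<lambda>(K, L). (L, K)" "\<lambda>(K, L). (L, K)"])
    (auto simp: add.commute)

text \<open>Both sides run over the ordered factorizations of M into three monomials. This is the
  associativity of the Cauchy product.\<close>

lemma sum_splits_assoc:
  "(\<Sum>(N, L)\<in>splits M. \<Sum>(H, K)\<in>splits N. f H K L) =
    (\<Sum>(H, N)\<in>splits M. \<Sum>(K, L)\<in>splits N. f H K L)"
proof -
  have "(\<Sum>(N, L)\<in>splits M. \<Sum>(H, K)\<in>splits N. f H K L) =
      (\<Sum>((N, L), (H, K))\<in>(SIGMA NL:splits M. splits (fst NL)). f H K L)"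
    by (subst sum.Sigma[symmetric]) (auto simp: case_prod_unfold)
  also have "\<dots> = (\<Sum>((H, N), (K, L))\<in>(SIGMA HN:splits M. splits (snd HN)). f H K L)"
    by (rule sum.reindex_bij_witness[of _ "\<lambda>((H, N), (K, L)). ((H + K, L), (H, K))"
          "\<lambda>((N, L), (H, K)). ((H, K + L), (K, L))"]) (auto simp: add.assoc)
  also have "\<dots> = (\<Sum>(H, N)\<in>splits M. \<Sum>(K, L)\<in>splits N. f H K L)"
    by (subst sum.Sigma[symmetric]) (auto simp: case_prod_unfold)
  finally show ?thesis .
qed

lemma sum_splits_delta_left:
  fixes f :: "'a multiset \<Rightarrow> 'b::comm_monoid_add"
  shows "(\<Sum>(K, L)\<in>splits M. if K = {#} then f L else 0) = f M"
proof -
  have "(\<Sum>(K, L)\<in>splits M. if K = {#} then f L else 0) =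
      (\<Sum>(K, L)\<in>{({#} :: 'a multiset, M)}. f L)"
    by (intro sum.mono_neutral_cong_right) (auto split: if_splits)
  then show ?thesis by simp
qed

text \<open>Series with ring coefficients get a type of their own, because \<open>Function_Algebras\<close> already
  makes the function type a ring under the pointwise product.\<close>

typedef 'a ser = "UNIV :: 'a series set"
  morphisms coeff Ser by simp

lemma coeff_Ser [simp]: "coeff (Ser f) = f"
  by (simp add: Ser_inverse)

lemma ser_eqI: "(\<And>M. coeff s M = coeff t M) \<Longrightarrow> s = t"
  by (metis coeff_inverse ext)

instantiation ser :: (ring_1) ring_1
begin

definition "0 = Ser (\<lambda>M. 0)"
definition "1 = Ser (\<lambda>M. if M = {#} then 1 else 0)"
definition "s + t = Ser (\<lambda>M. coeff s M + coeff t M)"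
definition "s - t = Ser (\<lambda>M. coeff s M - coeff t M)"
definition "- s = Ser (\<lambda>M. - coeff s M)"
definition "s * t = Ser (\<lambda>M. \<Sum>(K, L)\<in>splits M. coeff s K * coeff t L)"

instance
proof
  fix a b c :: "'a ser"
  show "a + b + c = a + (b + c)" by (simp add: plus_ser_def add.assoc)
  show "a * b * c = a * (b * c)"
  proof (rule ser_eqI)
    fix M
    show "coeff (a * b * c) M = coeff (a * (b * c)) M"
      using sum_splits_assoc[of "\<lambda>H K L. coeff a H * coeff b K * coeff c L" M]
      by (simp add: times_ser_def sum_distrib_left sum_distrib_right case_prod_unfold mult.assoc)
  qed
  show "1 * a = a"
  proof (rule ser_eqI)
    fix M
    have "coeff (1 * a) M = (\<Sum>(K, L)\<in>splits M. if K = {#} then coeff a L else 0)"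
      by (auto simp: times_ser_def one_ser_def intro!: sum.cong)
    then show "coeff (1 * a) M = coeff a M" by (simp only: sum_splits_delta_left)
  qed
  show "a * 1 = a"
  proof (rule ser_eqI)
    fix M
    have "coeff (a * 1) M = (\<Sum>(K, L)\<in>splits M. if L = {#} then coeff a K else 0)"
      by (auto simp: times_ser_def one_ser_def intro!: sum.cong)
    also have "\<dots> = (\<Sum>(K, L)\<in>splits M. if K = {#} then coeff a L else 0)"
      by (rule sum_splits_swap)
    finally show "coeff (a * 1) M = coeff a M" by (simp only: sum_splits_delta_left)
  qed
  show "(a + b) * c = a * c + b * c"
    by (auto simp: times_ser_def plus_ser_def distrib_right sum.distrib case_prod_unfold)
  show "a * (b + c) = a * b + a * c"
    by (auto simp: times_ser_def plus_ser_def distrib_left sum.distrib case_prod_unfold)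
  show "(0 :: 'a ser) \<noteq> 1"
  proof
    assume "(0 :: 'a ser) = 1"
    then have "coeff (0 :: 'a ser) {#} = coeff 1 {#}" by simp
    then show False by (simp add: zero_ser_def one_ser_def)
  qed
qed (simp_all add: plus_ser_def zero_ser_def minus_ser_def uminus_ser_def add.commute coeff_inverse)

end

lemma coeff_zero [simp]: "coeff 0 M = 0"
  and coeff_one: "coeff 1 M = (if M = {#} then 1 else 0)"
  and coeff_add [simp]: "coeff (s + t) M = coeff s M + coeff t M"
  and coeff_diff [simp]: "coeff (s - t) M = coeff s M - coeff t M"
  and coeff_uminus [simp]: "coeff (- s) M = - coeff s M"
  and coeff_mult: "coeff (s * t) M = (\<Sum>(K, L)\<in>splits M. coeff s K * coeff t L)"
  by (simp_all add: zero_ser_def one_ser_def plus_ser_def minus_ser_def uminus_ser_def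
      times_ser_def)

lemma coeff_sum [simp]: "coeff (sum f A) M = (\<Sum>i\<in>A. coeff (f i) M)"
  by (induction A rule: infinite_finite_induct) auto

lemma coeff_mult_empty [simp]: "coeff (s * t) {#} = coeff s {#} * coeff t {#}"
  by (simp add: coeff_mult)

section \<open>The filtration of series by order\<close>

definition order_ge :: "nat \<Rightarrow> 'a::ring_1 ser \<Rightarrow> bool" where
  "order_ge n s \<longleftrightarrow> (\<forall>M. size M < n \<longrightarrow> coeff s M = 0)"

lemma order_ge_mult:
  assumes "order_ge m s" "order_ge n t"
  shows "order_ge (m + n) (s * t)"
  unfolding order_ge_def
proof (intro allI impI)
  fix M :: monomial assume M: "size M < m + n"
  have "coeff s K * coeff t L = 0" if "K + L = M" for K L
  proof -
    have "size K < m \<or> size L < n" using M that by auto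
    then show ?thesis using assms by (auto simp: order_ge_def)
  qed
  then show "coeff (s * t) M = 0" by (auto simp: coeff_mult intro!: sum.neutral)
qed

lemma order_ge_0 [simp]: "order_ge 0 s"
  by (simp add: order_ge_def)

lemma order_ge_1: "order_ge 1 s \<longleftrightarrow> coeff s {#} = 0"
  by (auto simp: order_ge_def)

lemma order_ge_diff: "order_ge n s \<Longrightarrow> order_ge n t \<Longrightarrow> order_ge n (s - t)"
  by (simp add: order_ge_def)

lemma order_ge_power: "coeff s {#} = 0 \<Longrightarrow> order_ge n (s ^ n)"
proof (induction n)
  case (Suc n)
  then show ?case using order_ge_mult[of 1 s n "s ^ n"] order_ge_1[of s] by simp
qed simp

section \<open>The exponential and its derivative\<close>

definition comm :: "'a::ring \<Rightarrow> 'a \<Rightarrow> 'a" where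
  "comm a b = a * b - b * a"

lemma mult_eq_comm: "a * b = comm a b + b * a"
  by (simp add: comm_def)

lemma comm_self [simp]: "comm a a = 0"
  by (simp add: comm_def)

lemma comm_0_right [simp]: "comm a 0 = 0"
  by (simp add: comm_def)

text \<open>Left multiplication by s is the sum of \<open>comm s\<close> and right multiplication by
  s. These two operators commute, so this is their binomial theorem.\<close>

lemma power_mult_eq_sum_comm:
  fixes s y :: "'a::ring_1"
  shows "s ^ n * y = (\<Sum>k\<le>n. of_nat (n choose k) * ((comm s ^^ k) y * s ^ (n - k)))"
proof (induction n)
  case (Suc n)
  define T where "T = (\<lambda>k. (comm s ^^ k) y * s ^ (Suc n - k))"
  have step: "s * ((comm s ^^ k) y * s ^ (n - k)) = T (Suc k) + T k" if "k \<le> n" for k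
  proof -
    have "s * ((comm s ^^ k) y * s ^ (n - k)) = (s * (comm s ^^ k) y) * s ^ (n - k)"
      by (simp add: mult.assoc)
    also have "\<dots> = (comm s ^^ Suc k) y * s ^ (n - k) + (comm s ^^ k) y * (s * s ^ (n - k))"
      by (subst mult_eq_comm) (simp add: distrib_right mult.assoc)
    finally show ?thesis using that by (simp add: T_def Suc_diff_le)
  qed
  have "s ^ Suc n * y = s * (s ^ n * y)" by (simp add: mult.assoc)
  also have "\<dots> = (\<Sum>k\<le>n. of_nat (n choose k) * (s * ((comm s ^^ k) y * s ^ (n - k))))"
    by (simp add: Suc.IH sum_distrib_left mult_of_nat_commute mult.assoc)
  also have "\<dots> = (\<Sum>k\<le>n. of_nat (n choose k) * T (Suc k)) + (\<Sum>k\<le>n. of_nat (n choose k) * T k)"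
    by (simp add: step distrib_left sum.distrib)
  also have "(\<Sum>k\<le>n. of_nat (n choose k) * T k) = (\<Sum>k\<le>Suc n. of_nat (n choose k) * T k)"
    by (simp add: binomial_eq_0)
  also have "\<dots> = T 0 + (\<Sum>k\<le>n. of_nat (n choose Suc k) * T (Suc k))"
    by (subst sum.atMost_Suc_shift) simp
  also have "(\<Sum>k\<le>n. of_nat (n choose k) * T (Suc k)) +
      (T 0 + (\<Sum>k\<le>n. of_nat (n choose Suc k) * T (Suc k))) =
      T 0 + (\<Sum>k\<le>n. of_nat (Suc n choose Suc k) * T (Suc k))"
    by (simp add: distrib_right sum.distrib add_ac)
  also have "\<dots> = (\<Sum>k\<le>Suc n. of_nat (Suc n choose k) * T k)"
    by (subst sum.atMost_Suc_shift) simp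
  finally show ?case by (simp add: T_def)
qed simp

text \<open>By the Leibniz rule, D (s^(n+1)) is the sum of s^i (D s) s^(n-i) over i up to n. Moving
  each s^i to the right by the binomial formula and adding up C(i, k) over i gives C(n+1, k+1). The
  induction does this one factor at a time by Pascal's rule.\<close>

lemma derivation_power_eq_sum_comm:
  fixes s :: "'a::ring_1"
  assumes D: "\<And>a b. D (a * b) = D a * b + a * D b"
  shows "D (s ^ Suc n) =
    (\<Sum>k\<le>n. of_nat (Suc n choose Suc k) * ((comm s ^^ k) (D s) * s ^ (n - k)))"
proof (induction n)
  case (Suc n)
  define T where "T = (\<lambda>k. (comm s ^^ k) (D s) * s ^ (Suc n - k))"
  have step: "s * ((comm s ^^ k) (D s) * s ^ (n - k)) = T (Suc k) + T k" if "k \<le> n" for k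
  proof -
    have "s * ((comm s ^^ k) (D s) * s ^ (n - k)) = (s * (comm s ^^ k) (D s)) * s ^ (n - k)"
      by (simp add: mult.assoc)
    also have "\<dots> = (comm s ^^ Suc k) (D s) * s ^ (n - k) + (comm s ^^ k) (D s) * (s * s ^ (n - k))"
      by (subst mult_eq_comm) (simp add: distrib_right mult.assoc)
    finally show ?thesis using that by (simp add: T_def Suc_diff_le)
  qed
  have "D (s ^ Suc (Suc n)) = D s * s ^ Suc n + s * D (s ^ Suc n)"
    by (subst power_Suc, subst D) simp
  also have "s * D (s ^ Suc n) =
      (\<Sum>k\<le>n. of_nat (Suc n choose Suc k) * (s * ((comm s ^^ k) (D s) * s ^ (n - k))))"
    unfolding Suc.IH sum_distrib_left by (intro sum.cong refl) (metis mult.assoc mult_of_nat_commute)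
  also have "\<dots> = (\<Sum>k\<le>n. of_nat (Suc n choose Suc k) * T (Suc k)) +
      (\<Sum>k\<le>n. of_nat (Suc n choose Suc k) * T k)"
    by (simp add: step distrib_left sum.distrib del: binomial_Suc_Suc)
  also have "(\<Sum>k\<le>n. of_nat (Suc n choose Suc k) * T k) =
      (\<Sum>k\<le>Suc n. of_nat (Suc n choose Suc k) * T k)"
    by (simp add: binomial_eq_0 del: binomial_Suc_Suc)
  \<comment> \<open>The Leibniz term \<open>D s * s ^ Suc n\<close> is the \<open>T 0\<close> that
    the shifted sum lacks.\<close>
  also have "D s * s ^ Suc n + ((\<Sum>k\<le>n. of_nat (Suc n choose Suc k) * T (Suc k)) + \<dots>) =
      (T 0 + (\<Sum>k\<le>n. of_nat (Suc n choose Suc k) * T (Suc k))) + \<dots>"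
    by (simp add: T_def add.assoc)
  also have "T 0 + (\<Sum>k\<le>n. of_nat (Suc n choose Suc k) * T (Suc k)) =
      (\<Sum>k\<le>Suc n. of_nat (Suc n choose k) * T k)"
    by (subst sum.atMost_Suc_shift) simp
  also have "\<dots> + (\<Sum>k\<le>Suc n. of_nat (Suc n choose Suc k) * T k) =
      (\<Sum>k\<le>Suc n. of_nat (Suc (Suc n) choose Suc k) * T k)"
    by (subst sum.distrib[symmetric], subst distrib_right[symmetric], subst of_nat_add[symmetric])
      (simp only: binomial_Suc_Suc)
  finally show ?case by (simp only: T_def)
qed simp

text \<open>If \<open>u n\<close> has order at least n, then the terms beyond \<open>size M\<close>
  vanish at M and the cut-off loses nothing. The lemmas about infinite sums carry this order
  hypothesis.\<close>

definition ser_suminf :: "(nat \<Rightarrow> 'a::ring_1 ser) \<Rightarrow> 'a ser" where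
  "ser_suminf u = Ser (\<lambda>M. \<Sum>n\<le>size M. coeff (u n) M)"

lemma coeff_ser_suminf:
  assumes "\<And>n. order_ge n (u n)" "size M \<le> N"
  shows "coeff (ser_suminf u) M = (\<Sum>n\<le>N. coeff (u n) M)"
  unfolding ser_suminf_def coeff_Ser
  by (rule sum.mono_neutral_left) (use assms in \<open>auto simp: order_ge_def\<close>)

lemma ser_suminf_mult_right:
  assumes "\<And>n. order_ge n (u n)"
  shows "ser_suminf u * y = ser_suminf (\<lambda>n. u n * y)"
proof (rule ser_eqI)
  fix M
  have "coeff (ser_suminf u * y) M =
      (\<Sum>(K, L)\<in>splits M. (\<Sum>n\<le>size M. coeff (u n) K) * coeff y L)"
    unfolding coeff_mult
    by (intro sum.cong refl) (auto simp: coeff_ser_suminf[where N = "size M"] assms)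
  also have "\<dots> = coeff (ser_suminf (\<lambda>n. u n * y)) M"
    by (simp add: ser_suminf_def coeff_mult sum_distrib_right case_prod_unfold)
      (rule sum.swap)
  finally show "coeff (ser_suminf u * y) M = coeff (ser_suminf (\<lambda>n. u n * y)) M" .
qed

lemma ser_suminf_mult:
  assumes u: "\<And>n. order_ge n (u n)" and v: "\<And>n. order_ge n (v n)"
  shows "ser_suminf u * ser_suminf v = ser_suminf (\<lambda>n. \<Sum>i\<le>n. u i * v (n - i))"
proof (rule ser_eqI)
  fix M :: monomial
  define N where "N = size M"
  have "coeff (ser_suminf u * ser_suminf v) M =
      (\<Sum>(K, L)\<in>splits M. (\<Sum>i\<le>N. coeff (u i) K) * (\<Sum>j\<le>N. coeff (v j) L))"
    unfolding coeff_mult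
    by (intro sum.cong refl) (auto simp: coeff_ser_suminf[where N = N] u v N_def)
  also have "\<dots> = (\<Sum>(K, L)\<in>splits M. \<Sum>(i, j)\<in>{..N} \<times> {..N}. coeff (u i) K * coeff (v j) L)"
    by (simp add: sum_product sum.cartesian_product)
  also have "\<dots> = (\<Sum>(i, j)\<in>{..N} \<times> {..N}. coeff (u i * v j) M)"
    unfolding coeff_mult case_prod_unfold by (rule sum.swap)
  \<comment> \<open>The square may be cut down to the triangle because \<open>u i * v j\<close> has
    order at least i + j, and the triangle is what the convolution sums over.\<close>
  also have "\<dots> = (\<Sum>(i, j)\<in>{(i, j). i + j \<le> N}. coeff (u i * v j) M)"
  proof (rule sum.mono_neutral_right)
    show "\<forall>ij\<in>{..N} \<times> {..N} - {(i, j). i + j \<le> N}. (case ij of (i, j) \<Rightarrow> coeff (u i * v j) M) = 0"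
    proof
      fix ij assume ij: "ij \<in> {..N} \<times> {..N} - {(i, j). i + j \<le> N}"
      show "(case ij of (i, j) \<Rightarrow> coeff (u i * v j) M) = 0"
        using order_ge_mult[OF u[of "fst ij"] v[of "snd ij"]] ij
        by (auto simp: order_ge_def N_def not_le split: prod.splits)
    qed
  qed auto
  also have "\<dots> = coeff (ser_suminf (\<lambda>n. \<Sum>i\<le>n. u i * v (n - i))) M"
    by (simp add: ser_suminf_def sum.triangle_reindex_eq N_def)
  finally show "coeff (ser_suminf u * ser_suminf v) M =
      coeff (ser_suminf (\<lambda>n. \<Sum>i\<le>n. u i * v (n - i))) M" .
qed

section \<open>The Euler derivation\<close>

lemma ordA_add [simp]: "ordA (K + L) = ordA K + ordA L"
  by (simp add: ordA_def)

lemma ordB_add [simp]: "ordB (K + L) = ordB K + ordB L"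
  by (simp add: ordB_def)

lemma ordA_empty [simp]: "ordA {#} = 0" and ordB_empty [simp]: "ordB {#} = 0"
  by (simp_all add: ordA_def ordB_def)

definition euler :: "'a::ring_1 ser \<Rightarrow> 'a ser" where
  "euler s = Ser (\<lambda>M. of_nat (ordA M) * coeff s M)"

lemma coeff_euler [simp]: "coeff (euler s) M = of_nat (ordA M) * coeff s M"
  by (simp add: euler_def)

lemma euler_mult: "euler (s * t) = euler s * t + s * euler t"
proof (rule ser_eqI)
  fix M
  have "of_nat (ordA M) * (coeff s K * coeff t L) =
      of_nat (ordA K) * coeff s K * coeff t L + coeff s K * (of_nat (ordA L) * coeff t L)"
    if "K + L = M" for K L
  proof -
    have "coeff s K * (of_nat (ordA L) * coeff t L) = of_nat (ordA L) * (coeff s K * coeff t L)"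
      by (metis mult.assoc mult_of_nat_commute)
    then show ?thesis using that[symmetric] by (simp add: distrib_right mult.assoc)
  qed
  then show "coeff (euler (s * t)) M = coeff (euler s * t + s * euler t) M"
    by (auto simp: coeff_mult sum_distrib_left sum.distrib[symmetric] case_prod_unfold
        intro!: sum.cong)
qed

text \<open>An algebra over a field, encoded as a homomorphism of the field into the centre since
  \<open>ring_1\<close> carries no scalars. The instance below is \<open>const\<close>, with values
  in the free algebra.\<close>

locale central_scalars =
  fixes \<kappa> :: "'f::field_char_0 \<Rightarrow> 'a::ring_1"
  assumes \<kappa>_add: "\<kappa> (c + d) = \<kappa> c + \<kappa> d"
    and \<kappa>_mult: "\<kappa> (c * d) = \<kappa> c * \<kappa> d"
    and \<kappa>_1 [simp]: "\<kappa> 1 = 1"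
    and \<kappa>_central: "\<kappa> c * a = a * \<kappa> c"
begin

lemma \<kappa>_0 [simp]: "\<kappa> 0 = 0"
  using \<kappa>_add[of 0 0] by simp

lemma \<kappa>_of_nat [simp]: "\<kappa> (of_nat n) = of_nat n"
  by (induction n) (simp_all add: \<kappa>_add)

definition smul :: "'f \<Rightarrow> 'a ser \<Rightarrow> 'a ser" where
  "smul c s = Ser (\<lambda>M. \<kappa> c * coeff s M)"

lemma coeff_smul [simp]: "coeff (smul c s) M = \<kappa> c * coeff s M"
  by (simp add: smul_def)

lemma smul_mult_left: "smul c s * t = smul c (s * t)"
  by (rule ser_eqI) (simp add: coeff_mult sum_distrib_left case_prod_unfold mult.assoc)

lemma smul_mult_right: "s * smul c t = smul c (s * t)"
proof (rule ser_eqI)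
  fix M
  have "a * (\<kappa> c * b) = \<kappa> c * (a * b)" for a b
    by (metis \<kappa>_central mult.assoc)
  then show "coeff (s * smul c t) M = coeff (smul c (s * t)) M"
    by (simp add: coeff_mult sum_distrib_left case_prod_unfold)
qed

lemma smul_smul: "smul c (smul d s) = smul (c * d) s"
  by (rule ser_eqI) (simp add: \<kappa>_mult mult.assoc)

lemma smul_sum: "smul c (sum f A) = (\<Sum>i\<in>A. smul c (f i))"
  by (rule ser_eqI) (simp add: sum_distrib_left)

lemma coeff_of_nat_mult: "coeff (of_nat n * s) M = of_nat n * coeff s M"
  by (induction n) (auto simp: distrib_right)

lemma smul_of_nat: "smul (of_nat n) s = of_nat n * s"
  by (rule ser_eqI) (simp add: coeff_of_nat_mult)

lemma smul_1 [simp]: "smul 1 s = s"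
  by (rule ser_eqI) simp

lemma order_ge_smul: "order_ge n s \<Longrightarrow> order_ge n (smul c s)"
  by (simp add: order_ge_def)

definition ser_exp :: "'a ser \<Rightarrow> 'a ser" where
  "ser_exp s = ser_suminf (\<lambda>n. smul (1 / fact n) (s ^ n))"

text \<open>The operator f(ad s) applied to y, where f is the formal power series with coefficients
  c.\<close>

definition ad_series :: "(nat \<Rightarrow> 'f) \<Rightarrow> 'a ser \<Rightarrow> 'a ser \<Rightarrow> 'a ser" where
  "ad_series c s y = ser_suminf (\<lambda>k. smul (c k) ((comm s ^^ k) y))"

lemma order_ge_comm_pow: "coeff s {#} = 0 \<Longrightarrow> order_ge k ((comm s ^^ k) y)"
proof (induction k)
  case (Suc k)
  then show ?case
    using order_ge_mult[of 1 s k "(comm s ^^ k) y"] order_ge_mult[of k "(comm s ^^ k) y" 1 s]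
      order_ge_1[of s] by (simp add: comm_def[of s "(comm s ^^ k) y"] order_ge_diff)
qed simp

text \<open>The exponential of left multiplication by s factors into e^(ad s) and right
  multiplication by e^s, as in the binomial formula above. On coefficients this is C(n, k) / n! = 1
  / (k! (n-k)!).\<close>

lemma ser_exp_mult:
  assumes s: "coeff s {#} = 0"
  shows "ser_exp s * y = ad_series (\<lambda>k. 1 / fact k) s y * ser_exp s"
proof -
  have "ser_exp s * y = ser_suminf (\<lambda>n. smul (1 / fact n) (s ^ n * y))"
    unfolding ser_exp_def
    by (subst ser_suminf_mult_right) (simp_all add: smul_mult_left order_ge_smul order_ge_power s)
  also have "(\<lambda>n. smul (1 / fact n) (s ^ n * y)) =
      (\<lambda>n. \<Sum>k\<le>n. smul (1 / fact k) ((comm s ^^ k) y) * smul (1 / fact (n - k)) (s ^ (n - k)))"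
  proof
    fix n
    have "smul (1 / fact n) (of_nat (n choose k) * t) = smul (1 / fact k * (1 / fact (n - k))) t"
      if "k \<le> n" for k t
    proof -
      have "(1 / fact n :: 'f) * of_nat (n choose k) = 1 / fact k * (1 / fact (n - k))"
        by (simp add: binomial_fact[OF that])
      then show ?thesis by (simp only: smul_smul smul_of_nat[symmetric])
    qed
    then show "smul (1 / fact n) (s ^ n * y) =
      (\<Sum>k\<le>n. smul (1 / fact k) ((comm s ^^ k) y) * smul (1 / fact (n - k)) (s ^ (n - k)))"
      unfolding power_mult_eq_sum_comm smul_sum smul_mult_left smul_mult_right smul_smul
      by (intro sum.cong refl) (simp add: mult.commute)
  qed
  also have "ser_suminf \<dots> = ad_series (\<lambda>k. 1 / fact k) s y * ser_exp s"
    unfolding ser_exp_def ad_series_def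
    by (rule ser_suminf_mult[symmetric]) (auto intro!: order_ge_smul order_ge_power order_ge_comm_pow s)
  finally show ?thesis .
qed

text \<open>The coefficients \<open>1 / (k + 1)!\<close> are those of \<open>\<phi>(z) = (e\<^sup>z - 1) / z\<close>.\<close>

lemma euler_ser_exp:
  assumes s: "coeff s {#} = 0"
  shows "euler (ser_exp s) = ad_series (\<lambda>k. 1 / fact (Suc k)) s (euler s) * ser_exp s"
proof -
  have small: "order_ge n (smul (1 / fact n) (s ^ n))" for n
    by (intro order_ge_smul order_ge_power s)
  have "euler (ser_exp s) = ser_suminf (\<lambda>n. smul (1 / fact (Suc n)) (euler (s ^ Suc n)))"
  proof (rule ser_eqI)
    fix M
    \<comment> \<open>One term more than necessary is summed: the derivation kills the term n = 0,
      and the index shift then leaves a sum up to \<open>size M\<close>.\<close>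
    have "coeff (euler (ser_exp s)) M =
        of_nat (ordA M) * (\<Sum>n\<le>Suc (size M). coeff (smul (1 / fact n) (s ^ n)) M)"
      unfolding ser_exp_def coeff_euler by (subst coeff_ser_suminf[OF small, where N = "Suc (size M)"]) auto
    also have "\<dots> = (\<Sum>n\<le>Suc (size M). coeff (smul (1 / fact n) (euler (s ^ n))) M)"
    proof -
      have "of_nat m * (\<kappa> c * t) = \<kappa> c * (of_nat m * t)" for m c t
        by (metis mult.assoc mult_of_nat_commute)
      then show ?thesis by (simp only: sum_distrib_left coeff_smul coeff_euler)
    qed
    also have "\<dots> = coeff (ser_suminf (\<lambda>n. smul (1 / fact (Suc n)) (euler (s ^ Suc n)))) M"
      by (subst sum.atMost_Suc_shift) (simp add: ser_suminf_def coeff_one)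
    finally show "coeff (euler (ser_exp s)) M =
        coeff (ser_suminf (\<lambda>n. smul (1 / fact (Suc n)) (euler (s ^ Suc n)))) M" .
  qed
  also have "(\<lambda>n. smul (1 / fact (Suc n)) (euler (s ^ Suc n))) =
      (\<lambda>n. \<Sum>k\<le>n. smul (1 / fact (Suc k)) ((comm s ^^ k) (euler s)) *
        smul (1 / fact (n - k)) (s ^ (n - k)))"
  proof
    fix n
    \<comment> \<open>C(n+1, k+1) / (n+1)! = 1 / ((k+1)! (n-k)!), which separates the coefficients
      of phi from those of the exponential.\<close>
    have "smul (1 / fact (Suc n)) (of_nat (Suc n choose Suc k) * t) =
        smul (1 / fact (Suc k) * (1 / fact (n - k))) t" if "k \<le> n" for k t
    proof -
      have "(1 / fact (Suc n) :: 'f) * of_nat (Suc n choose Suc k) =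
          1 / fact (Suc k) * (1 / fact (n - k))"
        using that by (subst binomial_fact) (simp_all del: fact_Suc)
      then show ?thesis by (simp only: smul_smul smul_of_nat[symmetric])
    qed
    then show "smul (1 / fact (Suc n)) (euler (s ^ Suc n)) =
      (\<Sum>k\<le>n. smul (1 / fact (Suc k)) ((comm s ^^ k) (euler s)) *
        smul (1 / fact (n - k)) (s ^ (n - k)))"
      unfolding derivation_power_eq_sum_comm[where D = euler, OF euler_mult]
        smul_sum smul_mult_left smul_mult_right smul_smul
      by (intro sum.cong refl) (simp add: mult_ac)
  qed
  also have "ser_suminf \<dots> = ad_series (\<lambda>k. 1 / fact (Suc k)) s (euler s) * ser_exp s"
    unfolding ser_exp_def ad_series_def
    by (rule ser_suminf_mult[symmetric]) (auto intro!: order_ge_smul order_ge_power order_ge_comm_pow s)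
  finally show ?thesis .
qed

end

section \<open>The action of a Lie algebra on its symmetric algebra\<close>

locale vspace = vector_space scale
  for scale :: "'a::field \<Rightarrow> 'b::ab_group_add \<Rightarrow> 'b"
begin

text \<open>Finitely supported functions form the free vector space on the index type;
  \<open>lin g\<close> is the linear map that takes the basis vector i to
  \<open>g i\<close>.\<close>

definition lin :: "('i \<Rightarrow> 'b) \<Rightarrow> ('i \<Rightarrow>\<^sub>0 'a) \<Rightarrow> 'b" where
  "lin g t = (\<Sum>i\<in>Poly_Mapping.keys t. scale (Poly_Mapping.lookup t i) (g i))"

lemma lin_superset:
  assumes "finite I" "Poly_Mapping.keys t \<subseteq> I"
  shows "lin g t = (\<Sum>i\<in>I. scale (Poly_Mapping.lookup t i) (g i))"
  unfolding lin_def
  by (rule sum.mono_neutral_left) (use assms in \<open>auto simp: in_keys_iff\<close>)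

lemma lin_0 [simp]: "lin g 0 = 0"
  by (simp add: lin_def)

lemma lin_single [simp]: "lin g (Poly_Mapping.single i c) = scale c (g i)"
  by (simp add: lin_def)

lemma lin_add: "lin g (s + t) = lin g s + lin g t"
proof -
  define I where "I = Poly_Mapping.keys s \<union> Poly_Mapping.keys t"
  have "Poly_Mapping.keys (s + t) \<subseteq> I" "finite I"
    using Poly_Mapping.keys_add[of s t] by (auto simp: I_def)
  then show ?thesis
    using lin_superset[of I "s + t" g] lin_superset[of I s g] lin_superset[of I t g]
    by (simp add: I_def lookup_add scale_left_distrib sum.distrib)
qed

lemma lin_uminus: "lin g (- t) = - lin g t"
  by (rule minus_unique[symmetric]) (simp add: lin_add[symmetric])

lemma lin_diff: "lin g (s - t) = lin g s - lin g t"
  using lin_add[of g s "- t"] by (simp add: lin_uminus)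

lemma lin_cong: "(\<And>i. i \<in> Poly_Mapping.keys t \<Longrightarrow> g i = h i) \<Longrightarrow> lin g t = lin h t"
  by (simp add: lin_def)

lemma lin_fun_add: "lin (\<lambda>i. g i + h i) t = lin g t + lin h t"
  by (simp add: lin_def scale_right_distrib sum.distrib)

lemma lin_fun_diff: "lin (\<lambda>i. g i - h i) t = lin g t - lin h t"
  by (simp add: lin_def scale_right_diff_distrib sum_subtractf)

lemma lin_swap: "lin (\<lambda>i. lin (g i) t) s = lin (\<lambda>j. lin (\<lambda>i. g i j) s) t"
  unfolding lin_def scale_sum_right
  by (subst sum.swap) (simp add: mult.commute)

end

definition pscale :: "'f::field \<Rightarrow> ('i \<Rightarrow>\<^sub>0 'f) \<Rightarrow> ('i \<Rightarrow>\<^sub>0 'f)" where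
  "pscale c t = Poly_Mapping.map ((*) c) t"

lemma lookup_pscale [simp]: "Poly_Mapping.lookup (pscale c t) i = c * Poly_Mapping.lookup t i"
  by (simp add: pscale_def Poly_Mapping.map.rep_eq when_def)

interpretation poly: vspace pscale
  by unfold_locales (auto intro!: poly_mapping_eqI simp: lookup_add algebra_simps)

lemma pscale_single [simp]:
  "pscale c (Poly_Mapping.single i d) = Poly_Mapping.single i (c * d)"
  by (rule poly_mapping_eqI) (simp add: lookup_single when_def)

lemma keys_pscale_subset: "Poly_Mapping.keys (pscale c t) \<subseteq> Poly_Mapping.keys t"
  by (auto simp: in_keys_iff)

lemma (in vspace) lin_pscale: "lin g (pscale c t) = scale c (lin g t)"
  using lin_superset[OF _ keys_pscale_subset, of t g c]
  by (simp add: lin_def scale_sum_right)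

lemma (in vspace) lin_lin: "lin g (poly.lin h t) = lin (\<lambda>i. lin g (h i)) t"
proof -
  have "lin g (\<Sum>i\<in>I. pscale (c i) (h i)) = (\<Sum>i\<in>I. scale (c i) (lin g (h i)))" for I c
    by (induction I rule: infinite_finite_induct) (simp_all add: lin_add lin_pscale)
  then show ?thesis by (simp add: lin_def poly.lin_def)
qed

lemma keys_poly_lin:
  assumes "K \<in> Poly_Mapping.keys (poly.lin g t)"
  obtains i where "i \<in> Poly_Mapping.keys t" "K \<in> Poly_Mapping.keys (g i)"
proof -
  have "Poly_Mapping.lookup (poly.lin g t) K =
      (\<Sum>i\<in>Poly_Mapping.keys t. Poly_Mapping.lookup t i * Poly_Mapping.lookup (g i) K)"
    by (simp add: poly.lin_def lookup_sum)
  then have "(\<Sum>i\<in>Poly_Mapping.keys t. Poly_Mapping.lookup t i * Poly_Mapping.lookup (g i) K) \<noteq> 0"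
    using assms by (simp add: in_keys_iff)
  then obtain i where "i \<in> Poly_Mapping.keys t"
      "Poly_Mapping.lookup t i * Poly_Mapping.lookup (g i) K \<noteq> 0"
    by (rule sum.not_neutral_contains_not_neutral)
  then show ?thesis by (intro that[of i]) (simp_all add: in_keys_iff)
qed

lemma poly_lin_single: "poly.lin (\<lambda>i. Poly_Mapping.single i 1) t = t"
proof (rule poly_mapping_eqI)
  fix K
  have "Poly_Mapping.lookup (poly.lin (\<lambda>i. Poly_Mapping.single i 1) t) K =
      (\<Sum>i\<in>Poly_Mapping.keys t. if i = K then Poly_Mapping.lookup t i else 0)"
    by (simp add: poly.lin_def lookup_sum lookup_single when_def)
  also have "\<dots> = Poly_Mapping.lookup t K"
    by (simp add: in_keys_iff)
  finally show "Poly_Mapping.lookup (poly.lin (\<lambda>i. Poly_Mapping.single i 1) t) K =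
    Poly_Mapping.lookup t K" .
qed

context lie_algebra
begin

lemma bracket_0_left [simp]: "bracket 0 y = 0"
  using bracket_add_left[of 0 0 y] by simp

lemma bracket_0_right [simp]: "bracket x 0 = 0"
  using bracket_add_right[of x 0 0] by simp

lemma bracket_uminus_right: "bracket y (- x) = - bracket y x"
  by (rule minus_unique[symmetric]) (simp add: bracket_add_right[symmetric])

lemma bracket_swap: "bracket x y = - bracket y x"
proof -
  have "bracket (x + y) (x + y) = bracket x y + bracket y x"
    unfolding bracket_add_left bracket_add_right by (simp add: bracket_self)
  then have "bracket x y + bracket y x = 0" by (metis bracket_self)
  then show ?thesis by (simp only: eq_neg_iff_add_eq_0)
qed

end

text \<open>The order fixes in which order the factors of a monomial are applied. Monomials are
  finite, so a linear order is enough for least factors to exist.\<close>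

locale ordered_basis_lie_algebra = lie_algebra scale bracket + vspace scale + ord: linorder le lt
  for scale :: "'f::field_char_0 \<Rightarrow> 'p::ab_group_add \<Rightarrow> 'p"
    and bracket :: "'p \<Rightarrow> 'p \<Rightarrow> 'p"
    and le lt :: "'p \<Rightarrow> 'p \<Rightarrow> bool" +
  fixes B :: "'p set"
  assumes independent_B: "independent B" and span_B: "span B = UNIV"
begin

definition rep :: "'p \<Rightarrow> 'p \<Rightarrow>\<^sub>0 'f" where
  "rep x = Abs_poly_mapping (representation B x)"

lemma lookup_rep: "Poly_Mapping.lookup (rep x) = representation B x"
  by (simp add: rep_def finite_representation)

lemma rep_add: "rep (x + y) = rep x + rep y"
  by (rule poly_mapping_eqI)
    (simp add: lookup_rep lookup_add representation_add[OF independent_B] span_B)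

lemma rep_scale: "rep (scale c x) = pscale c (rep x)"
  by (rule poly_mapping_eqI) (simp add: lookup_rep representation_scale[OF independent_B] span_B)

lemma rep_0 [simp]: "rep 0 = 0"
  using rep_add[of 0 0] by simp

lemma rep_uminus: "rep (- x) = - rep x"
  by (rule minus_unique[symmetric]) (simp add: rep_add[symmetric])

lemma rep_basis: "b \<in> B \<Longrightarrow> rep b = Poly_Mapping.single b 1"
  by (rule poly_mapping_eqI)
    (auto simp: lookup_rep representation_basis[OF independent_B] lookup_single when_def)

lemma keys_rep: "Poly_Mapping.keys (rep x) \<subseteq> B"
  by (auto simp: in_keys_iff lookup_rep intro: representation_ne_zero)

lemma lin_rep: "lin (\<lambda>b. b) (rep x) = x"
  using sum_nonzero_representation_eq[OF independent_B, of x] span_B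
  by (simp add: lin_def lookup_rep keys.rep_eq)

abbreviation mono_of :: "'p multiset \<Rightarrow> 'p multiset \<Rightarrow>\<^sub>0 'f" where
  "mono_of M \<equiv> Poly_Mapping.single M 1"

definition below :: "'p \<Rightarrow> 'p multiset \<Rightarrow> bool" where
  "below b M \<longleftrightarrow> (\<forall>x\<in>#M. le b x)"

definition least :: "'p multiset \<Rightarrow> 'p" where
  "least M = ord.Min (set_mset M)"

abbreviation rest :: "'p multiset \<Rightarrow> 'p multiset" where
  "rest M \<equiv> M - {#least M#}"

lemma least_in: "M \<noteq> {#} \<Longrightarrow> least M \<in># M"
  by (simp add: least_def ord.Min_in)

lemma least_le: "x \<in># M \<Longrightarrow> le (least M) x"
  by (simp add: least_def ord.Min_le)

lemma size_rest: "M \<noteq> {#} \<Longrightarrow> size (rest M) < size M"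
  by (simp add: least_in size_Diff1_less)

lemma below_empty [simp]: "below b {#}"
  by (simp add: below_def)

text \<open>The action of the basis element \<open>b\<close> on the monomial \<open>M\<close> of the symmetric algebra. If \<open>b\<close> is
  not below \<open>M\<close>, then \<open>M = m T\<close> with \<open>m\<close> least, and \<open>b (m T) = m (b T) + [b, m] T\<close>, where the
  leading term of \<open>b T\<close> has been split off to make the recursion terminate. The restriction on
  \<open>size K\<close> is vacuous, see \<open>bounded_act_diff\<close>.\<close>

function act :: "'p \<Rightarrow> 'p multiset \<Rightarrow> ('p multiset \<Rightarrow>\<^sub>0 'f)" where
  "act b M =
    (if below b M then mono_of (add_mset b M)
     else mono_of (add_mset b M) +
       (\<Sum>K\<in>{K \<in> Poly_Mapping.keys (act b (rest M) - mono_of (add_mset b (rest M))). size K < size M}.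
         pscale (Poly_Mapping.lookup (act b (rest M) - mono_of (add_mset b (rest M))) K)
           (act (least M) K)) +
       (\<Sum>c\<in>Poly_Mapping.keys (rep (bracket b (least M))).
         pscale (Poly_Mapping.lookup (rep (bracket b (least M))) c) (act c (rest M))))"
  by auto
termination
  by (relation "measure (\<lambda>(b, M). size M)") (auto intro!: size_rest)

declare act.simps [simp del]

text \<open>The degree filtration of the symmetric algebra. Monomials are multisets over the whole
  type, so the restriction to factors from B has to be part of it.\<close>

definition bounded :: "nat \<Rightarrow> ('p multiset \<Rightarrow>\<^sub>0 'f) \<Rightarrow> bool" where
  "bounded n v \<longleftrightarrow> (\<forall>K\<in>Poly_Mapping.keys v. set_mset K \<subseteq> B \<and> size K \<le> n)"

lemma bounded_0 [simp]: "bounded n 0"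
  by (simp add: bounded_def)

lemma bounded_add: "bounded n v \<Longrightarrow> bounded n w \<Longrightarrow> bounded n (v + w)"
  unfolding bounded_def using Poly_Mapping.keys_add[of v w] by blast

lemma bounded_lin:
  assumes "\<And>i. i \<in> Poly_Mapping.keys t \<Longrightarrow> bounded n (g i)"
  shows "bounded n (poly.lin g t)"
  using assms unfolding bounded_def by (metis keys_poly_lin)

lemma bounded_single: "bounded n (Poly_Mapping.single K c) \<longleftrightarrow> c = 0 \<or> (set_mset K \<subseteq> B \<and> size K \<le> n)"
  by (simp add: bounded_def)

lemma bounded_mono: "bounded m v \<Longrightarrow> m \<le> n \<Longrightarrow> bounded n v"
  by (force simp: bounded_def)

text \<open>Apart from the leading term, the recursion lets basis elements act only on monomials
  shorter than M, and by induction one action raises the degree by at most one.\<close>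

lemma bounded_act_diff:
  assumes "b \<in> B" "set_mset M \<subseteq> B"
  shows "bounded (size M) (act b M - mono_of (add_mset b M))"
  using assms
proof (induction "size M" arbitrary: b M rule: less_induct)
  case less
  show ?case
  proof (cases "below b M")
    case True
    then show ?thesis by (simp add: act.simps[of b M])
  next
    case False
    then have M: "M \<noteq> {#}" by auto
    define m T where "m = least M" and "T = rest M"
    have T: "size M = Suc (size T)" "set_mset T \<subseteq> B" "m \<in> B"
    proof -
      show "size M = Suc (size T)"
        using size_Suc_Diff1[OF least_in[OF M]] by (simp add: T_def)
      show "set_mset T \<subseteq> B" "m \<in> B"
        using less.prems least_in[OF M] by (auto simp: T_def m_def dest: in_diffD)
    qed
    have act: "bounded (size M) (act c K)" if "c \<in> B" "set_mset K \<subseteq> B" "size K < size M" for c K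
    proof -
      have "bounded (size M) (act c K - mono_of (add_mset c K))"
        using bounded_mono[OF less.hyps[OF that(3,1,2)]] that(3) by simp
      moreover have "bounded (size M) (mono_of (add_mset c K))"
        using that by (simp add: bounded_single)
      ultimately have "bounded (size M) (act c K - mono_of (add_mset c K) + mono_of (add_mset c K))"
        by (rule bounded_add)
      then show ?thesis by simp
    qed
    define w where "w = act b T - mono_of (add_mset b T)"
    have w: "bounded (size T) w"
      unfolding w_def by (rule less.hyps) (use T less.prems in auto)
    have sum: "bounded (size M) (\<Sum>K\<in>I. pscale (c K) (h K))"
      if "\<And>K. K \<in> I \<Longrightarrow> bounded (size M) (h K)" for I c and h :: "'z \<Rightarrow> _"
      using that
    proof (induction I rule: infinite_finite_induct)
      case (insert x F)
      have "bounded (size M) (pscale (c x) (h x))"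
        using insert.prems keys_pscale_subset[of "c x" "h x"] unfolding bounded_def by blast
      then show ?case using insert by (simp add: bounded_add)
    qed simp_all
    have "bounded (size M) ((\<Sum>K\<in>{K \<in> Poly_Mapping.keys w. size K < size M}.
         pscale (Poly_Mapping.lookup w K) (act m K)) +
       (\<Sum>c\<in>Poly_Mapping.keys (rep (bracket b m)).
         pscale (Poly_Mapping.lookup (rep (bracket b m)) c) (act c T)))"
      using w keys_rep T by (intro bounded_add sum act) (auto simp: bounded_def)
    then show ?thesis using False by (simp add: act.simps[of b M] w_def m_def T_def add.assoc)
  qed
qed

definition rho :: "'p \<Rightarrow> ('p multiset \<Rightarrow>\<^sub>0 'f) \<Rightarrow> ('p multiset \<Rightarrow>\<^sub>0 'f)" where
  "rho x v = poly.lin (\<lambda>b. poly.lin (act b) v) (rep x)"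

lemma rho_basis: "b \<in> B \<Longrightarrow> rho b v = poly.lin (act b) v"
  by (simp add: rho_def rep_basis)

lemma rho_mono: "rho x (mono_of M) = poly.lin (\<lambda>b. act b M) (rep x)"
  by (simp add: rho_def)

lemma rho_add_left: "rho (x + y) v = rho x v + rho y v"
  by (simp add: rho_def rep_add poly.lin_add)

lemma rho_scale_left: "rho (scale c x) v = pscale c (rho x v)"
  by (simp add: rho_def rep_scale poly.lin_pscale)

lemma rho_uminus_left: "rho (- x) v = - rho x v"
  by (simp add: rho_def rep_uminus poly.lin_uminus)

lemma rho_add_right: "rho x (v + w) = rho x v + rho x w"
  by (simp add: rho_def poly.lin_add poly.lin_fun_add)

lemma rho_diff_right: "rho x (v - w) = rho x v - rho x w"
  by (simp add: rho_def poly.lin_diff poly.lin_fun_diff)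

lemma rho_0_left [simp]: "rho 0 v = 0"
  by (simp add: rho_def)

lemma rho_lin: "rho x (poly.lin g t) = poly.lin (\<lambda>i. rho x (g i)) t"
  unfolding rho_def poly.lin_lin by (rule poly.lin_swap)

lemma rho_below:
  assumes "b \<in> B" "below b M"
  shows "rho b (mono_of M) = mono_of (add_mset b M)"
  using assms by (simp add: rho_basis act.simps[of b M])

lemma below_add_mset: "below b (add_mset c M) \<longleftrightarrow> le b c \<and> below b M"
  by (auto simp: below_def)

text \<open>The recursion of \<open>act\<close> read backwards. The least factor of the monomial b T
  is b, so the clause for a acting on b T is the commutation rule itself, once the removed leading
  term is restored.\<close>

lemma rho_not_below:
  assumes a: "a \<in> B" and b: "b \<in> B" and T: "set_mset T \<subseteq> B"
    and "below b T" and "lt b a"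
  shows "rho a (rho b (mono_of T)) =
    rho b (rho a (mono_of T)) + rho (bracket a b) (mono_of T)"
proof -
  define M where "M = add_mset b T"
  have nb: "\<not> below a M"
    using assms(5) by (simp add: M_def below_add_mset ord.not_le)
  have "le b (least M)" using least_in[of M] assms(4) by (auto simp: M_def below_def)
  moreover have "le (least M) b" by (rule least_le) (simp add: M_def)
  ultimately have least: "least M = b" by (rule ord.order.antisym[symmetric])
  have rest: "M - {#b#} = T" by (simp add: M_def)
  define w where "w = act a T - mono_of (add_mset a T)"
  have w: "bounded (size T) w" unfolding w_def by (rule bounded_act_diff) (use a T in auto)
  then have eq: "{K \<in> Poly_Mapping.keys w. size K < size M} = Poly_Mapping.keys w"
    by (auto simp: bounded_def M_def)
  have "act a M = mono_of (add_mset a M) + poly.lin (act b) w + rho (bracket a b) (mono_of T)"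
    using nb eq by (simp add: act.simps[of a M] least rest w_def poly.lin_def[of "act b"]
        poly.lin_def[of "\<lambda>c. act c T"] rho_mono)
  also have "poly.lin (act b) w = rho b (rho a (mono_of T)) - rho b (mono_of (add_mset a T))"
    using a b by (simp add: w_def rho_basis poly.lin_diff)
  \<comment> \<open>Since b is below a T, the leading term that w lacks is acted on without
    correction. It then cancels the leading term of \<open>act a M\<close>.\<close>
  also have "rho b (mono_of (add_mset a T)) = mono_of (add_mset a M)"
    using assms by (subst rho_below)
      (auto simp: below_add_mset M_def add_mset_commute ord.less_imp_le)
  finally have "act a M = rho b (rho a (mono_of T)) + rho (bracket a b) (mono_of T)"
    by (simp add: algebra_simps)
  moreover have "rho a (rho b (mono_of T)) = act a M"
    by (simp add: rho_below[OF b assms(4)] rho_basis[OF a] M_def)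
  ultimately show ?thesis by simp
qed

section \<open>The bracket acts as a commutator\<close>

abbreviation compatible :: "'p \<Rightarrow> 'p \<Rightarrow> ('p multiset \<Rightarrow>\<^sub>0 'f) \<Rightarrow> bool" where
  "compatible x y v \<equiv> rho x (rho y v) = rho y (rho x v) + rho (bracket x y) v"

lemma compatible_lin:
  assumes "\<And>i. i \<in> Poly_Mapping.keys t \<Longrightarrow> compatible x y (g i)"
  shows "compatible x y (poly.lin g t)"
  unfolding rho_lin poly.lin_fun_add[symmetric]
  by (rule poly.lin_cong) (rule assms)

lemma compatible_vector:
  assumes "\<And>K. K \<in> Poly_Mapping.keys v \<Longrightarrow> compatible x y (mono_of K)"
  shows "compatible x y v"
  using compatible_lin[of v x y mono_of] assms by (simp add: poly_lin_single)

lemma bracket_lin_left: "bracket (lin g t) y = lin (\<lambda>i. bracket (g i) y) t"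
proof -
  have "bracket (\<Sum>i\<in>I. scale (c i) (g i)) y = (\<Sum>i\<in>I. scale (c i) (bracket (g i) y))" for I c
    by (induction I rule: infinite_finite_induct) (simp_all add: bracket_add_left bracket_scale_left)
  then show ?thesis by (simp add: lin_def)
qed

lemma rho_lin_left: "rho (lin g t) v = poly.lin (\<lambda>i. rho (g i) v) t"
proof -
  have "rho (\<Sum>i\<in>I. scale (c i) (g i)) v = (\<Sum>i\<in>I. pscale (c i) (rho (g i) v))" for I c
    by (induction I rule: infinite_finite_induct)
      (simp_all add: rho_add_left rho_scale_left)
  then show ?thesis by (simp add: lin_def poly.lin_def)
qed

lemma compatible_swap: "compatible x y v \<Longrightarrow> compatible y x v"
  by (simp add: bracket_swap[of y x] rho_uminus_left)

lemma compatible_lin_left: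
  assumes "\<And>i. i \<in> Poly_Mapping.keys t \<Longrightarrow> compatible (g i) y v"
  shows "compatible (lin g t) y v"
  unfolding rho_lin_left bracket_lin_left rho_lin poly.lin_fun_add[symmetric]
  by (rule poly.lin_cong) (rule assms)

text \<open>Linearity in the left argument extends the relation from B to all x. The exchange of the
  arguments then reduces the right one to the same statement.\<close>

lemma compatible_basis:
  assumes "\<And>a b. a \<in> B \<Longrightarrow> b \<in> B \<Longrightarrow> compatible a b v"
  shows "compatible x y v"
proof -
  have *: "compatible x b v" if "b \<in> B" for x b
    using compatible_lin_left[of "rep x" "\<lambda>b. b" b v] keys_rep[of x] assms that
    by (auto simp: lin_rep)
  have "compatible y x v"
    using compatible_lin_left[of "rep y" "\<lambda>b. b" x v] keys_rep[of y] compatible_swap[OF *]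
    by (auto simp: lin_rep)
  then show ?thesis by (rule compatible_swap)
qed

text \<open>Strong induction on the length of T. If a or b is below T, the relation is built into
  the action, up to exchanging a and b. Otherwise T = n S with n less than both. Moving n to the
  left in a b n S and in b a n S produces double brackets, and these match by the Jacobi
  identity.\<close>

lemma compatible_mono_basis:
  assumes "a \<in> B" "b \<in> B" "set_mset T \<subseteq> B"
  shows "compatible a b (mono_of T)"
  using assms
proof (induction "size T" arbitrary: a b T rule: less_induct)
  case less
  \<comment> \<open>By linearity the induction hypothesis covers arbitrary Lie algebra elements and
    vectors of degree less than that of T.\<close>
  have IH: "compatible x y v" if v: "bounded k v" "k < size T" for x y v k
  proof (rule compatible_basis, rule compatible_vector)
    fix c d K assume cd: "c \<in> B" "d \<in> B" and K: "K \<in> Poly_Mapping.keys v"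
    have "set_mset K \<subseteq> B \<and> size K \<le> k" using v(1) K by (simp add: bounded_def)
    then show "compatible c d (mono_of K)" using v(2) cd by (intro less.hyps) auto
  qed
  show ?case
  proof (cases "below a T \<or> below b T \<or> a = b")
    case True
    have lt: "compatible x y (mono_of T)"
      if "x \<in> B" "y \<in> B" "below x T \<or> below y T" "lt y x" for x y
    proof -
      have "below y T"
        using that(3)
      proof
        assume "below x T"
        then show ?thesis
          using ord.order.trans[OF ord.less_imp_le[OF that(4)]] by (simp add: below_def)
      qed
      then show ?thesis by (rule rho_not_below[OF that(1,2) less.prems(3) _ that(4)])
    qed
    have *: "a = b \<or> lt a b \<or> lt b a" by (rule ord.linorder_cases[of a b]) simp_all
    show ?thesis
    proof (cases "a = b")
      case True
      then show ?thesis by (simp add: bracket_self)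
    next
      case False
      show ?thesis
      proof (cases "lt b a")
        case True
        then show ?thesis using lt[of a b] less.prems \<open>below a T \<or> below b T \<or> a = b\<close> False by blast
      next
        case nlt: False
        then have "compatible b a (mono_of T)"
          using lt[of b a] less.prems * \<open>below a T \<or> below b T \<or> a = b\<close> False by blast
        then show ?thesis by (rule compatible_swap)
      qed
    qed
  next
    case False
    then have T0: "T \<noteq> {#}" by auto
    define n S where "n = least T" and "S = rest T"
    have T: "T = add_mset n S" "n \<in> B" "set_mset S \<subseteq> B"
      using less.prems(3) least_in[OF T0] by (auto simp: S_def n_def dest: in_diffD)
    have belowS: "below n S"
      by (auto simp: below_def n_def S_def intro!: least_le dest: in_diffD)
    have n: "lt n x" if "\<not> below x T" for x
    proof (rule ccontr)
      assume "\<not> lt n x"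
      then have xn: "le x n" by (simp add: ord.not_less)
      then have "below x S" using belowS ord.order.trans[OF xn] by (simp add: below_def)
      then show False using that xn by (simp add: T(1) below_add_mset)
    qed
    have T_eq: "mono_of T = rho n (mono_of S)" using T belowS by (simp add: rho_below)
    \<comment> \<open>The vector \<open>rho y (mono_of S)\<close> has degree up to
      \<open>size T\<close>, out of reach of the induction hypothesis. Its leading term y S still
      has n below it, so x and n commute there by \<open>rho_not_below\<close>; only the remainder w
      of lower degree is left to the hypothesis.\<close>
    have half: "rho x (rho y (mono_of T)) =
        rho n (rho x (rho y (mono_of S))) + rho (bracket x n) (rho y (mono_of S)) +
        rho (bracket y n) (rho x (mono_of S)) + rho (bracket x (bracket y n)) (mono_of S)"
      if "x \<in> B" "y \<in> B" "lt n x" "lt n y" for x y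
    proof -
      define w where "w = rho y (mono_of S) - mono_of (add_mset y S)"
      have w: "bounded (size S) w"
        using bounded_act_diff[of y S] that T by (simp add: w_def rho_basis)
      have yS: "rho y (mono_of S) = mono_of (add_mset y S) + w" by (simp add: w_def)
      have "compatible x n (mono_of (add_mset y S))"
        using that T belowS
        by (intro rho_not_below) (auto simp: below_add_mset ord.less_imp_le)
      moreover have "compatible x n w" using w by (rule IH) (simp add: T)
      ultimately have 1: "compatible x n (rho y (mono_of S))"
        by (simp add: yS rho_add_right)
      have 2: "rho y (mono_of T) = rho n (rho y (mono_of S)) + rho (bracket y n) (mono_of S)"
        unfolding T_eq using that T belowS by (intro rho_not_below) auto
      have 3: "compatible x (bracket y n) (mono_of S)"
        by (rule IH[of "size S"]) (use T in \<open>auto simp: bounded_single\<close>)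
      show ?thesis by (simp add: 2 rho_add_right 1 3)
    qed
    have S: "compatible x y (mono_of S)" for x y
      by (rule IH[of "size S"]) (use T in \<open>auto simp: bounded_single\<close>)
    have jac: "bracket a (bracket b n) = bracket b (bracket a n) - bracket n (bracket a b)"
    proof -
      have "bracket b (bracket n a) = - bracket b (bracket a n)"
        by (subst bracket_swap[of n a]) (rule bracket_uminus_right)
      then have "bracket a (bracket b n) - bracket b (bracket a n) + bracket n (bracket a b) = 0"
        using jacobi[of a b n] by simp
      moreover have "bracket a (bracket b n) =
          (bracket a (bracket b n) - bracket b (bracket a n) + bracket n (bracket a b)) +
          (bracket b (bracket a n) - bracket n (bracket a b))" by simp
      ultimately show ?thesis by (metis add_0)
    qed
    \<comment> \<open>The two middle terms of \<open>half\<close> are interchanged when x and y are,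
      so they cancel in the difference.\<close>
    have "rho a (rho b (mono_of T)) - rho b (rho a (mono_of T)) =
        rho n (rho a (rho b (mono_of S)) - rho b (rho a (mono_of S))) +
        (rho (bracket a (bracket b n)) (mono_of S) - rho (bracket b (bracket a n)) (mono_of S))"
      using half[of a b] half[of b a] less.prems False n by (simp add: rho_diff_right)
    also have "rho a (rho b (mono_of S)) - rho b (rho a (mono_of S)) = rho (bracket a b) (mono_of S)"
      using S[of a b] by simp
    also have "rho n \<dots> = rho (bracket a b) (mono_of T) + rho (bracket n (bracket a b)) (mono_of S)"
      using S[of n "bracket a b"] by (simp add: T_eq)
    also have "rho (bracket a (bracket b n)) (mono_of S) =
        rho (bracket b (bracket a n)) (mono_of S) - rho (bracket n (bracket a b)) (mono_of S)"
      unfolding jac diff_conv_add_uminus rho_add_left rho_uminus_left ..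
    finally show ?thesis by (simp add: algebra_simps)
  qed
qed

lemma rho_bracket:
  assumes "bounded n v"
  shows "rho x (rho y v) = rho y (rho x v) + rho (bracket x y) v"
proof (rule compatible_basis, rule compatible_vector)
  fix a b K assume "a \<in> B" "b \<in> B" "K \<in> Poly_Mapping.keys v"
  then show "compatible a b (mono_of K)"
    using assms by (intro compatible_mono_basis) (simp_all add: bounded_def)
qed

lemma bounded_rho:
  assumes "bounded n v"
  shows "bounded (Suc n) (rho x v)"
  unfolding rho_def
proof (intro bounded_lin)
  fix b K assume b: "b \<in> Poly_Mapping.keys (rep x)" and "K \<in> Poly_Mapping.keys v"
  then have K: "set_mset K \<subseteq> B" "size K \<le> n" "b \<in> B"
    using assms keys_rep[of x] by (auto simp: bounded_def)
  then have "bounded (Suc n) (act b K - mono_of (add_mset b K))"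
    using bounded_mono[OF bounded_act_diff[of b K]] by simp
  moreover have "bounded (Suc n) (mono_of (add_mset b K))" using K by (simp add: bounded_single)
  ultimately have "bounded (Suc n) (act b K - mono_of (add_mset b K) + mono_of (add_mset b K))"
    by (rule bounded_add)
  then show "bounded (Suc n) (act b K)" by simp
qed

text \<open>Acting on the unit of the symmetric algebra turns x into its expansion in the basis,
  read as a polynomial of degree one.\<close>

lemma rho_one_eq_0:
  assumes "rho x (mono_of {#}) = 0"
  shows "x = 0"
proof -
  have "representation B x b = 0" for b
  proof -
    have "Poly_Mapping.lookup (rho x (mono_of {#})) {#b#} =
        (\<Sum>c\<in>Poly_Mapping.keys (rep x). if c = b then Poly_Mapping.lookup (rep x) c else 0)"
      unfolding rho_mono poly.lin_def lookup_sum
      by (simp add: act.simps lookup_single when_def)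
    also have "\<dots> = Poly_Mapping.lookup (rep x) b" by (simp add: in_keys_iff)
    finally show ?thesis using assms by (simp add: lookup_rep)
  qed
  then have "rep x = 0" by (intro poly_mapping_eqI) (simp add: lookup_rep)
  then show ?thesis using lin_rep[of x] by simp
qed

end

section \<open>Embedding into the universal enveloping algebra\<close>

lemma poly_mapping_additive_induct [case_names zero single add]:
  assumes "Q 0" and single: "\<And>i c. Q (Poly_Mapping.single i c)"
    and add: "\<And>s t. Q s \<Longrightarrow> Q t \<Longrightarrow> Q (s + t)"
  shows "Q (t :: 'i \<Rightarrow>\<^sub>0 'f::field)"
proof -
  have "Q (\<Sum>i\<in>I. Poly_Mapping.single i (c i))" for I c
    by (induction I rule: infinite_finite_induct) (simp_all add: assms)
  moreover have "t = (\<Sum>i\<in>Poly_Mapping.keys t. Poly_Mapping.single i (Poly_Mapping.lookup t i))"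
    using poly_lin_single[of t] by (simp add: poly.lin_def)
  ultimately show ?thesis by metis
qed

section \<open>The free algebra as a ring\<close>

lemma const_central: "const c * t = t * const c"
  by (induction t rule: poly_mapping_additive_induct)
    (simp_all add: const_def mult_single distrib_left distrib_right mult.commute)

interpretation free_alg: central_scalars "const :: 'f::field_char_0 \<Rightarrow> ('f, 'p) free_alg"
  by unfold_locales (simp_all add: const_def single_add mult_single const_central[unfolded const_def])

lemma free_ring_simps [simp]:
  "carrier free_ring = UNIV" "monoid.mult free_ring = (*)" "one free_ring = 1"
  "zero free_ring = 0" "add free_ring = (+)"
  by (simp_all add: free_ring_def)

lemma free_ring: "ring (free_ring :: ('f::field, 'p) free_alg ring)"
proof (rule ringI)
  show "abelian_group (free_ring :: ('f, 'p) free_alg ring)"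
    by (rule abelian_groupI) (auto simp: add_ac intro: exI[of _ "- _"] add.left_inverse)
  show "Group.monoid (free_ring :: ('f, 'p) free_alg ring)"
    by (rule monoidI) (auto simp: mult.assoc)
qed (auto simp: distrib_left distrib_right)

lemma free_ring_uminus:
  fixes x :: "('f::field, 'p) free_alg"
  shows "\<ominus>\<^bsub>free_ring\<^esub> x = - x"
proof -
  interpret ring "free_ring :: ('f, 'p) free_alg ring" by (rule free_ring)
  show ?thesis by (rule minus_equality) auto
qed

lemma free_ring_minus: "x \<ominus>\<^bsub>free_ring\<^esub> y = x - y"
  by (simp add: a_minus_def free_ring_uminus)

lemma free_ring_idealI:
  fixes I :: "('f::field, 'p) free_alg set"
  assumes "0 \<in> I" and "\<And>s t. s \<in> I \<Longrightarrow> t \<in> I \<Longrightarrow> s + t \<in> I" and "\<And>s. s \<in> I \<Longrightarrow> - s \<in> I"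
    and "\<And>s t. t \<in> I \<Longrightarrow> s * t \<in> I" and "\<And>s t. s \<in> I \<Longrightarrow> s * t \<in> I"
  shows "ideal I free_ring"
proof (rule idealI[OF free_ring])
  show "subgroup I (add_monoid free_ring)"
  proof
    fix x assume "x \<in> I"
    then show "inv\<^bsub>add_monoid free_ring\<^esub> x \<in> I"
      using assms(3) free_ring_uminus[of x] by (metis a_inv_def)
  qed (use assms in auto)
qed (use assms in auto)

section \<open>The action of the free algebra\<close>

context ordered_basis_lie_algebra
begin

fun word_act :: "'p free_monoid \<Rightarrow> ('p multiset \<Rightarrow>\<^sub>0 'f) \<Rightarrow> ('p multiset \<Rightarrow>\<^sub>0 'f)" where
  "word_act (Word xs) v = foldr rho xs v"

lemma word_act_plus: "word_act (u + w) v = word_act u (word_act w v)"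
  by (cases u; cases w) simp

lemma word_act_0 [simp]: "word_act 0 v = v"
  by (simp add: zero_free_monoid_def)

lemma word_act_lin: "word_act w (poly.lin g t) = poly.lin (\<lambda>i. word_act w (g i)) t"
proof (cases w)
  case (Word xs)
  have "foldr rho xs (poly.lin g t) = poly.lin (\<lambda>i. foldr rho xs (g i)) t"
    by (induction xs) (simp_all add: rho_lin)
  then show ?thesis by (simp add: Word)
qed

definition alg_act :: "('f, 'p) free_alg \<Rightarrow> ('p multiset \<Rightarrow>\<^sub>0 'f) \<Rightarrow> ('p multiset \<Rightarrow>\<^sub>0 'f)" where
  "alg_act t v = poly.lin (\<lambda>w. word_act w v) t"

lemma alg_act_gen [simp]: "alg_act (gen x) v = rho x v"
  by (simp add: alg_act_def gen_def)

lemma alg_act_const [simp]: "alg_act (const c) v = pscale c v"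
  by (simp add: alg_act_def const_def)

lemma alg_act_add: "alg_act (s + t) v = alg_act s v + alg_act t v"
  by (simp add: alg_act_def poly.lin_add)

lemma alg_act_diff: "alg_act (s - t) v = alg_act s v - alg_act t v"
  by (simp add: alg_act_def poly.lin_diff)

lemma alg_act_single: "alg_act (Poly_Mapping.single w c) v = pscale c (word_act w v)"
  by (simp add: alg_act_def)

lemma alg_act_mult: "alg_act (s * t) v = alg_act s (alg_act t v)"
proof (induction s rule: poly_mapping_additive_induct)
  case (single u c)
  show ?case
  proof (induction t rule: poly_mapping_additive_induct)
    case zero
    then show ?case using word_act_lin[of u "\<lambda>i. 0" 0] by (simp add: alg_act_def)
  next
    case (single w d)
    \<comment> \<open>Scalar multiples and, further below, sums of two vectors are treated as linear
      combinations indexed by \<open>unit\<close> and \<open>bool\<close>, so that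
      \<open>word_act_lin\<close> covers both.\<close>
    have "word_act u (pscale d (word_act w v)) = pscale d (word_act u (word_act w v))"
      using word_act_lin[of u "\<lambda>_. word_act w v" "Poly_Mapping.single () d"] by simp
    then show ?case by (simp add: mult_single alg_act_single word_act_plus)
  next
    case (add s t)
    have "word_act u (x + y) = word_act u x + word_act u y" for x y
      using word_act_lin[of u "\<lambda>b. if b then x else y"
          "Poly_Mapping.single True 1 + Poly_Mapping.single False 1"]
      by (simp add: poly.lin_add)
    then have "alg_act (Poly_Mapping.single u c) (x + y) =
        alg_act (Poly_Mapping.single u c) x + alg_act (Poly_Mapping.single u c) y" for x y
      by (simp add: alg_act_single poly.scale_right_distrib)
    then show ?case using add by (simp add: distrib_left alg_act_add)
  qed
qed (simp_all add: alg_act_def distrib_right poly.lin_add)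

lemma alg_act_0_right [simp]: "alg_act t 0 = 0"
  using alg_act_mult[of t 0 0] by (simp add: alg_act_def)

text \<open>The symmetric algebra inside the free vector space on all multisets. The commutator
  relation is established for these vectors, so they are the module on which the enveloping algebra
  acts.\<close>

definition supported :: "('p multiset \<Rightarrow>\<^sub>0 'f) \<Rightarrow> bool" where
  "supported v \<longleftrightarrow> (\<exists>n. bounded n v)"

lemma supported_iff: "supported v \<longleftrightarrow> (\<forall>K\<in>Poly_Mapping.keys v. set_mset K \<subseteq> B)"
proof
  assume *: "\<forall>K\<in>Poly_Mapping.keys v. set_mset K \<subseteq> B"
  have "bounded (Max (size ` Poly_Mapping.keys v)) v"
    using * by (auto simp: bounded_def)
  then show "supported v" by (auto simp: supported_def)
qed (auto simp: supported_def bounded_def)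

lemma supported_rho: "supported v \<Longrightarrow> supported (rho x v)"
  unfolding supported_def using bounded_rho by blast

lemma supported_alg_act:
  assumes "supported v"
  shows "supported (alg_act t v)"
proof -
  have "supported (foldr rho xs v)" for xs
    by (induction xs) (simp_all add: assms supported_rho)
  then have "supported (word_act w v)" for w by (cases w) simp
  then show ?thesis unfolding supported_iff alg_act_def by (metis keys_poly_lin)
qed

text \<open>The elements that annihilate every supported vector form an ideal, two-sided because
  supported vectors are stable under the action. It contains the three families of relations, hence
  the ideal that they generate.\<close>

lemma uea_ideal_acts_by_0:
  assumes "t \<in> uea_ideal scale bracket" "supported v"
  shows "alg_act t v = 0"
proof -
  define I where "I = {t. \<forall>v. supported v \<longrightarrow> alg_act t v = 0}"
  have "uea_ideal scale bracket \<subseteq> I"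
    unfolding uea_ideal_def
  proof (rule ring.genideal_minimal[OF free_ring])
    show "ideal I free_ring"
    proof (rule free_ring_idealI)
      fix s assume "s \<in> I"
      then show "- s \<in> I" using alg_act_diff[of 0 s] by (simp add: I_def alg_act_def)
    qed (auto simp: I_def alg_act_add alg_act_mult supported_alg_act alg_act_def[of 0])
    have "rho x (rho y v) - rho y (rho x v) = rho (bracket x y) v" if "supported v" for x y v
      using that rho_bracket[of _ v x y] by (auto simp: supported_def)
    then show "{gen (x + y) - gen x - gen y | x y. True} \<union>
        {gen (scale c x) - const c * gen x | c x. True} \<union>
        {gen x * gen y - gen y * gen x - gen (bracket x y) | x y. True} \<subseteq> I"
      by (auto simp: I_def alg_act_diff alg_act_mult rho_add_left rho_scale_left)
  qed
  then show ?thesis using assms by (auto simp: I_def)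
qed

lemma gen_in_uea_ideal:
  assumes "gen x \<in> uea_ideal scale bracket"
  shows "x = 0"
proof (rule rho_one_eq_0)
  have "supported (mono_of {#})" by (auto simp: supported_iff)
  then show "rho x (mono_of {#}) = 0"
    using uea_ideal_acts_by_0[OF assms, of "mono_of {#}"] by simp
qed

end

text \<open>A consequence of the well-ordering theorem; the type of the Lie algebra comes with no
  order.\<close>

lemma ex_linorder: "\<exists>le lt. class.linorder le (lt :: 'a \<Rightarrow> 'a \<Rightarrow> bool)"
proof -
  obtain r :: "('a \<times> 'a) set" where r: "well_order_on UNIV r" using well_order_on by blast
  then have lin: "linear_order r" by (simp add: well_order_on_def)
  have "class.linorder (\<lambda>x y. (x, y) \<in> r) (\<lambda>x y. (x, y) \<in> r \<and> x \<noteq> y)"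
  proof
    fix x y z
    show "(x, x) \<in> r" using lin by (auto simp: order_on_defs refl_on_def)
    show "(x, y) \<in> r \<Longrightarrow> (y, z) \<in> r \<Longrightarrow> (x, z) \<in> r"
      using lin by (auto simp: order_on_defs dest: transD)
    show anti: "(x, y) \<in> r \<Longrightarrow> (y, x) \<in> r \<Longrightarrow> x = y"
      using lin by (auto simp: order_on_defs dest: antisymD)
    then show "((x, y) \<in> r \<and> x \<noteq> y) = ((x, y) \<in> r \<and> (y, x) \<notin> r)"
      using lin by (auto simp: order_on_defs refl_on_def dest: antisymD)
    show "(x, y) \<in> r \<or> (y, x) \<in> r"
      using lin by (cases "x = y") (auto simp: order_on_defs refl_on_def total_on_def)
  qed
  then show ?thesis by blast
qed

text \<open>The canonical map to the universal enveloping algebra is injective, which is the part of the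
  Poincare--Birkhoff--Witt theorem that uniqueness requires.\<close>

theorem (in lie_algebra) gen_in_uea_ideal:
  assumes "gen x \<in> uea_ideal scale bracket"
  shows "x = 0"
proof -
  obtain le lt :: "'p \<Rightarrow> 'p \<Rightarrow> bool" where le: "class.linorder le lt" using ex_linorder by blast
  obtain B where B: "independent B" "UNIV \<subseteq> span B"
    using maximal_independent_subset[of UNIV] by blast
  interpret vspace scale ..
  interpret ord: linorder le lt by (rule le)
  interpret ordered_basis_lie_algebra scale bracket le lt B
    by unfold_locales (use B in auto)
  show ?thesis using assms by (rule gen_in_uea_ideal)
qed

section \<open>Series over the universal enveloping algebra\<close>

lemma ideal_uea_ideal: "ideal (uea_ideal scale bracket) free_ring"
  unfolding uea_ideal_def by (rule ring.genideal_ideal[OF free_ring]) simp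

lemma ring_uea: "ring (uea scale bracket)"
  unfolding uea_def by (rule ideal.quotient_is_ring[OF ideal_uea_ideal])

context
  fixes scale :: "'f::field \<Rightarrow> 'p::ab_group_add \<Rightarrow> 'p" and bracket :: "'p \<Rightarrow> 'p \<Rightarrow> 'p"
begin

lemma uea_ideal_0 [simp]: "0 \<in> uea_ideal scale bracket"
  using additive_subgroup.zero_closed[OF ideal.axioms(1)[OF ideal_uea_ideal]] by simp

lemma uea_ideal_add: "s \<in> uea_ideal scale bracket \<Longrightarrow> t \<in> uea_ideal scale bracket \<Longrightarrow> s + t \<in> uea_ideal scale bracket"
  using additive_subgroup.a_closed[OF ideal.axioms(1)[OF ideal_uea_ideal]] by fastforce

lemma uea_ideal_mult_left: "t \<in> uea_ideal scale bracket \<Longrightarrow> s * t \<in> uea_ideal scale bracket"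
  using ideal.I_l_closed[OF ideal_uea_ideal] by fastforce

lemma uea_ideal_mult_right: "s \<in> uea_ideal scale bracket \<Longrightarrow> s * t \<in> uea_ideal scale bracket"
  using ideal.I_r_closed[OF ideal_uea_ideal] by fastforce

lemma uea_ideal_uminus: "s \<in> uea_ideal scale bracket \<Longrightarrow> - s \<in> uea_ideal scale bracket"
  using uea_ideal_mult_left[of s "- 1"] by simp

lemma uea_ideal_diff: "s \<in> uea_ideal scale bracket \<Longrightarrow> t \<in> uea_ideal scale bracket \<Longrightarrow> s - t \<in> uea_ideal scale bracket"
  using uea_ideal_add[of s "- t"] uea_ideal_uminus[of t] by simp

lemma uea_ideal_sum: "(\<And>i. i \<in> I \<Longrightarrow> f i \<in> uea_ideal scale bracket) \<Longrightarrow> sum f I \<in> uea_ideal scale bracket"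
  by (induction I rule: infinite_finite_induct) (auto intro: uea_ideal_add)

lemma uea_class_eq_iff: "uea_class scale bracket s = uea_class scale bracket t \<longleftrightarrow> s - t \<in> uea_ideal scale bracket"
  using ring.quotient_eq_iff_same_a_r_cos[OF free_ring ideal_uea_ideal, of s t scale bracket]
  by (simp add: uea_class_def free_ring_minus)

lemma uea_class_hom:
  "uea_class scale bracket (s * t) =
    uea_class scale bracket s \<otimes>\<^bsub>uea scale bracket\<^esub> uea_class scale bracket t"
  "uea_class scale bracket (s + t) =
    uea_class scale bracket s \<oplus>\<^bsub>uea scale bracket\<^esub> uea_class scale bracket t"
  "uea_class scale bracket 1 = \<one>\<^bsub>uea scale bracket\<^esub>"
  "uea_class scale bracket s \<in> carrier (uea scale bracket)"
  using ring_hom_memE[OF ideal.rcos_ring_hom[OF ideal_uea_ideal, of scale bracket]]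
  by (simp_all add: uea_class_def uea_def)

lemma uea_class_0: "uea_class scale bracket 0 = \<zero>\<^bsub>uea scale bracket\<^esub>"
proof -
  interpret U: ring "uea scale bracket" by (rule ring_uea)
  show ?thesis using uea_class_hom(2)[of 0 0] uea_class_hom(4)[of 0]
    by (metis U.add.r_cancel_one' add_0)
qed

lemma uea_class_sum:
  "uea_class scale bracket (sum f I) =
    (\<Oplus>\<^bsub>uea scale bracket\<^esub>i\<in>I. uea_class scale bracket (f i))"
proof -
  interpret U: ring "uea scale bracket" by (rule ring_uea)
  show ?thesis
    by (induction I rule: infinite_finite_induct)
      (simp_all add: uea_class_0 uea_class_hom(2,4) Pi_def)
qed

text \<open>The quotient map applied to each coefficient. It transports identities from
  \<open>ser\<close> over the free algebra to the record-based ring of the statement.\<close>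

definition uea_series_class :: "('f, 'p) free_alg ser \<Rightarrow> ('f, 'p) free_alg set series" where
  "uea_series_class s = (\<lambda>M. uea_class scale bracket (coeff s M))"

lemma uea_series_class_mult:
  "uea_series_class s \<otimes>\<^bsub>uea_series scale bracket\<^esub> uea_series_class t = uea_series_class (s * t)"
  by (simp add: series_ring_def uea_series_class_def coeff_mult uea_class_sum uea_class_hom(1)
      case_prod_unfold)

lemma uea_series_class_1: "\<one>\<^bsub>uea_series scale bracket\<^esub> = uea_series_class 1"
proof
  fix M
  show "\<one>\<^bsub>uea_series scale bracket\<^esub> M = uea_series_class 1 M"
    by (simp add: series_ring_def uea_series_class_def coeff_one uea_class_hom(3) uea_class_0)
qed

lemma uea_series_class_power:
  "uea_series_class s [^]\<^bsub>uea_series scale bracket\<^esub> (n :: nat) = uea_series_class (s ^ n)"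
  by (induction n)
    (simp_all add: nat_pow_def uea_series_class_1 uea_series_class_mult power_commutes)

text \<open>\<open>gen 0\<close> is not \<open>0\<close> in the free algebra, hence the case distinction.\<close>

definition lift_series :: "'p series \<Rightarrow> ('f, 'p) free_alg ser" where
  "lift_series f = Ser (\<lambda>M. if f M = 0 then 0 else gen (f M))"

definition series_cong :: "('f, 'p) free_alg ser \<Rightarrow> ('f, 'p) free_alg ser \<Rightarrow> bool" (infix \<open>\<approx>\<close> 50) where
  "s \<approx> t \<longleftrightarrow> (\<forall>M. coeff s M - coeff t M \<in> uea_ideal scale bracket)"

lemma uea_series_class_eq_iff: "uea_series_class s = uea_series_class t \<longleftrightarrow> s \<approx> t"
  by (simp add: uea_series_class_def series_cong_def fun_eq_iff uea_class_eq_iff)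

lemma cong_refl [simp]: "s \<approx> s"
  by (simp add: series_cong_def)

lemma cong_sym: "s \<approx> t \<Longrightarrow> t \<approx> s"
  by (metis uea_series_class_eq_iff)

lemma cong_trans [trans]: "s \<approx> t \<Longrightarrow> t \<approx> u \<Longrightarrow> s \<approx> u"
  by (metis uea_series_class_eq_iff)

lemma cong_add: "s \<approx> s' \<Longrightarrow> t \<approx> t' \<Longrightarrow> s + t \<approx> s' + t'"
  unfolding series_cong_def
proof
  fix M assume "\<forall>M. coeff s M - coeff s' M \<in> uea_ideal scale bracket" "\<forall>M. coeff t M - coeff t' M \<in> uea_ideal scale bracket"
  then have "(coeff s M - coeff s' M) + (coeff t M - coeff t' M) \<in> uea_ideal scale bracket"
    using uea_ideal_add by blast
  then show "coeff (s + t) M - coeff (s' + t') M \<in> uea_ideal scale bracket" by (simp add: algebra_simps)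
qed

lemma cong_mult: "s \<approx> s' \<Longrightarrow> t \<approx> t' \<Longrightarrow> s * t \<approx> s' * t'"
  by (metis uea_series_class_eq_iff uea_series_class_mult)

lemma cong_diff: "s \<approx> s' \<Longrightarrow> t \<approx> t' \<Longrightarrow> s - t \<approx> s' - t'"
  unfolding series_cong_def
proof
  fix M assume "\<forall>M. coeff s M - coeff s' M \<in> uea_ideal scale bracket" "\<forall>M. coeff t M - coeff t' M \<in> uea_ideal scale bracket"
  then have "(coeff s M - coeff s' M) - (coeff t M - coeff t' M) \<in> uea_ideal scale bracket"
    using uea_ideal_diff by blast
  then show "coeff (s - t) M - coeff (s' - t') M \<in> uea_ideal scale bracket" by (simp add: algebra_simps)
qed

lemma cong_comm: "s \<approx> s' \<Longrightarrow> t \<approx> t' \<Longrightarrow> comm s t \<approx> comm s' t'"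
  by (simp add: comm_def cong_mult cong_diff)

end

section \<open>Lie series inside the enveloping algebra\<close>

context lie_algebra
begin

abbreviation "lift f \<equiv> lift_series f :: ('f, 'p) free_alg ser"

lemma gen_relations:
  "gen (x + y) - gen x - gen y \<in> uea_ideal scale bracket"
  "gen (scale c x) - const c * gen x \<in> uea_ideal scale bracket"
  "gen x * gen y - gen y * gen x - gen (bracket x y) \<in> uea_ideal scale bracket"
proof -
  define G where "G = {gen (x + y) - gen x - gen y | x y. True} \<union>
     {gen (scale c x) - const c * gen x | c x. True} \<union>
     {gen x * gen y - gen y * gen x - gen (bracket x y) | x y. True}"
  have "G \<subseteq> uea_ideal scale bracket"
    unfolding uea_ideal_def G_def by (rule ring.genideal_self[OF free_ring]) simp
  moreover have "gen (x + y) - gen x - gen y \<in> G" "gen (scale c x) - const c * gen x \<in> G"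
    "gen x * gen y - gen y * gen x - gen (bracket x y) \<in> G"
    unfolding G_def by blast+
  ultimately show "gen (x + y) - gen x - gen y \<in> uea_ideal scale bracket"
    "gen (scale c x) - const c * gen x \<in> uea_ideal scale bracket"
    "gen x * gen y - gen y * gen x - gen (bracket x y) \<in> uea_ideal scale bracket" by blast+
qed

lemma gen_0: "gen 0 \<in> uea_ideal scale bracket"
  using uea_ideal_uminus[OF gen_relations(1)[of 0 0]] by simp

lemma coeff_lift: "coeff (lift f) M - gen (f M) \<in> uea_ideal scale bracket"
  using uea_ideal_uminus[OF gen_0] by (simp add: lift_series_def)

lemma uea_embed_eq: "uea_embed scale bracket f = uea_series_class scale bracket (lift f)"
  unfolding uea_embed_def uea_series_class_def
  by (intro ext) (metis coeff_lift uea_class_eq_iff)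

text \<open>Two truncations of one sum: \<open>uea_exp\<close> runs over the n whose power has a
  nonzero class at M, \<open>ser_exp\<close> over all n up to \<open>size M\<close>. Without
  constant term the first set lies in the second, and the additional terms lie in the ideal.\<close>

lemma uea_exp_eq:
  assumes "f {#} = 0"
  shows "uea_exp scale bracket f = uea_series_class scale bracket (free_alg.ser_exp (lift f))"
proof
  fix M
  define U where "U = uea scale bracket"
  define l where "l = lift f"
  define t where "t = (\<lambda>n. const (1 / fact n) * coeff (l ^ n) M)"
  define S where "S = {n. uea_class scale bracket (coeff (l ^ n) M) \<noteq> \<zero>\<^bsub>U\<^esub>}"
  have l: "coeff l {#} = 0" using assms by (simp add: l_def lift_series_def)
  have S: "S \<subseteq> {..size M}"
  proof
    fix n assume "n \<in> S"
    then have "coeff (l ^ n) M \<noteq> 0" by (auto simp: S_def U_def uea_class_0)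
    then show "n \<in> {..size M}" using order_ge_power[OF l, of n] by (force simp: order_ge_def)
  qed
  have "uea_exp scale bracket f M = uea_class scale bracket (sum t S)"
    by (simp add: uea_exp_def uea_embed_eq uea_series_class_power uea_class_sum t_def
        uea_class_hom(1) S_def U_def l_def Let_def)
      (simp add: uea_series_class_def)
  also have "\<dots> = uea_class scale bracket (sum t {..size M})"
  proof -
    have "t n \<in> uea_ideal scale bracket" if "n \<in> {..size M} - S" for n
      using that unfolding S_def U_def t_def uea_class_0[symmetric] uea_class_eq_iff
      by (auto intro: uea_ideal_mult_left)
    then have "sum t ({..size M} - S) \<in> uea_ideal scale bracket" by (rule uea_ideal_sum)
    moreover have "sum t {..size M} - sum t S = sum t ({..size M} - S)"
      using sum.subset_diff[OF S, of t] by simp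
    ultimately show ?thesis by (metis uea_class_eq_iff)
  qed
  also have "sum t {..size M} = coeff (free_alg.ser_exp l) M"
    by (simp add: free_alg.ser_exp_def ser_suminf_def t_def)
  finally show "uea_exp scale bracket f M =
      uea_series_class scale bracket (free_alg.ser_exp (lift f)) M"
    by (simp add: uea_series_class_def l_def)
qed

abbreviation cong_syntax (infix \<open>\<approx>\<close> 50) where "s \<approx> t \<equiv> series_cong scale bracket s t"

lemma lift_add: "lift (f + g) \<approx> lift f + lift g"
  unfolding series_cong_def
proof
  fix M
  have "coeff (lift (f + g)) M - gen (f M + g M) \<in> uea_ideal scale bracket"
    using coeff_lift[of "f + g" M] by simp
  then have "(coeff (lift (f + g)) M - gen (f M + g M)) - (coeff (lift f) M - gen (f M)) -
      (coeff (lift g) M - gen (g M)) + (gen (f M + g M) - gen (f M) - gen (g M))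
      \<in> uea_ideal scale bracket"
    by (rule uea_ideal_add[OF uea_ideal_diff[OF uea_ideal_diff[OF _ coeff_lift] coeff_lift]
          gen_relations(1)])
  then show "coeff (lift (f + g)) M - coeff (lift f + lift g) M \<in> uea_ideal scale bracket"
    by (simp add: algebra_simps)
qed

lemma lift_scale:
  assumes "\<And>M. g M = scale (c M) (f M)"
  shows "coeff (lift g) M - const (c M) * coeff (lift f) M \<in> uea_ideal scale bracket"
proof -
  have "(coeff (lift g) M - gen (g M)) + (gen (g M) - const (c M) * gen (f M)) -
      const (c M) * (coeff (lift f) M - gen (f M)) \<in> uea_ideal scale bracket"
    by (rule uea_ideal_diff[OF uea_ideal_add[OF coeff_lift] uea_ideal_mult_left[OF coeff_lift]])
      (simp add: assms gen_relations)
  then show ?thesis by (simp add: algebra_simps)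
qed

lemma gen_sum: "gen (sum f I) - (\<Sum>i\<in>I. gen (f i)) \<in> uea_ideal scale bracket"
proof (induction I rule: infinite_finite_induct)
  case (insert x F)
  have "(gen (f x + sum f F) - gen (f x) - gen (sum f F)) + (gen (sum f F) - (\<Sum>i\<in>F. gen (f i)))
      \<in> uea_ideal scale bracket"
    by (rule uea_ideal_add[OF gen_relations(1) insert.IH])
  then show ?case using insert.hyps by (simp add: algebra_simps)
qed (simp_all add: gen_0)

text \<open>The third family of relations, summed over the factorizations of M. In the second
  product of the commutator the two factors of M trade places, which is harmless because the
  variables commute.\<close>

lemma lift_bracket: "lift (series_bracket bracket f g) \<approx> comm (lift f) (lift g)"
  unfolding series_cong_def
proof
  fix M
  let ?J = "uea_ideal scale bracket" and ?b = "series_bracket bracket f g"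
  have "gen (bracket (f K) (g L)) - (coeff (lift f) K * coeff (lift g) L -
      coeff (lift g) L * coeff (lift f) K) \<in> ?J" for K L
  proof -
    have 1: "gen (f K) * gen (g L) - coeff (lift f) K * coeff (lift g) L \<in> ?J"
      and 2: "gen (g L) * gen (f K) - coeff (lift g) L * coeff (lift f) K \<in> ?J"
    proof -
      have "a * b - a' * b' \<in> ?J" if "a' - a \<in> ?J" "b' - b \<in> ?J" for a a' b b'
      proof -
        have "- ((a' - a) * b' + a * (b' - b)) \<in> ?J"
          by (intro uea_ideal_uminus uea_ideal_add uea_ideal_mult_left uea_ideal_mult_right that)
        then show ?thesis by (simp add: algebra_simps)
      qed
      then show "gen (f K) * gen (g L) - coeff (lift f) K * coeff (lift g) L \<in> ?J"
        "gen (g L) * gen (f K) - coeff (lift g) L * coeff (lift f) K \<in> ?J"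
        using coeff_lift by blast+
    qed
    have "(gen (f K) * gen (g L) - coeff (lift f) K * coeff (lift g) L) -
      (gen (g L) * gen (f K) - coeff (lift g) L * coeff (lift f) K) -
      (gen (f K) * gen (g L) - gen (g L) * gen (f K) - gen (bracket (f K) (g L))) \<in> ?J"
      by (intro uea_ideal_diff 1 2 gen_relations)
    then show ?thesis by (simp add: algebra_simps)
  qed
  then have "(\<Sum>(K, L)\<in>splits M. gen (bracket (f K) (g L)) - (coeff (lift f) K * coeff (lift g) L -
      coeff (lift g) L * coeff (lift f) K)) \<in> ?J"
    by (intro uea_ideal_sum) auto
  also have "(\<Sum>(K, L)\<in>splits M. gen (bracket (f K) (g L)) - (coeff (lift f) K * coeff (lift g) L -
      coeff (lift g) L * coeff (lift f) K)) =
    (\<Sum>(K, L)\<in>splits M. gen (bracket (f K) (g L))) - coeff (comm (lift f) (lift g)) M"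
    unfolding comm_def coeff_diff coeff_mult[of "lift g"]
      sum_splits_swap[of "\<lambda>K L. coeff (lift g) K * coeff (lift f) L" M]
    by (simp add: coeff_mult sum_subtractf[symmetric] case_prod_unfold)
  finally have 1: "(\<Sum>(K, L)\<in>splits M. gen (bracket (f K) (g L))) - coeff (comm (lift f) (lift g)) M
    \<in> ?J" .
  have 2: "gen (?b M) - (\<Sum>(K, L)\<in>splits M. gen (bracket (f K) (g L))) \<in> ?J"
    using gen_sum[of "\<lambda>(K, L). bracket (f K) (g L)" "splits M"]
    by (simp add: series_bracket_def case_prod_unfold)
  show "coeff (lift ?b) M - coeff (comm (lift f) (lift g)) M \<in> ?J"
    using uea_ideal_add[OF uea_ideal_add[OF coeff_lift[of ?b M] 2] 1] by simp
qed

end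

section \<open>Series over the Lie algebra\<close>

lemma index_mk_var [simp]: "j \<noteq> 0 \<Longrightarrow> index (mk_var j) = j"
  by (simp add: mk_var_inverse)

lemma ordA_indet: "j \<noteq> 0 \<Longrightarrow> ordA (indet j) = (if j > 0 then 1 else 0)"
  and ordB_indet: "j \<noteq> 0 \<Longrightarrow> ordB (indet j) = (if j < 0 then 1 else 0)"
  by (simp_all add: ordA_def ordB_def indet_def)

lemma indet_eq_iff: "i \<noteq> 0 \<Longrightarrow> j \<noteq> 0 \<Longrightarrow> indet i = indet j \<longleftrightarrow> i = j"
  by (metis index_mk_var indet_def single_eq_single)

lemma size_indet [simp]: "size (indet j) = 1"
  by (simp add: indet_def)

lemma ord_add_mset:
  "ordA (add_mset v M) = (if index v > 0 then 1 else 0) + ordA M"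
  "ordB (add_mset v M) = (if index v < 0 then 1 else 0) + ordB M"
  by (simp_all add: ordA_def ordB_def)

lemma size_eq_ord: "size M = ordA M + ordB M"
proof (induction M)
  case (add v M)
  then show ?case using index[of v] by (auto simp: ord_add_mset)
qed simp

lemma ordA_1:
  assumes "ordA M = 1" "ordB M = 0"
  obtains j where "j > 0" "M = indet j"
proof -
  have "size M = 1" using assms by (simp add: size_eq_ord)
  then obtain v where v: "M = {#v#}" using size_1_singleton_mset by blast
  then have "index v > 0" "M = indet (index v)"
    using assms by (auto simp: ord_add_mset indet_def index_inverse split: if_splits)
  then show ?thesis using that by blast
qed

lemma ordB_1:
  assumes "ordA M = 0" "ordB M = 1"
  obtains j where "j < 0" "M = indet j"
proof -
  have "size M = 1" using assms by (simp add: size_eq_ord)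
  then obtain v where v: "M = {#v#}" using size_1_singleton_mset by blast
  then have "index v < 0" "M = indet (index v)"
    using assms by (auto simp: ord_add_mset indet_def index_inverse split: if_splits)
  then show ?thesis using that by blast
qed

lemma ord_1_1:
  assumes "ordA M = 1" "ordB M = 1"
  obtains j m where "j > 0" "m < 0" "M = indet j + indet m"
proof -
  have "size {#v \<in># M. index v > 0#} = 1" using assms by (simp add: ordA_def)
  then obtain v where v: "{#v \<in># M. index v > 0#} = {#v#}" using size_1_singleton_mset by blast
  define N where "N = M - {#v#}"
  have "v \<in># {#v \<in># M. index v > 0#}" by (simp add: v)
  then have vM: "v \<in># M" "index v > 0" by simp_all
  have M: "M = indet (index v) + N"
    using vM by (simp add: N_def indet_def index_inverse)
  have "ordA N = 0" "ordB N = 1"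
    using assms vM(2) unfolding M ordA_add ordB_add by (simp_all add: ordA_indet ordB_indet)
  then obtain m where "m < 0" "N = indet m" by (rule ordB_1)
  then show ?thesis using that vM(2) M by blast
qed

lemma g_plus_indet: "j > 0 \<Longrightarrow> g_plus p (indet j) = p j"
proof -
  assume "j > 0"
  then have "{i. i > 0 \<and> indet i = indet j} = {j}" by (auto simp: indet_eq_iff)
  then show ?thesis by (simp add: g_plus_def formal_sum_def)
qed

lemma g_minus_indet: "j < 0 \<Longrightarrow> g_minus p (indet j) = p j"
proof -
  assume "j < 0"
  then have "{i. i < 0 \<and> indet i = indet j} = {j}" by (auto simp: indet_eq_iff)
  then show ?thesis by (simp add: g_minus_def formal_sum_def)
qed

lemma formal_sum_eq_0: "(\<And>i. i \<in> I \<Longrightarrow> X i \<noteq> M) \<Longrightarrow> formal_sum I X c M = 0"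
  by (auto simp: formal_sum_def intro: sum.neutral)

lemma g_plus_eq_0: "\<not> (ordA M = 1 \<and> ordB M = 0) \<Longrightarrow> g_plus p M = 0"
  unfolding g_plus_def by (rule formal_sum_eq_0) (auto simp: ordA_indet ordB_indet)

lemma g_minus_eq_0: "\<not> (ordA M = 0 \<and> ordB M = 1) \<Longrightarrow> g_minus p M = 0"
  unfolding g_minus_def by (rule formal_sum_eq_0) (auto simp: ordA_indet ordB_indet)

lemma indet_splits:
  assumes "K + L = indet j"
  shows "(K = {#} \<and> L = indet j) \<or> (K = indet j \<and> L = {#})"
  using assms by (auto simp: indet_def union_is_single)

section \<open>Brackets of series and power series in ad\<close>

context lie_algebra
begin

abbreviation br :: "'p series \<Rightarrow> 'p series \<Rightarrow> 'p series" where
  "br \<equiv> series_bracket bracket"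

abbreviation sscale :: "'f \<Rightarrow> 'p series \<Rightarrow> 'p series" where
  "sscale \<equiv> series_scale scale"

definition series_euler :: "'p series \<Rightarrow> 'p series" where
  "series_euler f = (\<lambda>M. scale (of_nat (ordA M)) (f M))"

text \<open>The counterpart of \<open>ad_series\<close> inside the Lie algebra;
  \<open>lift_series_ad\<close> relates the two. For f without constant term the cut-off at
  \<open>size M\<close> is again harmless.\<close>

definition series_ad :: "(nat \<Rightarrow> 'f) \<Rightarrow> 'p series \<Rightarrow> 'p series \<Rightarrow> 'p series" where
  "series_ad c f y = (\<lambda>M. \<Sum>k\<le>size M. scale (c k) ((br f ^^ k) y M))"

lemma bracket_sum_right: "bracket x (sum f I) = (\<Sum>i\<in>I. bracket x (f i))"
  by (induction I rule: infinite_finite_induct) (simp_all add: bracket_add_right)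

lemma br_add_left: "br (f + g) y = br f y + br g y"
  by (auto simp: series_bracket_def bracket_add_left sum.distrib case_prod_unfold)

lemma br_add_right: "br f (y + z) = br f y + br f z"
  by (auto simp: series_bracket_def bracket_add_right sum.distrib case_prod_unfold)

lemma br_scale_left: "br (sscale c f) y = sscale c (br f y)"
  by (auto simp: series_bracket_def series_scale_def bracket_scale_left scale_sum_right
      case_prod_unfold)

lemma br_scale_right: "br f (sscale c y) = sscale c (br f y)"
  by (auto simp: series_bracket_def series_scale_def bracket_scale_right scale_sum_right
      case_prod_unfold)

lemma br_0_left [simp]: "br (\<lambda>M. 0) y = (\<lambda>M. 0)"
  and br_0_right [simp]: "br f (\<lambda>M. 0) = (\<lambda>M. 0)"
  by (auto simp: series_bracket_def)

text \<open>Only the diagonal pairs vanish by \<open>bracket_self\<close>. Exchanging the two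
  factors of M shows that each coefficient is its own negative, and 2 is invertible.\<close>

lemma br_self: "br f f = (\<lambda>M. 0)"
proof
  fix M
  have "br f f M = (\<Sum>(K, L)\<in>splits M. bracket (f L) (f K))"
    unfolding series_bracket_def by (rule sum_splits_swap)
  also have "\<dots> = - br f f M"
    unfolding series_bracket_def sum_negf[symmetric] case_prod_unfold
    by (intro sum.cong refl bracket_swap)
  finally have "br f f M + br f f M = 0" by (simp only: eq_neg_iff_add_eq_0[symmetric])
  then have "scale (1 + 1) (br f f M) = 0" by (simp only: scale_left_distrib scale_one)
  then show "br f f M = 0" by simp
qed

lemma br_pow_eq_0:
  assumes "f {#} = 0" "size M < k"
  shows "(br f ^^ k) y M = 0"
  using assms(2)
proof (induction k arbitrary: M)
  case (Suc k)
  have "bracket (f K) ((br f ^^ k) y L) = 0" if "K + L = M" for K L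
  proof (cases "K = {#}")
    case False
    then have "size L < k" using Suc.prems that by (auto simp: nonempty_has_size)
    then show ?thesis using Suc.IH by simp
  qed (simp add: assms)
  then show ?case
    by (auto simp: series_bracket_def[of bracket f "(br f ^^ k) y"] intro!: sum.neutral)
qed simp

lemma series_ad_eq_sum:
  assumes "f {#} = 0" "size M \<le> N"
  shows "series_ad c f y M = (\<Sum>k\<le>N. scale (c k) ((br f ^^ k) y M))"
  unfolding series_ad_def
  by (rule sum.mono_neutral_left) (use assms in \<open>auto simp: br_pow_eq_0\<close>)

text \<open>The identity c(z) = 1 + z d(z) of power series, with d the shift of c, evaluated at ad
  f. It splits off the part without brackets.\<close>

lemma series_ad_unfold:
  assumes f: "f {#} = 0" and "c 0 = 1"
  shows "series_ad c f y = y + br f (series_ad (\<lambda>k. c (Suc k)) f y)"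
proof
  fix M :: monomial
  let ?N = "size M"
  have "series_ad c f y M = (\<Sum>k\<le>Suc ?N. scale (c k) ((br f ^^ k) y M))"
    by (rule series_ad_eq_sum) (simp_all add: f)
  also have "\<dots> = y M + (\<Sum>k\<le>?N. scale (c (Suc k)) (br f ((br f ^^ k) y) M))"
    by (subst sum.atMost_Suc_shift) (simp add: assms)
  also have "(\<Sum>k\<le>?N. scale (c (Suc k)) (br f ((br f ^^ k) y) M)) =
      (\<Sum>(K, L)\<in>splits M. bracket (f K) (\<Sum>k\<le>?N. scale (c (Suc k)) ((br f ^^ k) y L)))"
    by (simp add: series_bracket_def bracket_sum_right scale_sum_right bracket_scale_right
        case_prod_unfold) (rule sum.swap)
  also have "\<dots> = br f (series_ad (\<lambda>k. c (Suc k)) f y) M"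
    unfolding series_bracket_def[of bracket f "series_ad _ f y"]
    by (intro sum.cong refl) (auto simp: f series_ad_eq_sum[of f _ ?N])
  finally show "series_ad c f y M = (y + br f (series_ad (\<lambda>k. c (Suc k)) f y)) M" by simp
qed

text \<open>The bracket at \<open>M\<close> of two series without constant term only depends on their coefficients at the
  proper divisors of \<open>M\<close>.\<close>

definition agree :: "monomial \<Rightarrow> 'p series \<Rightarrow> 'p series \<Rightarrow> bool" where
  "agree M f g \<longleftrightarrow> f {#} = 0 \<and> g {#} = 0 \<and> (\<forall>K. K \<subset># M \<longrightarrow> f K = g K)"

lemma agree_br:
  assumes "agree M f f'" "agree M y y'"
  shows "br f y M = br f' y' M"
  unfolding series_bracket_def
proof (rule sum.cong[OF refl], clarify)
  fix K L assume M: "M = K + L"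
  show "bracket (f K) (y L) = bracket (f' K) (y' L)"
  proof (cases "K = {#} \<or> L = {#}")
    case True
    then show ?thesis using assms by (auto simp: agree_def)
  next
    case False
    then have "K \<subset># M" "L \<subset># M" using M by (auto simp: subset_mset.less_le)
    then show ?thesis using assms by (auto simp: agree_def)
  qed
qed

lemma br_empty: "br f y {#} = bracket (f {#}) (y {#})"
  by (simp add: series_bracket_def)

lemma agree_mono: "agree M f g \<Longrightarrow> K \<subset># M \<Longrightarrow> agree K f g"
  by (auto simp: agree_def intro: subset_mset.less_trans)

lemma agree_agree_br:
  assumes "agree M f f'" "agree M y y'"
  shows "agree M (br f y) (br f' y')"
  using assms agree_br[OF agree_mono agree_mono, OF assms(1) _ assms(2)]
  by (auto simp: agree_def br_empty)

lemma agree_series_ad: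
  assumes "agree M f f'" "agree M y y'"
  shows "agree M (series_ad c f y) (series_ad c f' y')"
proof -
  have "agree M ((br f ^^ k) y) ((br f' ^^ k) y')" for k
    by (induction k) (simp_all add: assms agree_agree_br)
  then show ?thesis using assms(2) by (simp add: agree_def series_ad_def)
qed

lemma agree_add: "agree M f f' \<Longrightarrow> agree M g g' \<Longrightarrow> agree M (f + g) (f' + g')"
  by (simp add: agree_def)

lemma agree_series_euler: "agree M f f' \<Longrightarrow> agree M (series_euler f) (series_euler f')"
  by (simp add: agree_def series_euler_def)

lemma br_vanish:
  assumes "\<And>K. K \<subseteq># M \<Longrightarrow> y K = 0"
  shows "br f y M = 0"
  using assms by (auto simp: series_bracket_def intro!: sum.neutral)

lemma series_ad_vanish:
  assumes "\<And>K. K \<subseteq># M \<Longrightarrow> y K = 0"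
  shows "series_ad c f y M = 0"
proof -
  have "K \<subseteq># M \<longrightarrow> (br f ^^ k) y K = 0" for k K
  proof (induction k arbitrary: K)
    case (Suc k)
    then show ?case by (auto intro!: br_vanish intro: subset_mset.order_trans)
  qed (simp add: assms)
  then show ?thesis by (simp add: series_ad_def)
qed

end

section \<open>Homogeneous components and projections\<close>

context graded_lie_algebra
begin

definition component :: "'p \<Rightarrow> int \<Rightarrow> 'p" where
  "component x = (THE c. homogeneous_decomp P x c)"

lemma homogeneous_decomp_component: "homogeneous_decomp P x (component x)"
  unfolding component_def by (rule theI'[OF direct_sum])

lemma component_eqI:
  assumes "\<And>j. c j \<in> P j" "finite I" "\<And>j. j \<notin> I \<Longrightarrow> c j = 0" "x = sum c I"
  shows "component x = c"
proof -
  have sub: "{j. c j \<noteq> 0} \<subseteq> I" using assms(3) by auto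
  moreover have "sum c I = (\<Sum>j\<in>{j. c j \<noteq> 0}. c j)"
    by (rule sum.mono_neutral_right) (use assms(2) sub in auto)
  ultimately have "homogeneous_decomp P x c"
    using assms finite_subset[OF sub] by (simp add: homogeneous_decomp_def)
  then show ?thesis using direct_sum[of x] homogeneous_decomp_component[of x] by blast
qed

lemma component_in: "component x j \<in> P j"
  and finite_component: "finite {j. component x j \<noteq> 0}"
  and sum_component: "(\<Sum>j\<in>{j. component x j \<noteq> 0}. component x j) = x"
  using homogeneous_decomp_component[of x] by (auto simp: homogeneous_decomp_def)

lemma sum_component_superset:
  assumes "finite I" "{j. component x j \<noteq> 0} \<subseteq> I"
  shows "x = sum (component x) I"
proof -
  have "sum (component x) {j. component x j \<noteq> 0} = sum (component x) I"
    by (rule sum.mono_neutral_left) (use assms in auto)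
  then show ?thesis by (simp only: sum_component)
qed

lemma component_add: "component (x + y) = (\<lambda>j. component x j + component y j)"
proof -
  let ?I = "{j. component x j \<noteq> 0} \<union> {j. component y j \<noteq> 0}"
  have I: "finite ?I" by (simp add: finite_component)
  have "x = sum (component x) ?I" "y = sum (component y) ?I"
    by (rule sum_component_superset[OF I], auto)+
  then have "x + y = sum (component x) ?I + sum (component y) ?I" by (rule arg_cong2)
  then have "x + y = (\<Sum>j\<in>?I. component x j + component y j)" by (simp only: sum.distrib)
  then show ?thesis
    by (intro component_eqI[OF _ I]) (auto simp: subspace_add[OF subspace_P] component_in)
qed

lemma component_scale: "component (scale a x) = (\<lambda>j. scale a (component x j))"
proof (rule component_eqI[OF _ finite_component[of x]])
  show "scale a x = (\<Sum>j\<in>{j. component x j \<noteq> 0}. scale a (component x j))"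
    by (simp only: scale_sum_right[symmetric] sum_component)
qed (auto simp: subspace_scale[OF subspace_P] component_in)

lemma component_homogeneous: "x \<in> P i \<Longrightarrow> component x = (\<lambda>j. if j = i then x else 0)"
  by (rule component_eqI[of _ "{i}"]) (auto simp: subspace_0[OF subspace_P])

lemma graded_proj_eq: "graded_proj P J x = (\<Sum>j\<in>{j \<in> J. component x j \<noteq> 0}. component x j)"
  by (simp add: graded_proj_def component_def Let_def)

lemma graded_proj_superset:
  assumes "finite I" "{j. component x j \<noteq> 0} \<subseteq> I"
  shows "graded_proj P J x = (\<Sum>j\<in>I. if j \<in> J then component x j else 0)"
proof -
  have "(\<Sum>j\<in>{j \<in> J. component x j \<noteq> 0}. component x j) =
      (\<Sum>j\<in>I. if j \<in> J then component x j else 0)"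
    by (rule sum.mono_neutral_cong_left) (use assms in auto)
  then show ?thesis by (simp add: graded_proj_eq)
qed

lemma graded_proj_add: "graded_proj P J (x + y) = graded_proj P J x + graded_proj P J y"
proof -
  let ?I = "{j. component x j \<noteq> 0} \<union> {j. component y j \<noteq> 0}"
  have I: "finite ?I" by (simp add: finite_component)
  have "graded_proj P J (x + y) = (\<Sum>j\<in>?I. if j \<in> J then component (x + y) j else 0)"
    by (rule graded_proj_superset[OF I]) (auto simp: component_add)
  also have "\<dots> = (\<Sum>j\<in>?I. if j \<in> J then component x j else 0) +
      (\<Sum>j\<in>?I. if j \<in> J then component y j else 0)"
    unfolding sum.distrib[symmetric] by (intro sum.cong) (auto simp: component_add)
  also have "\<dots> = graded_proj P J x + graded_proj P J y"
    by (intro arg_cong2[where f = "(+)"] graded_proj_superset[OF I, symmetric]) auto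
  finally show ?thesis .
qed

lemma graded_proj_scale: "graded_proj P J (scale a x) = scale a (graded_proj P J x)"
proof -
  have "graded_proj P J (scale a x) =
      (\<Sum>j\<in>{j. component x j \<noteq> 0}. if j \<in> J then component (scale a x) j else 0)"
    by (rule graded_proj_superset[OF finite_component]) (auto simp: component_scale)
  also have "\<dots> = scale a (\<Sum>j\<in>{j. component x j \<noteq> 0}. if j \<in> J then component x j else 0)"
    unfolding scale_sum_right by (intro sum.cong) (auto simp: component_scale)
  finally show ?thesis by (simp only: graded_proj_superset[OF finite_component order_refl])
qed

lemma graded_proj_0 [simp]: "graded_proj P J 0 = 0"
  using graded_proj_scale[of J 0 0] by simp

lemma graded_proj_homogeneous:
  "x \<in> P i \<Longrightarrow> graded_proj P J x = (if i \<in> J then x else 0)"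
  by (subst graded_proj_superset[of "{i}"]) (auto simp: component_homogeneous)

lemma graded_proj_in: "graded_proj P J x \<in> graded_part scale P J"
  unfolding graded_proj_eq graded_part_def
  by (intro span_sum span_base) (auto intro: component_in)

lemma graded_proj_0_in: "graded_proj P {0} x \<in> P 0"
  unfolding graded_proj_eq by (intro subspace_sum[OF subspace_P]) (auto intro: component_in)

lemma graded_proj_decomp:
  "x = graded_proj P {..<0} x + graded_proj P {0<..} x + graded_proj P {0} x"
proof -
  have "x = (\<Sum>j\<in>{j. component x j \<noteq> 0}. component x j)" by (simp add: sum_component)
  also have "\<dots> = (\<Sum>j\<in>{j. component x j \<noteq> 0}. (if j \<in> {..<0} then component x j else 0) +
      (if j \<in> {0<..} then component x j else 0) + (if j \<in> {0} then component x j else 0))"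
    by (intro sum.cong) auto
  also have "\<dots> = graded_proj P {..<0} x + graded_proj P {0<..} x + graded_proj P {0} x"
    unfolding sum.distrib by (simp only: graded_proj_superset[OF finite_component order_refl])
  finally show ?thesis .
qed

text \<open>Both claims are preserved by linear combinations, so only the homogeneous generators of
  the span have to be checked.\<close>

lemma graded_proj_part:
  assumes "x \<in> graded_part scale P J"
  shows "J \<subseteq> J' \<Longrightarrow> graded_proj P J' x = x"
    and "J \<inter> J' = {} \<Longrightarrow> graded_proj P J' x = 0"
proof -
  have "graded_part scale P J \<subseteq> {x. (J \<subseteq> J' \<longrightarrow> graded_proj P J' x = x) \<and>
      (J \<inter> J' = {} \<longrightarrow> graded_proj P J' x = 0)}"
    unfolding graded_part_def
  proof (rule span_minimal)
    show "subspace {x. (J \<subseteq> J' \<longrightarrow> graded_proj P J' x = x) \<and>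
      (J \<inter> J' = {} \<longrightarrow> graded_proj P J' x = 0)}"
      by (auto simp: subspace_def graded_proj_add graded_proj_scale)
  qed (auto simp: graded_proj_homogeneous)
  then show "J \<subseteq> J' \<Longrightarrow> graded_proj P J' x = x"
    and "J \<inter> J' = {} \<Longrightarrow> graded_proj P J' x = 0" using assms by blast+
qed

lemma agree_series_proj: "agree M f f' \<Longrightarrow> agree M (series_proj P J f) (series_proj P J f')"
  by (simp add: agree_def series_proj_def)

end

section \<open>Solving for the factorization\<close>

lemma submultiset_ord: "K \<subseteq># M \<Longrightarrow> ordA K \<le> ordA M" "K \<subseteq># M \<Longrightarrow> ordB K \<le> ordB M"
  by (metis mset_subset_eq_exists_conv ordA_add le_add1)
    (metis mset_subset_eq_exists_conv ordB_add le_add1)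

lemma indet_pair_splits:
  assumes "K + L = indet i + indet j"
  shows "K = {#} \<or> L = {#} \<or> (K = indet i \<and> L = indet j) \<or> (K = indet j \<and> L = indet i)"
proof (cases K)
  case (add v N)
  then have "add_mset v (N + L) = {#mk_var i, mk_var j#}" using assms by (simp add: indet_def)
  then have "(v = mk_var i \<and> N + L = {#mk_var j#}) \<or> (v = mk_var j \<and> N + L = {#mk_var i#})"
    by (auto simp: add_eq_conv_ex)
  then show ?thesis by (auto simp: add indet_def union_is_single)
qed simp

locale factorization_problem = graded_lie_algebra scale bracket P
  for scale :: "'f::field_char_0 \<Rightarrow> 'p::ab_group_add \<Rightarrow> 'p" and bracket :: "'p \<Rightarrow> 'p \<Rightarrow> 'p"
    and P :: "int \<Rightarrow> 'p set" +
  fixes p :: "int \<Rightarrow> 'p"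
  assumes p_in: "j \<noteq> 0 \<Longrightarrow> p j \<in> P j"
begin

abbreviation "gp \<equiv> g_plus p"
abbreviation "gm \<equiv> g_minus p"
abbreviation "neg \<equiv> series_proj P {..<0}"
abbreviation "pos \<equiv> series_proj P {0<..}"
abbreviation "zer \<equiv> series_proj P {0}"

abbreviation (input) exp_coeff :: "nat \<Rightarrow> 'f" where "exp_coeff \<equiv> \<lambda>k. 1 / fact k"
abbreviation (input) phi :: "nat \<Rightarrow> 'f" where "phi \<equiv> \<lambda>k. 1 / fact (Suc k)"

abbreviation series_exp where "series_exp \<equiv> series_ad exp_coeff"
abbreviation series_phi where "series_phi \<equiv> series_ad phi"

text \<open>\<open>log_deriv a b c\<close> is the logarithmic derivative \<open>D(X) X\<^sup>-\<^sup>1\<close> of \<open>X = e\<^sup>a e\<^sup>b e\<^sup>c\<close>.\<close>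

definition log_deriv2 :: "'p series \<Rightarrow> 'p series \<Rightarrow> 'p series" where
  "log_deriv2 b c = series_phi b (series_euler b) + series_exp b (series_phi c (series_euler c))"

definition log_deriv :: "'p series \<Rightarrow> 'p series \<Rightarrow> 'p series \<Rightarrow> 'p series" where
  "log_deriv a b c = series_phi a (series_euler a) + series_exp a (log_deriv2 b c)"

text \<open>The coefficients of (phi(z) - 1) / z = (e^z - 1 - z) / z^2.\<close>

definition phi' :: "'p series \<Rightarrow> 'p series \<Rightarrow> 'p series" where
  "phi' = series_ad (\<lambda>k. 1 / fact (Suc (Suc k)))"

text \<open>What remains of the logarithmic derivative beyond its linear part. Every summand is a
  bracket with a, b or c on the left, so for series without constant term its value at M depends
  only on proper divisors of M.\<close>

definition correction :: "'p series \<Rightarrow> 'p series \<Rightarrow> 'p series \<Rightarrow> 'p series" where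
  "correction a b c =
    br a (phi' a (series_euler a)) + br a (series_phi a (log_deriv2 b c)) +
    br b (phi' b (series_euler b)) + br b (series_phi b (series_phi c (series_euler c))) +
    br c (phi' c (series_euler c))"

lemma series_phi_unfold: "f {#} = 0 \<Longrightarrow> series_phi f y = y + br f (phi' f y)"
  unfolding phi'_def by (rule series_ad_unfold) simp_all

lemma series_exp_unfold: "f {#} = 0 \<Longrightarrow> series_exp f y = y + br f (series_phi f y)"
  by (rule series_ad_unfold) simp_all

text \<open>Each operator is unfolded once, by e^z = 1 + z phi(z) and phi(z) = 1 + z
  phi'(z).\<close>

lemma log_deriv_eq:
  assumes "a {#} = 0" "b {#} = 0" "c {#} = 0"
  shows "log_deriv a b c =
    series_euler a + series_euler b + series_euler c + correction a b c"
proof -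
  note a = series_phi_unfold[of a, OF assms(1)] series_exp_unfold[of a, OF assms(1)]
  note b = series_phi_unfold[of b, OF assms(2)] series_exp_unfold[of b, OF assms(2)]
  note c = series_phi_unfold[of c, OF assms(3)]
  have 1: "log_deriv a b c = series_euler a + br a (phi' a (series_euler a)) +
      (log_deriv2 b c + br a (series_phi a (log_deriv2 b c)))"
    by (simp only: log_deriv_def a(2)) (simp only: a(1)[of "series_euler a"])
  have "log_deriv2 b c = series_euler b + br b (phi' b (series_euler b)) +
      (series_phi c (series_euler c) + br b (series_phi b (series_phi c (series_euler c))))"
    by (simp only: log_deriv2_def b(2)) (simp only: b(1)[of "series_euler b"])
  then have 2: "log_deriv2 b c = series_euler b + br b (phi' b (series_euler b)) +
      (series_euler c + br c (phi' c (series_euler c)) +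
        br b (series_phi b (series_phi c (series_euler c))))"
    by (simp only: c[of "series_euler c"])
  show ?thesis by (subst 1, subst 2) (simp only: correction_def add_ac)
qed

lemma correction_cong:
  assumes "agree M a a'" "agree M b b'" "agree M c c'"
  shows "correction a b c M = correction a' b' c' M"
proof -
  have "agree M (log_deriv2 b c) (log_deriv2 b' c')"
    unfolding log_deriv2_def by (intro agree_series_ad agree_add agree_series_euler assms)
  then show ?thesis
    unfolding correction_def phi'_def plus_fun_apply
    by (intro arg_cong2[where f = "(+)"] agree_br assms agree_series_ad agree_series_euler)
qed

text \<open>Every summand is built linearly from an Euler derivative, and those vanish at all
  divisors of a monomial without A's.\<close>

lemma correction_vanish:
  assumes "ordA M = 0"
  shows "correction a b c M = 0"
proof -
  have e: "series_euler f K = 0" if "K \<subseteq># M" for f K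
    using submultiset_ord(1)[OF that] assms by (simp add: series_euler_def)
  have ad: "series_ad d f y K = 0" if "K \<subseteq># M" "\<And>K. K \<subseteq># M \<Longrightarrow> y K = 0" for d f y K
    using that by (meson series_ad_vanish subset_mset.order_trans)
  have l: "log_deriv2 b c K = 0" if "K \<subseteq># M" for K
    unfolding log_deriv2_def plus_fun_apply using that by (simp add: ad e)
  show ?thesis
    unfolding correction_def phi'_def plus_fun_apply
    by (simp add: br_vanish ad e l)
qed

text \<open>The nonlinear part as a function of the single unknown S = a + b + c. As the
  decomposition is direct, a, b and c are its projections.\<close>

definition defect :: "'p series \<Rightarrow> 'p series" where
  "defect S = correction (neg S) (pos S) (zer S)"

lemma defect_cong: "agree M S S' \<Longrightarrow> defect S M = defect S' M"
  unfolding defect_def by (intro correction_cong agree_series_proj)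

text \<open>The equation D S + \<open>defect S\<close> = g^+ solved at M for the coefficient of S,
  with g^- prescribed where no A occurs. The argument of \<open>defect\<close> is cut off to proper
  divisors for the sake of termination; \<open>sol_step\<close> removes the cut-off.\<close>

function sol :: "'p series" where
  "sol M = (if ordA M = 0 then gm M
    else scale (1 / of_nat (ordA M)) (gp M - defect (\<lambda>K. if K \<subset># M then sol K else 0) M))"
  by auto
termination
  by (relation "measure size") (auto intro: mset_subset_size)

declare sol.simps [simp del]

lemma sol_ordA_0: "ordA M = 0 \<Longrightarrow> sol M = gm M"
  by (simp add: sol.simps)

lemma sol_empty [simp]: "sol {#} = 0"
  by (simp add: sol_ordA_0 g_minus_eq_0)

lemma sol_step: "ordA M \<noteq> 0 \<Longrightarrow> sol M = scale (1 / of_nat (ordA M)) (gp M - defect sol M)"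
proof -
  assume M: "ordA M \<noteq> 0"
  have "agree M (\<lambda>K. if K \<subset># M then sol K else 0) sol" by (simp add: agree_def)
  then have "defect (\<lambda>K. if K \<subset># M then sol K else 0) M = defect sol M" by (rule defect_cong)
  then show ?thesis using M by (simp add: sol.simps[of M])
qed

lemma euler_sol: "series_euler sol + defect sol = gp"
proof
  fix M
  show "(series_euler sol + defect sol) M = gp M"
  proof (cases "ordA M = 0")
    case True
    then show ?thesis
      by (simp add: series_euler_def defect_def correction_vanish g_plus_eq_0)
  next
    case False
    then show ?thesis by (simp add: series_euler_def sol_step[OF False])
  qed
qed

lemma series_proj_sum: "f = neg f + pos f + zer f"
  using graded_proj_decomp by (auto simp: series_proj_def fun_eq_iff)

lemma series_euler_add: "series_euler (f + g) = series_euler f + series_euler g"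
  by (auto simp: series_euler_def scale_right_distrib)

lemma series_proj_empty: "f {#} = 0 \<Longrightarrow> series_proj P J f {#} = 0"
  by (simp add: series_proj_def)

lemma log_deriv_sol: "log_deriv (neg sol) (pos sol) (zer sol) = gp"
proof -
  have "log_deriv (neg sol) (pos sol) (zer sol) =
      series_euler (neg sol + pos sol + zer sol) + defect sol"
    by (simp add: log_deriv_eq series_proj_empty defect_def series_euler_add)
  then show ?thesis using series_proj_sum[of sol] euler_sol by simp
qed

lemma g_plus_in: "gp M \<in> graded_part scale P {0<..}"
proof (cases "ordA M = 1 \<and> ordB M = 0")
  case True
  then obtain j where "j > 0" "M = indet j" using ordA_1 by blast
  then show ?thesis using p_in[of j]
    by (auto simp: g_plus_indet graded_part_def intro: span_base)
next
  case False
  then show ?thesis by (simp add: g_plus_eq_0 graded_part_def span_zero)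
qed

lemma g_minus_in: "gm M \<in> graded_part scale P {..<0}"
proof (cases "ordA M = 0 \<and> ordB M = 1")
  case True
  then obtain j where "j < 0" "M = indet j" using ordB_1 by blast
  then show ?thesis using p_in[of j]
    by (auto simp: g_minus_indet graded_part_def intro: span_base)
next
  case False
  then show ?thesis by (simp add: g_minus_eq_0 graded_part_def span_zero)
qed

lemma proj_g_plus: "neg gp = (\<lambda>M. 0)" "pos gp = gp" "zer gp = (\<lambda>M. 0)"
  unfolding series_proj_def by (auto intro!: ext graded_proj_part[OF g_plus_in])

lemma proj_g_minus: "neg gm = gm" "pos gm = (\<lambda>M. 0)" "zer gm = (\<lambda>M. 0)"
  unfolding series_proj_def by (auto intro!: ext graded_proj_part[OF g_minus_in])

lemma series_ad_0: "series_ad c f (\<lambda>M. 0) = (\<lambda>M. 0)"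
  by (rule ext, rule series_ad_vanish) simp

text \<open>Since ad f kills f, the series applied to f is a multiple of f.\<close>

lemma br_series_ad_self: "br f (series_ad c f f) = (\<lambda>M. 0)"
proof -
  have "(br f ^^ k) f = (if k = 0 then f else (\<lambda>M. 0))" for k
    by (induction k) (auto simp: br_self)
  then have "series_ad c f f = sscale (c 0) f"
    by (auto simp: series_ad_def series_scale_def if_distrib[of "\<lambda>f. f _"]
        if_distrib[of "scale _"] cong: if_cong)
  then show ?thesis by (simp add: br_scale_right br_self) (simp add: series_scale_def)
qed

text \<open>For S = g^+ only the positive part b = g^+ is nonzero, and D g^+ = g^+, so all remaining
  brackets are of g^+ with multiples of itself.\<close>

lemma defect_g_plus: "defect gp = (\<lambda>M. 0)"
proof -
  have "series_euler gp = gp"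
  proof
    fix M show "series_euler gp M = gp M"
      using g_plus_eq_0[of M p] by (cases "ordA M = 1") (auto simp: series_euler_def)
  qed
  moreover have "series_euler (\<lambda>M. 0) = (\<lambda>M. 0)" by (simp add: series_euler_def)
  ultimately show ?thesis
    by (simp add: defect_def proj_g_plus correction_def phi'_def series_ad_0 br_series_ad_self)
      (simp add: fun_eq_iff)
qed

text \<open>By \<open>defect_g_plus\<close> and D g^+ = g^+, the series g^+ obeys the recursion of
  \<open>sol\<close> on monomials without B's. This is the second half of the claim that only mixed
  terms are added.\<close>

lemma sol_ordB_0: "ordB M = 0 \<Longrightarrow> sol M = gp M"
proof (induction "size M" arbitrary: M rule: less_induct)
  case less
  show ?case
  proof (cases "ordA M = 0")
    case True
    then have "M = {#}" using less.prems size_eq_ord[of M] by simp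
    then show ?thesis by (simp add: g_plus_eq_0)
  next
    case False
    have "agree M sol gp"
    proof -
      have "sol K = gp K" if "K \<subset># M" for K
        using that less mset_subset_size submultiset_ord(2)[of K M]
        by (auto simp: subset_mset.less_imp_le)
      then show ?thesis by (simp add: agree_def g_plus_eq_0)
    qed
    then have "defect sol M = 0" by (simp add: defect_cong[of M sol gp] defect_g_plus)
    then have "sol M = scale (1 / of_nat (ordA M)) (gp M)" by (simp add: sol_step[OF False])
    then show ?thesis using g_plus_eq_0[of M p] by (cases "ordA M = 1") auto
  qed
qed

text \<open>A bracket of series without constant term has order at least two, so at a single
  variable only the term k = 0 is visible.\<close>

lemma singleton_coeff:
  assumes "f {#} = 0" "y {#} = 0" "j \<noteq> 0"
  shows "series_ad c f y (indet j) = scale (c 0) (y (indet j))"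
proof -
  have "br f z (indet j) = 0" if "z {#} = 0" for z
    using that assms(1) by (auto simp: series_bracket_def dest!: indet_splits intro!: sum.neutral)
  then show ?thesis using assms by (simp add: series_ad_def)
qed

lemma sol_indet: "j \<noteq> 0 \<Longrightarrow> sol (indet j) = p j"
  by (cases "j < 0") (simp_all add: sol_ordA_0 ordA_indet g_minus_indet sol_ordB_0 ordB_indet
      g_plus_indet)

lemma br_pair:
  assumes "f {#} = 0" "y {#} = 0" "j > 0" "m < 0"
  shows "br f y (indet j + indet m) =
    bracket (f (indet j)) (y (indet m)) + bracket (f (indet m)) (y (indet j))"
proof -
  have ne: "indet j \<noteq> indet m" using assms by (simp add: indet_eq_iff)
  have "br f y (indet j + indet m) =
      (\<Sum>(K, L)\<in>{(indet j, indet m), (indet m, indet j)}. bracket (f K) (y L))"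
    unfolding series_bracket_def
  proof (rule sum.mono_neutral_right)
    show "\<forall>KL\<in>splits (indet j + indet m) - {(indet j, indet m), (indet m, indet j)}.
        (case KL of (K, L) \<Rightarrow> bracket (f K) (y L)) = 0"
      using assms(1,2) by (auto dest!: indet_pair_splits)
  qed (auto simp: add.commute)
  then show ?thesis using ne by simp
qed

lemma sol_pair:
  assumes j: "j > 0" and m: "m < 0"
  shows "sol (indet j + indet m) = bracket (p j) (p m)"
proof -
  let ?M = "indet j + indet m"
  define a b c where "a = neg sol" and "b = pos sol" and "c = zer sol"
  have p: "p j \<in> P j" "p m \<in> P m" using p_in j m by auto
  have empty: "a {#} = 0" "b {#} = 0" "c {#} = 0"
    by (simp_all add: a_def b_def c_def series_proj_empty)
  have val: "a (indet j) = 0" "a (indet m) = p m" "b (indet j) = p j" "b (indet m) = 0"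
    "c (indet j) = 0" "c (indet m) = 0"
    using j m p by (simp_all add: a_def b_def c_def series_proj_def sol_indet
        graded_proj_homogeneous[OF p(1)] graded_proj_homogeneous[OF p(2)])
  have eu: "series_euler f (indet m) = 0" "series_euler f (indet j) = f (indet j)"
    "series_euler f {#} = 0" for f
    using j m by (simp_all add: series_euler_def ordA_indet)
  have ad0: "series_ad d f y {#} = scale (d 0) (y {#})" for d f y
    by (simp add: series_ad_def)
  have l0: "log_deriv2 b c {#} = 0" by (simp add: log_deriv2_def ad0 eu)
  note ad = singleton_coeff[of a, OF empty(1)] singleton_coeff[of b, OF empty(2)]
    singleton_coeff[of c, OF empty(3)]
  have l: "log_deriv2 b c (indet j) = p j"
    using j by (simp add: log_deriv2_def ad ad0 eu val)
  \<comment> \<open>One summand survives, the bracket of a at B_m with \<open>log_deriv2 b c\<close>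
    at A_j: a vanishes at A_j, b at B_m, c at both, and the Euler derivatives vanish at B_m.\<close>
  have "defect sol ?M = bracket (p m) (p j)"
    using j m unfolding defect_def a_def[symmetric] b_def[symmetric] c_def[symmetric]
    by (simp add: correction_def phi'_def br_pair empty val eu ad ad0 l0 l)
  moreover have "ordA ?M = 1" "gp ?M = 0"
    using j m by (simp_all add: ordA_indet ordB_indet g_plus_eq_0)
  ultimately have "sol ?M = - bracket (p m) (p j)" by (simp add: sol_step)
  then show ?thesis using bracket_swap[of "p j" "p m"] by simp
qed

section \<open>Formal combinations of words\<close>

lemma vspace_series: "vspace sscale"
  by unfold_locales (auto simp: series_scale_def scale_right_distrib scale_left_distrib)

interpretation series: vspace sscale
  by (rule vspace_series)

text \<open>The arguments are ordered as in \<open>pword\<close>: m is the order in the B's, n the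
  order in the A's.\<close>

definition bidegree :: "nat \<Rightarrow> nat \<Rightarrow> 'p series \<Rightarrow> 'p series" where
  "bidegree m n f = (\<lambda>M. if ordB M = m \<and> ordA M = n then f M else 0)"

definition word_span :: "nat \<Rightarrow> nat \<Rightarrow> 'p series set" where
  "word_span m n = module.span sscale {u. pword bracket P gm gp m n u}"

lemma subspace_word_span: "series.subspace (word_span m n)"
  unfolding word_span_def by (rule series.subspace_span)

lemmas word_span_0 = series.subspace_0[OF subspace_word_span]
lemmas word_span_add = series.subspace_add[OF subspace_word_span]
lemmas word_span_diff = series.subspace_diff[OF subspace_word_span]
lemmas word_span_scale = series.subspace_scale[OF subspace_word_span]
lemmas word_span_sum = series.subspace_sum[OF subspace_word_span]

text \<open>Bilinearity, one argument at a time: first a word against a span, then a span against a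
  span.\<close>

lemma word_span_br:
  assumes "u \<in> word_span m n" "v \<in> word_span m' n'"
  shows "br u v \<in> word_span (m + m') (n + n')"
proof -
  have zero: "br x 0 = 0" "br 0 x = 0" for x by (auto simp: series_bracket_def)
  have 1: "br u v \<in> word_span (m + m') (n + n')"
    if "pword bracket P gm gp m n u" "v \<in> word_span m' n'" for u v
  proof -
    have "word_span m' n' \<subseteq> {v. br u v \<in> word_span (m + m') (n + n')}"
      unfolding word_span_def[of m' n']
    proof (rule series.span_minimal)
      show "series.subspace {v. br u v \<in> word_span (m + m') (n + n')}"
        by (auto simp: series.subspace_def br_add_right br_scale_right zero
            intro: word_span_0 word_span_add word_span_scale)
      show "{v. pword bracket P gm gp m' n' v} \<subseteq> {v. br u v \<in> word_span (m + m') (n + n')}"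
        using that(1) by (auto simp: word_span_def intro!: series.span_base pword.bracket)
    qed
    then show ?thesis using that(2) by blast
  qed
  have "word_span m n \<subseteq> {u. br u v \<in> word_span (m + m') (n + n')}"
    unfolding word_span_def[of m n]
  proof (rule series.span_minimal)
    show "series.subspace {u. br u v \<in> word_span (m + m') (n + n')}"
      by (auto simp: series.subspace_def br_add_left br_scale_left zero
          intro: word_span_0 word_span_add word_span_scale)
  qed (use 1 assms(2) in auto)
  then show ?thesis using assms(1) by blast
qed

lemma word_span_proj:
  assumes "u \<in> word_span m n" and J: "J \<in> {{..<0}, {0}, {0<..}}"
  shows "series_proj P J u \<in> word_span m n"
proof -
  have "word_span m n \<subseteq> {u. series_proj P J u \<in> word_span m n}"
    unfolding word_span_def[of m n]
  proof (rule series.span_minimal)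
    have "series_proj P J (f + g) = series_proj P J f + series_proj P J g"
      "series_proj P J (sscale d f) = sscale d (series_proj P J f)" "series_proj P J 0 = 0" for f g d
      by (auto simp: series_proj_def series_scale_def graded_proj_add graded_proj_scale)
    then show "series.subspace {u. series_proj P J u \<in> module.span sscale {u. pword bracket P gm gp m n u}}"
      unfolding word_span_def[symmetric]
      by (auto simp: series.subspace_def intro: word_span_0 word_span_add word_span_scale)
    show "{u. pword bracket P gm gp m n u} \<subseteq>
        {u. series_proj P J u \<in> module.span sscale {u. pword bracket P gm gp m n u}}"
      using J by (auto intro!: series.span_base pword.proj_minus pword.proj_zero pword.proj_plus)
  qed
  then show ?thesis using assms(1) by blast
qed

text \<open>A form of membership in \<open>pword_series\<close> that is stable under the operations
  of the recursion: the homogeneous parts of f themselves serve as the summands.\<close>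

definition word_series :: "'p series \<Rightarrow> bool" where
  "word_series f \<longleftrightarrow> (\<forall>m n. bidegree m n f \<in> word_span m n)"

lemma sum_series_apply: "sum F I M = (\<Sum>i\<in>I. F i M)" for F :: "'z \<Rightarrow> 'p series"
  by (induction I rule: infinite_finite_induct) auto

lemma bidegree_br:
  "bidegree m n (br f y) =
    (\<Sum>i\<le>m. \<Sum>j\<le>n. br (bidegree i j f) (bidegree (m - i) (n - j) y))"
proof
  fix M
  have inner: "(\<Sum>i\<le>m. \<Sum>j\<le>n. bracket (bidegree i j f K) (bidegree (m - i) (n - j) y L)) =
      (if ordB M = m \<and> ordA M = n then bracket (f K) (y L) else 0)" if "K + L = M" for K L
  proof -
    \<comment> \<open>For given K and L only i = \<open>ordB K\<close> and j = \<open>ordA K\<close>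
      contribute; the nested conditionals have the shape in which a sum over a Kronecker delta
      collapses.\<close>
    have "bracket (bidegree i j f K) (bidegree (m - i) (n - j) y L) =
        (if i = ordB K then if j = ordA K then
          if ordB L = m - ordB K \<and> ordA L = n - ordA K then bracket (f K) (y L) else 0
          else 0 else 0)" for i j
      by (auto simp: bidegree_def)
    then have "(\<Sum>i\<le>m. \<Sum>j\<le>n. bracket (bidegree i j f K) (bidegree (m - i) (n - j) y L)) =
        (\<Sum>i\<le>m. if i = ordB K then \<Sum>j\<le>n. if j = ordA K then
          if ordB L = m - ordB K \<and> ordA L = n - ordA K then bracket (f K) (y L) else 0
          else 0 else 0)"
      by (intro sum.cong) (auto intro!: sum.neutral)
    also have "\<dots> = (if ordB K \<le> m \<and> ordA K \<le> n \<and>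
        ordB L = m - ordB K \<and> ordA L = n - ordA K then bracket (f K) (y L) else 0)"
      by simp
    also have "\<dots> = (if ordB M = m \<and> ordA M = n then bracket (f K) (y L) else 0)"
      using that[symmetric] by auto
    finally show ?thesis .
  qed
  have "(\<Sum>i\<le>m. \<Sum>j\<le>n. br (bidegree i j f) (bidegree (m - i) (n - j) y)) M =
      (\<Sum>i\<le>m. \<Sum>j\<le>n. \<Sum>(K, L)\<in>splits M.
        bracket (bidegree i j f K) (bidegree (m - i) (n - j) y L))"
    by (simp only: sum_series_apply series_bracket_def)
  also have "\<dots> = (\<Sum>(K, L)\<in>splits M. \<Sum>i\<le>m. \<Sum>j\<le>n.
        bracket (bidegree i j f K) (bidegree (m - i) (n - j) y L))"
  proof -
    have "(\<Sum>i\<le>m. \<Sum>j\<le>n. \<Sum>p\<in>splits M. G i j p) = (\<Sum>i\<le>m. \<Sum>p\<in>splits M. \<Sum>j\<le>n. G i j p)"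
      for G :: "nat \<Rightarrow> nat \<Rightarrow> monomial \<times> monomial \<Rightarrow> 'p"
      by (intro sum.cong refl) (rule sum.swap)
    also have "(\<Sum>i\<le>m. \<Sum>p\<in>splits M. \<Sum>j\<le>n. G i j p) = (\<Sum>p\<in>splits M. \<Sum>i\<le>m. \<Sum>j\<le>n. G i j p)"
      for G :: "nat \<Rightarrow> nat \<Rightarrow> monomial \<times> monomial \<Rightarrow> 'p"
      by (rule sum.swap)
    finally show ?thesis by (simp only: case_prod_unfold)
  qed
  also have "\<dots> = (\<Sum>(K, L)\<in>splits M. if ordB M = m \<and> ordA M = n then bracket (f K) (y L) else 0)"
    by (intro sum.cong refl) (auto simp: inner)
  also have "\<dots> = bidegree m n (br f y) M"
    by (cases "ordB M = m \<and> ordA M = n")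
      (auto simp: bidegree_def series_bracket_def intro!: sum.neutral)
  finally show "bidegree m n (br f y) M =
    (\<Sum>i\<le>m. \<Sum>j\<le>n. br (bidegree i j f) (bidegree (m - i) (n - j) y)) M" ..
qed

lemma word_series_br:
  assumes "word_series f" "word_series y"
  shows "word_series (br f y)"
proof -
  have "br (bidegree i j f) (bidegree (m - i) (n - j) y) \<in> word_span m n"
    if "i \<le> m" "j \<le> n" for i j m n
    using word_span_br[of "bidegree i j f" i j "bidegree (m - i) (n - j) y" "m - i" "n - j"]
      assms that by (simp add: word_series_def)
  then show ?thesis
    unfolding word_series_def bidegree_br by (auto intro!: word_span_sum)
qed

lemma word_series_add: "word_series f \<Longrightarrow> word_series g \<Longrightarrow> word_series (f + g)"
proof -
  have "bidegree m n (f + g) = bidegree m n f + bidegree m n g" for m n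
    by (auto simp: bidegree_def)
  then show "word_series f \<Longrightarrow> word_series g \<Longrightarrow> word_series (f + g)"
    by (simp add: word_series_def word_span_add)
qed

lemma word_series_proj:
  assumes "word_series f" "J \<in> {{..<0}, {0}, {0<..}}"
  shows "word_series (series_proj P J f)"
proof -
  have "bidegree m n (series_proj P J f) = series_proj P J (bidegree m n f)" for m n
    by (auto simp: bidegree_def series_proj_def)
  then show ?thesis using assms word_span_proj by (simp add: word_series_def)
qed

lemma word_series_euler:
  assumes "word_series f"
  shows "word_series (series_euler f)"
proof -
  have "bidegree m n (series_euler f) = sscale (of_nat n) (bidegree m n f)" for m n
    by (auto simp: bidegree_def series_euler_def series_scale_def)
  then show ?thesis using assms by (simp add: word_series_def word_span_scale)
qed

text \<open>All monomials of bidegree (m, n) have size m + n, so on each homogeneous part the series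
  in ad f is one finite sum.\<close>

lemma word_series_ad:
  assumes "word_series f" "word_series y"
  shows "word_series (series_ad c f y)"
  unfolding word_series_def
proof (intro allI)
  fix m n
  have "word_series ((br f ^^ k) y)" for k
    by (induction k) (simp_all add: assms word_series_br)
  moreover have "bidegree m n (series_ad c f y) =
      (\<Sum>k\<le>m + n. sscale (c k) (bidegree m n ((br f ^^ k) y)))"
    by (rule ext) (auto simp: bidegree_def series_ad_def sum_series_apply series_scale_def
        size_eq_ord add.commute)
  ultimately show "bidegree m n (series_ad c f y) \<in> word_span m n"
    by (auto simp: word_series_def intro!: word_span_sum word_span_scale)
qed

lemma word_series_defect:
  assumes "word_series S"
  shows "word_series (defect S)"
  unfolding defect_def correction_def log_deriv2_def phi'_def
  by (intro word_series_add word_series_br word_series_ad word_series_euler word_series_proj assms)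
    simp_all

lemma word_series_g_plus: "word_series gp"
  unfolding word_series_def
proof (intro allI)
  fix m n
  have "bidegree m n gp = (if m = 0 \<and> n = 1 then gp else 0)"
    by (rule ext) (auto simp: bidegree_def g_plus_eq_0)
  then show "bidegree m n gp \<in> word_span m n"
    by (auto simp: word_span_0) (auto simp: word_span_def intro!: series.span_base pword.second[simplified])
qed

lemma word_series_g_minus: "word_series gm"
  unfolding word_series_def
proof (intro allI)
  fix m n
  have "bidegree m n gm = (if m = 1 \<and> n = 0 then gm else 0)"
    by (rule ext) (auto simp: bidegree_def g_minus_eq_0)
  then show "bidegree m n gm \<in> word_span m n"
    by (auto simp: word_span_0) (auto simp: word_span_def intro!: series.span_base pword.first[simplified])
qed

text \<open>The recursion forms only brackets, projections and rational multiples. By induction on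
  the total degree, the truncation T is a combination of words, and it determines the defect in
  degree m + n.\<close>

lemma word_series_sol: "word_series sol"
proof -
  have "bidegree m n sol \<in> word_span m n" for m n
  proof (induction "m + n" arbitrary: m n rule: less_induct)
    case less
    show ?case
    proof (cases "n = 0")
      case True
      then have "bidegree m n sol = bidegree m n gm"
        by (auto simp: bidegree_def sol_ordA_0)
      then show ?thesis using word_series_g_minus by (simp add: word_series_def)
    next
      case False
      define T where "T = (\<lambda>M. if size M < m + n then sol M else 0)"
      have "bidegree i j T = (if i + j < m + n then bidegree i j sol else 0)" for i j
        by (rule ext) (auto simp: bidegree_def T_def size_eq_ord add.commute)
      then have T: "word_series T"
        using less by (auto simp: word_series_def word_span_0)
      have "defect sol M = defect T M" if "size M = m + n" for M
        using that mset_subset_size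
        by (intro defect_cong) (force simp: agree_def T_def)
      then have "bidegree m n sol =
          sscale (1 / of_nat n) (bidegree m n gp + sscale (- 1) (bidegree m n (defect T)))"
        using False
        by (intro ext) (auto simp: bidegree_def series_scale_def sol_step size_eq_ord add.commute)
      then show ?thesis
        using word_series_g_plus word_series_defect[OF T]
        by (simp add: word_series_def word_span_diff word_span_scale)
    qed
  qed
  then show ?thesis by (simp add: word_series_def)
qed

lemma word_series_imp:
  assumes "word_series f"
  shows "f \<in> pword_series scale bracket P gm gp"
proof -
  have "f M = (\<Sum>(m, n)\<in>{(m, n). bidegree m n f M \<noteq> 0}. bidegree m n f M)" for M
  proof -
    have "{(m, n). bidegree m n f M \<noteq> 0} = (if f M = 0 then {} else {(ordB M, ordA M)})"
      by (auto simp: bidegree_def split: if_splits)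
    then show ?thesis by (simp add: bidegree_def)
  qed
  then show ?thesis
    using assms unfolding pword_series_def word_series_def word_span_def
    by (intro CollectI exI[of _ "\<lambda>m n. bidegree m n f"]) auto
qed

end

section \<open>Comparison in the enveloping algebra\<close>

context central_scalars
begin

lemma ad_series_add: "ad_series c s (y + z) = ad_series c s y + ad_series c s z"
proof -
  have "(comm s ^^ k) (y + z) = (comm s ^^ k) y + (comm s ^^ k) z" for k
    by (induction k) (simp_all add: comm_def algebra_simps)
  then show ?thesis
    by (intro ser_eqI) (simp add: ad_series_def ser_suminf_def distrib_left sum.distrib)
qed

lemma ad_series_0 [simp]: "ad_series c s 0 = 0"
  using ad_series_add[of c s 0 0] by simp

lemma ad_series_self: "ad_series c s s = smul (c 0) s"
proof (rule ser_eqI)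
  fix M
  have "(comm s ^^ k) s = (if k = 0 then s else 0)" for k
    by (induction k) auto
  then have "coeff (ad_series c s s) M = (\<Sum>k\<le>size M. if k = 0 then \<kappa> (c 0) * coeff s M else 0)"
    unfolding ad_series_def ser_suminf_def coeff_Ser by (intro sum.cong) auto
  then show "coeff (ad_series c s s) M = coeff (smul (c 0) s) M" by simp
qed

text \<open>The Leibniz rule places one logarithmic derivative in front of each factor; carrying it
  left past an exponential e^s costs an application of e^(ad s).\<close>

lemma euler_exp3:
  assumes "coeff s {#} = 0" "coeff t {#} = 0" "coeff u {#} = 0"
  defines "\<phi> \<equiv> \<lambda>k. 1 / fact (Suc k)" and "\<epsilon> \<equiv> \<lambda>k. 1 / fact k"
  shows "euler (ser_exp s * ser_exp t * ser_exp u) =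
    (ad_series \<phi> s (euler s) + ad_series \<epsilon> s (ad_series \<phi> t (euler t) +
      ad_series \<epsilon> t (ad_series \<phi> u (euler u)))) * (ser_exp s * ser_exp t * ser_exp u)"
proof -
  define y z where "y = ad_series \<phi> t (euler t)" and "z = ad_series \<phi> u (euler u)"
  have "euler (ser_exp s * ser_exp t * ser_exp u) =
      ad_series \<phi> s (euler s) * (ser_exp s * ser_exp t * ser_exp u) +
      (ser_exp s * y) * (ser_exp t * ser_exp u) +
      ser_exp s * (ser_exp t * z) * ser_exp u"
    by (simp add: euler_mult euler_ser_exp assms y_def z_def distrib_left distrib_right
        mult.assoc del: fact_Suc)
  also have "ser_exp t * z = ad_series \<epsilon> t z * ser_exp t"
    unfolding \<epsilon>_def by (rule ser_exp_mult) (rule assms)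
  also have "ser_exp s * (ad_series \<epsilon> t z * ser_exp t) = (ser_exp s * ad_series \<epsilon> t z) * ser_exp t"
    by (simp add: mult.assoc)
  also have "ser_exp s * ad_series \<epsilon> t z = ad_series \<epsilon> s (ad_series \<epsilon> t z) * ser_exp s"
    unfolding \<epsilon>_def by (rule ser_exp_mult) (rule assms)
  also have "ser_exp s * y = ad_series \<epsilon> s y * ser_exp s"
    unfolding \<epsilon>_def by (rule ser_exp_mult) (rule assms)
  finally show ?thesis
    by (simp add: y_def[symmetric] z_def[symmetric] ad_series_add distrib_right mult.assoc add.assoc)
qed

lemma coeff_ser_exp_empty: "coeff (ser_exp s) {#} = 1"
  by (simp add: ser_exp_def ser_suminf_def coeff_one)

lemma ser_exp_0 [simp]: "ser_exp 0 = 1"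
proof (rule ser_eqI)
  fix M
  have "coeff (ser_exp 0) M = (\<Sum>n\<le>size M. if n = 0 then coeff 1 M else 0)"
    unfolding ser_exp_def ser_suminf_def coeff_Ser
    by (intro sum.cong) (auto simp: power_0_left)
  then show "coeff (ser_exp 0) M = coeff 1 M" by simp
qed

end

section \<open>Dependence of coefficients on divisors\<close>

definition eq_upto :: "monomial \<Rightarrow> 'a::ring_1 ser \<Rightarrow> 'a ser \<Rightarrow> bool" where
  "eq_upto M s t \<longleftrightarrow> (\<forall>K. K \<subseteq># M \<longrightarrow> coeff s K = coeff t K)"

lemma eq_upto_refl [simp]: "eq_upto M s s"
  by (simp add: eq_upto_def)

lemma eq_upto_mult:
  assumes "eq_upto M s s'" "eq_upto M t t'"
  shows "eq_upto M (s * t) (s' * t')"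
  unfolding eq_upto_def
proof (intro allI impI)
  fix N assume N: "N \<subseteq># M"
  show "coeff (s * t) N = coeff (s' * t') N"
    unfolding coeff_mult
  proof (rule sum.cong[OF refl], clarify)
    fix K L assume "N = K + L"
    then have "K \<subseteq># M" "L \<subseteq># M"
      using N by (meson mset_subset_eq_add_left mset_subset_eq_add_right subset_mset.order_trans)+
    then show "coeff s K * coeff t L = coeff s' K * coeff t' L"
      using assms by (simp add: eq_upto_def)
  qed
qed

lemma (in central_scalars) eq_upto_ser_exp:
  assumes "eq_upto M s t"
  shows "eq_upto M (ser_exp s) (ser_exp t)"
proof -
  have "eq_upto M (s ^ n) (t ^ n)" for n
    by (induction n) (simp_all add: assms eq_upto_mult)
  then show ?thesis by (simp add: eq_upto_def ser_exp_def ser_suminf_def)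
qed

definition eq_below :: "monomial \<Rightarrow> 'a::ring_1 ser \<Rightarrow> 'a ser \<Rightarrow> bool" where
  "eq_below M s t \<longleftrightarrow> (\<forall>K. K \<subset># M \<longrightarrow> coeff s K = coeff t K)"

lemma eq_below_upto: "eq_below M s t \<longleftrightarrow> (\<forall>K. K \<subset># M \<longrightarrow> eq_upto K s t)"
  unfolding eq_below_def eq_upto_def by (meson subset_mset.le_less_trans subset_mset.order_refl)

lemma eq_below_mult: "eq_below M s s' \<Longrightarrow> eq_below M t t' \<Longrightarrow> eq_below M (s * t) (s' * t')"
  by (simp add: eq_below_upto eq_upto_mult)

text \<open>A factorization of M into two nonempty parts involves proper divisors only, where the
  series agree. What is left are the two factorizations with an empty part, which are distinct as M
  is nonempty.\<close>

lemma coeff_mult_diff: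
  assumes "eq_below M s s'" "eq_below M t t'" "M \<noteq> {#}"
  shows "coeff (s * t) M - coeff (s' * t') M =
    coeff s {#} * (coeff t M - coeff t' M) + (coeff s M - coeff s' M) * coeff t {#}"
proof -
  have "{#} \<subset># M" using assms(3) by (simp add: subset_mset.zero_less_iff_neq_zero)
  then have empty: "coeff s' {#} = coeff s {#}" "coeff t' {#} = coeff t {#}"
    using assms by (simp_all add: eq_below_def)
  have "coeff (s * t) M - coeff (s' * t') M =
      (\<Sum>(K, L)\<in>splits M. coeff s K * coeff t L - coeff s' K * coeff t' L)"
    by (simp add: coeff_mult sum_subtractf case_prod_unfold)
  also have "\<dots> = (\<Sum>(K, L)\<in>{({#}, M), (M, {#})}. coeff s K * coeff t L - coeff s' K * coeff t' L)"
  proof (rule sum.mono_neutral_right)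
    show "\<forall>KL\<in>splits M - {({#}, M), (M, {#})}.
        (case KL of (K, L) \<Rightarrow> coeff s K * coeff t L - coeff s' K * coeff t' L) = 0"
    proof
      fix KL assume KL: "KL \<in> splits M - {({#}, M), (M, {#})}"
      obtain K L where KL_eq: "KL = (K, L)" by (cases KL)
      have "K \<subset># M" "L \<subset># M" using KL by (auto simp: KL_eq subset_mset.less_le)
      then show "(case KL of (K, L) \<Rightarrow> coeff s K * coeff t L - coeff s' K * coeff t' L) = 0"
        using assms by (simp add: KL_eq eq_below_def)
    qed
  qed auto
  also have "\<dots> = coeff s {#} * (coeff t M - coeff t' M) + (coeff s M - coeff s' M) * coeff t {#}"
    using assms(3) empty by (simp add: algebra_simps)
  finally show ?thesis .
qed

context central_scalars
begin

lemma eq_below_ser_exp: "eq_below M s t \<Longrightarrow> eq_below M (ser_exp s) (ser_exp t)"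
  by (simp add: eq_below_upto eq_upto_ser_exp)

text \<open>In a power with exponent at least two, the coefficient at M is always multiplied by a
  constant term, which is zero. Only the exponent one contributes.\<close>

lemma coeff_ser_exp_diff:
  assumes "eq_below M s t" "coeff s {#} = 0" "coeff t {#} = 0" "M \<noteq> {#}"
  shows "coeff (ser_exp s) M - coeff (ser_exp t) M = coeff s M - coeff t M"
proof -
  have pow: "eq_below M (s ^ n) (t ^ n)" for n
    by (induction n) (simp_all add: assms eq_below_mult, simp add: eq_below_def)
  have eq: "coeff (s ^ n) M - coeff (t ^ n) M = (if n = 1 then coeff s M - coeff t M else 0)" for n
  proof (cases "n = 0 \<or> n = 1")
    case False
    then obtain k where n: "n = Suc (Suc k)" by (metis not0_implies_Suc One_nat_def)
    have "coeff (s * s ^ Suc k) M - coeff (t * t ^ Suc k) M =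
        coeff s {#} * (coeff (s ^ Suc k) M - coeff (t ^ Suc k) M) +
        (coeff s M - coeff t M) * coeff (s ^ Suc k) {#}"
      by (rule coeff_mult_diff[OF assms(1) pow assms(4)])
    then show ?thesis using assms(2) n by simp
  qed auto
  have "coeff (ser_exp s) M - coeff (ser_exp t) M =
      (\<Sum>n\<le>size M. \<kappa> (1 / fact n) * (coeff (s ^ n) M - coeff (t ^ n) M))"
    by (simp add: ser_exp_def ser_suminf_def sum_subtractf right_diff_distrib)
  also have "\<dots> = (\<Sum>n\<le>size M. if n = 1 then coeff s M - coeff t M else 0)"
    by (intro sum.cong refl) (simp add: eq)
  also have "\<dots> = coeff s M - coeff t M"
    using assms(4) by (auto simp: not_le nonempty_has_size Suc_le_eq)
  finally show ?thesis .
qed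

lemma coeff_exp3_diff:
  assumes "eq_below M s s'" "eq_below M t t'" "eq_below M u u'" "M \<noteq> {#}"
    and "coeff s {#} = 0" "coeff s' {#} = 0" "coeff t {#} = 0" "coeff t' {#} = 0"
    "coeff u {#} = 0" "coeff u' {#} = 0"
  shows "coeff (ser_exp s * ser_exp t * ser_exp u) M - coeff (ser_exp s' * ser_exp t' * ser_exp u') M =
    (coeff s M - coeff s' M) + (coeff t M - coeff t' M) + (coeff u M - coeff u' M)"
  using assms by (simp add: coeff_mult_diff eq_below_mult eq_below_ser_exp coeff_ser_exp_empty
      coeff_ser_exp_diff add_ac)

end

section \<open>Lifting the differential equation\<close>

context lie_algebra
begin

lemma coeff_lift_empty: "f {#} = 0 \<Longrightarrow> coeff (lift f) {#} = 0"
  by (simp add: lift_series_def)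

lemma series_cong_sum:
  assumes "\<And>i. i \<in> I \<Longrightarrow> f i - g i \<in> uea_ideal scale bracket"
  shows "sum f I - sum g I \<in> uea_ideal scale bracket"
  unfolding sum_subtractf[symmetric] by (rule uea_ideal_sum) (rule assms)

lemma ad_series_cong:
  assumes "s \<approx> s'" "y \<approx> y'"
  shows "free_alg.ad_series c s y \<approx> free_alg.ad_series c s' y'"
proof -
  have *: "(comm s ^^ k) y \<approx> (comm s' ^^ k) y'" for k
    by (induction k) (simp_all add: assms cong_comm)
  show ?thesis
    unfolding series_cong_def free_alg.ad_series_def ser_suminf_def coeff_Ser
  proof (intro allI series_cong_sum)
    fix M k
    show "coeff (free_alg.smul (c k) ((comm s ^^ k) y)) M -
        coeff (free_alg.smul (c k) ((comm s' ^^ k) y')) M \<in> uea_ideal scale bracket"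
      using *[of k] by (simp add: series_cong_def right_diff_distrib[symmetric] uea_ideal_mult_left)
  qed
qed

text \<open>By \<open>lift_bracket\<close>, iterated brackets become iterated commutators; the rest
  is linearity of \<open>gen\<close> modulo the ideal.\<close>

lemma lift_series_ad: "lift (series_ad c f y) \<approx> free_alg.ad_series c (lift f) (lift y)"
  unfolding series_cong_def
proof
  fix M
  let ?J = "uea_ideal scale bracket" and ?z = "\<lambda>k. (br f ^^ k) y"
  have pow: "lift (?z k) \<approx> (comm (lift f) ^^ k) (lift y)" for k
  proof (induction k)
    case (Suc k)
    have "lift (br f (?z k)) \<approx> comm (lift f) (lift (?z k))" by (rule lift_bracket)
    also have "comm (lift f) (lift (?z k)) \<approx> comm (lift f) ((comm (lift f) ^^ k) (lift y))"
      by (rule cong_comm[OF cong_refl Suc.IH])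
    finally show ?case by simp
  qed simp
  have "gen (scale (c k) (?z k M)) - const (c k) * coeff ((comm (lift f) ^^ k) (lift y)) M \<in> ?J" for k
  proof -
    have "coeff (lift (?z k)) M - coeff ((comm (lift f) ^^ k) (lift y)) M \<in> ?J"
      using pow[of k] by (simp add: series_cong_def)
    then have "(gen (scale (c k) (?z k M)) - const (c k) * gen (?z k M)) -
        const (c k) * (coeff (lift (?z k)) M - gen (?z k M)) +
        const (c k) * (coeff (lift (?z k)) M - coeff ((comm (lift f) ^^ k) (lift y)) M) \<in> ?J"
      by (intro uea_ideal_add[OF uea_ideal_diff] uea_ideal_mult_left gen_relations coeff_lift)
    then show ?thesis by (simp add: algebra_simps)
  qed
  then have 1: "(\<Sum>k\<le>size M. gen (scale (c k) (?z k M))) -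
      coeff (free_alg.ad_series c (lift f) (lift y)) M \<in> ?J"
    by (simp add: free_alg.ad_series_def ser_suminf_def series_cong_sum)
  have 2: "gen (series_ad c f y M) - (\<Sum>k\<le>size M. gen (scale (c k) (?z k M))) \<in> ?J"
    unfolding series_ad_def by (rule gen_sum)
  show "coeff (lift (series_ad c f y)) M - coeff (free_alg.ad_series c (lift f) (lift y)) M \<in> ?J"
    using uea_ideal_add[OF uea_ideal_add[OF coeff_lift[of "series_ad c f y" M] 2] 1] by simp
qed

lemma lift_euler: "lift (series_euler f) \<approx> euler (lift f)"
  unfolding series_cong_def
proof
  fix M
  show "coeff (lift (series_euler f)) M - coeff (euler (lift f)) M \<in> uea_ideal scale bracket"
    using lift_scale[of "series_euler f" "\<lambda>M. of_nat (ordA M)" f M]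
    by (simp add: series_euler_def)
qed

lemma lift_series_ad_cong:
  assumes "lift y \<approx> z"
  shows "lift (series_ad c f y) \<approx> free_alg.ad_series c (lift f) z"
  using cong_trans[OF lift_series_ad ad_series_cong[OF cong_refl assms]] .

lemma lift_add_cong: "lift f \<approx> s \<Longrightarrow> lift g \<approx> t \<Longrightarrow> lift (f + g) \<approx> s + t"
  using cong_trans[OF lift_add cong_add] .

text \<open>At M the left side is the coefficient of the solution times \<open>ordA M\<close>, while
  the right side involves only monomials shorter than M because the coefficient series has no
  constant term. So the coefficients at \<open>ordA M = 0\<close> determine all others, modulo the
  ideal.\<close>

lemma linear_ode_unique:
  assumes X: "euler X = \<Phi> * X" and Y: "euler Y = \<Lambda> * Y" and "\<Phi> \<approx> \<Lambda>" and "coeff \<Lambda> {#} = 0"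
    and init: "\<And>M. ordA M = 0 \<Longrightarrow> coeff X M - coeff Y M \<in> uea_ideal scale bracket"
  shows "X \<approx> Y"
proof -
  let ?J = "uea_ideal scale bracket"
  have "\<Phi> * X \<approx> \<Lambda> * X" using cong_mult[OF \<open>\<Phi> \<approx> \<Lambda>\<close> cong_refl] .
  then have step: "coeff (\<Phi> * X) M - coeff (\<Lambda> * X) M \<in> ?J" for M by (simp add: series_cong_def)
  have "coeff X M - coeff Y M \<in> ?J" for M
  proof (induction "size M" arbitrary: M rule: less_induct)
    case less
    show ?case
    proof (cases "ordA M = 0")
      case False
      have "coeff \<Lambda> K * coeff X L - coeff \<Lambda> K * coeff Y L \<in> ?J" if "K + L = M" for K L
      proof (cases "K = {#}")
        case False
        then have "size L < size M" using that by (auto simp: nonempty_has_size)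
        then show ?thesis
          using less.hyps[of L] by (simp add: right_diff_distrib[symmetric] uea_ideal_mult_left)
      qed (simp add: assms)
      then have "coeff (\<Lambda> * X) M - coeff (\<Lambda> * Y) M \<in> ?J"
        unfolding coeff_mult by (intro series_cong_sum) auto
      from uea_ideal_add[OF step[of M] this]
      have "coeff (euler X) M - coeff (euler Y) M \<in> ?J" by (simp add: X Y)
      \<comment> \<open>Division by \<open>ordA M\<close> is multiplication by a scalar of the free
        algebra, under which the ideal is stable.\<close>
      then have "const (1 / of_nat (ordA M)) * (of_nat (ordA M) * (coeff X M - coeff Y M)) \<in> ?J"
        by (intro uea_ideal_mult_left[of _ scale bracket "const _"]) (simp add: right_diff_distrib)
      moreover have inv: "const (1 / of_nat (ordA M)) * of_nat (ordA M) = (1 :: ('f, 'p) free_alg)"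
        unfolding free_alg.\<kappa>_of_nat[symmetric] free_alg.\<kappa>_mult[symmetric] using False by simp
      ultimately show ?thesis by (simp only: mult.assoc[symmetric] inv mult_1_left)
    qed (rule init)
  qed
  then show ?thesis by (simp add: series_cong_def)
qed

end

section \<open>Existence and uniqueness\<close>

context factorization_problem
begin

abbreviation E :: "'p series \<Rightarrow> ('f, 'p) free_alg ser" where
  "E f \<equiv> free_alg.ser_exp (lift f)"

text \<open>Since D g^+ = g^+ commutes with g^+, the operator phi(ad g^+) fixes it, and D g^- =
  0.\<close>

lemma lift_g_plus_ode: "euler (E gp * E gm) = lift gp * (E gp * E gm)"
proof -
  have empty: "coeff (lift gp) {#} = 0" "coeff (lift gm) {#} = 0"
    by (simp_all add: coeff_lift_empty g_plus_eq_0 g_minus_eq_0)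
  have "euler (lift gp) = lift gp"
  proof (rule ser_eqI)
    fix M show "coeff (euler (lift gp)) M = coeff (lift gp) M"
      using g_plus_eq_0[of M p] by (cases "ordA M = 1") (simp_all add: lift_series_def)
  qed
  moreover have "euler (lift gm) = 0"
  proof (rule ser_eqI)
    fix M show "coeff (euler (lift gm)) M = coeff 0 M"
      using g_minus_eq_0[of M p] by (cases "ordA M = 0") (simp_all add: lift_series_def)
  qed
  ultimately show ?thesis
    by (simp add: euler_mult free_alg.euler_ser_exp empty free_alg.ad_series_self mult.assoc)
qed

lemma existence: "E gp * E gm \<approx> E (neg sol) * E (pos sol) * E (zer sol)"
proof (rule cong_sym)
  define a b c where "a = neg sol" and "b = pos sol" and "c = zer sol"
  have empty: "coeff (lift a) {#} = 0" "coeff (lift b) {#} = 0" "coeff (lift c) {#} = 0"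
    by (simp_all add: a_def b_def c_def coeff_lift_empty series_proj_empty)
  define \<Phi> where "\<Phi> = free_alg.ad_series phi (lift a) (euler (lift a)) +
    free_alg.ad_series exp_coeff (lift a) (free_alg.ad_series phi (lift b) (euler (lift b)) +
      free_alg.ad_series exp_coeff (lift b) (free_alg.ad_series phi (lift c) (euler (lift c))))"
  have "lift (log_deriv a b c) \<approx> \<Phi>"
    unfolding log_deriv_def log_deriv2_def \<Phi>_def
    by (intro lift_add_cong lift_series_ad_cong lift_euler)
  then have \<Phi>: "\<Phi> \<approx> lift gp"
    using log_deriv_sol cong_sym by (simp add: a_def b_def c_def)
  have ode: "euler (E a * E b * E c) = \<Phi> * (E a * E b * E c)"
    unfolding \<Phi>_def by (rule free_alg.euler_exp3[OF empty])
  show "E (neg sol) * E (pos sol) * E (zer sol) \<approx> E gp * E gm"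
    unfolding a_def[symmetric] b_def[symmetric] c_def[symmetric]
  proof (rule linear_ode_unique[OF ode lift_g_plus_ode \<Phi>])
    show "coeff (lift gp) {#} = 0" by (simp add: coeff_lift_empty g_plus_eq_0)
    fix M assume M: "ordA M = 0"
    have sub: "ordA K = 0" if "K \<subseteq># M" for K using submultiset_ord(1)[OF that] M by simp
    have proj: "series_proj P J sol K = series_proj P J gm K" if "K \<subseteq># M" for J K
      using sub[OF that] by (simp add: series_proj_def sol_ordA_0)
    \<comment> \<open>At A = 0 the solution is g^-, which is its own negative part, so both products
      reduce to e^(g^-).\<close>
    have "eq_upto M (lift a) (lift gm)" "eq_upto M (lift b) 0" "eq_upto M (lift c) 0"
      "eq_upto M (lift gp) 0"
      by (auto simp: eq_upto_def lift_series_def a_def b_def c_def proj proj_g_minus sub g_plus_eq_0)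
    then have "eq_upto M (E a * E b * E c) (E gm * free_alg.ser_exp 0 * free_alg.ser_exp 0)"
      "eq_upto M (E gp * E gm) (free_alg.ser_exp 0 * E gm)"
      by (intro eq_upto_mult free_alg.eq_upto_ser_exp; simp)+
    then show "coeff (E a * E b * E c) M - coeff (E gp * E gm) M \<in> uea_ideal scale bracket"
      by (simp add: eq_upto_def)
  qed
qed

lemma uniqueness:
  assumes cong: "E a * E b * E c \<approx> E a' * E b' * E c'"
    and empty: "a {#} = 0" "b {#} = 0" "c {#} = 0" "a' {#} = 0" "b' {#} = 0" "c' {#} = 0"
    and parts: "a \<in> series_in (graded_part scale P {..<0})" "a' \<in> series_in (graded_part scale P {..<0})"
      "b \<in> series_in (graded_part scale P {0<..})" "b' \<in> series_in (graded_part scale P {0<..})"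
      "c \<in> series_in (P 0)" "c' \<in> series_in (P 0)"
  shows "a = a' \<and> b = b' \<and> c = c'"
proof -
  have "a M = a' M \<and> b M = b' M \<and> c M = c' M" for M
  proof (induction "size M" arbitrary: M rule: less_induct)
    case less
    show ?case
    proof (cases "M = {#}")
      case False
      let ?J = "uea_ideal scale bracket"
      have "a K = a' K \<and> b K = b' K \<and> c K = c' K" if "K \<subset># M" for K
        using less mset_subset_size[OF that] by blast
      then have below: "eq_below M (lift a) (lift a')" "eq_below M (lift b) (lift b')"
        "eq_below M (lift c) (lift c')"
        by (simp_all add: eq_below_def lift_series_def)
      have "(coeff (lift a) M - coeff (lift a') M) + (coeff (lift b) M - coeff (lift b') M) +
          (coeff (lift c) M - coeff (lift c') M) \<in> ?J"
      proof -
        have "coeff (E a * E b * E c) M - coeff (E a' * E b' * E c') M \<in> ?J"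
          using cong by (simp add: series_cong_def)
        then show ?thesis
          by (subst (asm) free_alg.coeff_exp3_diff[OF below False])
            (simp_all add: empty coeff_lift_empty)
      qed
      \<comment> \<open>The three differences are gathered into one difference of sums;
        \<open>lift\<close> is additive only modulo the ideal.\<close>
      moreover have "(coeff (lift (a + b + c)) M - coeff (lift a + lift b + lift c) M) -
          (coeff (lift (a' + b' + c')) M - coeff (lift a' + lift b' + lift c') M) \<in> ?J"
      proof -
        have *: "coeff (lift (f + g + h)) M - coeff (lift f + lift g + lift h) M \<in> ?J" for f g h
          using lift_add_cong[OF lift_add cong_refl] unfolding series_cong_def by blast
        show ?thesis by (rule uea_ideal_diff[OF * *])
      qed
      ultimately have "coeff (lift (a + b + c)) M - coeff (lift (a' + b' + c')) M \<in> ?J"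
        using uea_ideal_add by (fastforce simp: algebra_simps)
      then have "(coeff (lift (a + b + c)) M - coeff (lift (a' + b' + c')) M) -
          (coeff (lift (a + b + c)) M - gen ((a + b + c) M)) +
          (coeff (lift (a' + b' + c')) M - gen ((a' + b' + c') M)) \<in> ?J"
        by (intro uea_ideal_add[OF uea_ideal_diff] coeff_lift)
      then have gens: "gen ((a + b + c) M) - gen ((a' + b' + c') M) \<in> ?J" by simp
      define x x' where "x = (a + b + c) M" and "x' = (a' + b' + c') M"
      \<comment> \<open>Injectivity speaks of a single generator, so the difference of generators is
        first replaced by \<open>gen (x - x')\<close>.\<close>
      have "gen (x - x') + gen x' - gen x \<in> ?J"
        using uea_ideal_uminus[OF gen_relations(1)[of "x - x'" x']] by (simp add: algebra_simps)
      then have "(gen (x - x') + gen x' - gen x) + (gen x - gen x') \<in> ?J"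
        using gens unfolding x_def x'_def by (rule uea_ideal_add)
      then have "gen (x - x') \<in> ?J" by simp
      then have "x - x' = 0" by (rule gen_in_uea_ideal)
      then have eq: "a M + b M + c M = a' M + b' M + c' M" by (simp add: x_def x'_def)
      have in_parts: "a M \<in> graded_part scale P {..<0}" "a' M \<in> graded_part scale P {..<0}"
        "b M \<in> graded_part scale P {0<..}" "b' M \<in> graded_part scale P {0<..}"
        "c M \<in> P 0" "c' M \<in> P 0"
        using parts by (simp_all add: series_in_def)
      have proj: "graded_proj P J (a M + b M + c M) = graded_proj P J (a' M + b' M + c' M)" for J
        by (simp only: eq)
      have disjoint: "{..<0} \<inter> {0<..} = ({} :: int set)" "{0<..} \<inter> {..<0} = ({} :: int set)"
        by auto
      from proj[of "{..<0}"] proj[of "{0<..}"] proj[of "{0}"] in_parts show ?thesis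
        by (simp add: disjoint graded_proj_add graded_proj_part[OF in_parts(1)] graded_proj_part[OF in_parts(2)]
            graded_proj_part[OF in_parts(3)] graded_proj_part[OF in_parts(4)]
            graded_proj_homogeneous[OF in_parts(5)] graded_proj_homogeneous[OF in_parts(6)])
    qed (simp add: empty)
  qed
  then show ?thesis by auto
qed

end

section \<open>The required form and the terms of low order\<close>

context factorization_problem
begin

lemma factorization_iff:
  assumes "a {#} = 0" "b {#} = 0" "c {#} = 0"
  shows "uea_exp scale bracket gp \<otimes>\<^bsub>uea_series scale bracket\<^esub> uea_exp scale bracket gm =
      uea_exp scale bracket a \<otimes>\<^bsub>uea_series scale bracket\<^esub> uea_exp scale bracket b
        \<otimes>\<^bsub>uea_series scale bracket\<^esub> uea_exp scale bracket c \<longleftrightarrow>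
    E gp * E gm \<approx> E a * E b * E c"
  using assms by (simp add: uea_exp_eq g_plus_eq_0 g_minus_eq_0 uea_series_class_mult
      uea_series_class_eq_iff)

lemma only_mixed_terms_empty: "only_mixed_terms Q \<Longrightarrow> Q {#} = 0"
  by (force simp: only_mixed_terms_def)

text \<open>The component in \<open>P 0\<close> is the second argument of
  \<open>is_factorization\<close> but the last factor of the product, hence the order a, c,
  b.\<close>

lemma is_factorizationD:
  assumes "is_factorization scale bracket P p a c b"
  shows "a {#} = 0" "b {#} = 0" "c {#} = 0" "a \<in> series_in (graded_part scale P {..<0})"
    "b \<in> series_in (graded_part scale P {0<..})" "c \<in> series_in (P 0)"
    "E gp * E gm \<approx> E a * E b * E c"
proof -
  show empty: "a {#} = 0" "b {#} = 0" "c {#} = 0"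
    using assms by (auto simp: is_factorization_def only_mixed_terms_empty g_plus_eq_0 g_minus_eq_0)
  show "a \<in> series_in (graded_part scale P {..<0})"
    "b \<in> series_in (graded_part scale P {0<..})" "c \<in> series_in (P 0)"
    using assms by (simp_all add: is_factorization_def)
  show "E gp * E gm \<approx> E a * E b * E c"
    using assms by (simp add: is_factorization_def factorization_iff[of a b c, OF empty])
qed

lemma only_mixed_termsI:
  "(\<And>M. ordA M = 0 \<or> ordB M = 0 \<Longrightarrow> f M = 0) \<Longrightarrow> only_mixed_terms f"
  unfolding only_mixed_terms_def by (metis One_nat_def Suc_leI neq0_conv)

lemma series_proj_sol_nonmixed:
  assumes "ordA M = 0 \<or> ordB M = 0"
  shows "series_proj P J sol M = series_proj P J gm M + series_proj P J gp M"
proof -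
  have "sol M = gm M + gp M"
    using assms by (auto simp: sol_ordA_0 sol_ordB_0 g_plus_eq_0 g_minus_eq_0)
  then show ?thesis by (simp add: series_proj_def graded_proj_add)
qed

lemma mixed_proj_sol:
  "only_mixed_terms (neg sol - gm)" "only_mixed_terms (zer sol)" "only_mixed_terms (pos sol - gp)"
  by (rule only_mixed_termsI, simp add: series_proj_sol_nonmixed proj_g_plus proj_g_minus)+

lemma is_factorization_sol: "is_factorization scale bracket P p (neg sol) (zer sol) (pos sol)"
proof -
  have sub: "subspace (graded_part scale P J)" for J
    by (simp add: graded_part_def)
  have "neg sol - gm \<in> series_in (graded_part scale P {..<0})"
    "pos sol - gp \<in> series_in (graded_part scale P {0<..})" "zer sol \<in> series_in (P 0)"
    using g_plus_in g_minus_in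
    by (auto simp: series_in_def series_proj_def graded_proj_in graded_proj_0_in
        intro!: subspace_diff[OF sub])
  moreover have "neg sol \<in> series_in (graded_part scale P {..<0})"
    "pos sol \<in> series_in (graded_part scale P {0<..})"
    by (simp_all add: series_in_def series_proj_def graded_proj_in)
  moreover have "neg sol = gm + (neg sol - gm)" "pos sol = gp + (pos sol - gp)" by simp_all
  ultimately show ?thesis
    unfolding is_factorization_def
    using mixed_proj_sol existence
      factorization_iff[of "neg sol" "pos sol" "zer sol"] series_proj_empty[of sol, OF sol_empty]
    by blast
qed

lemma is_factorization_unique:
  assumes "is_factorization scale bracket P p a c b"
  shows "a = neg sol \<and> c = zer sol \<and> b = pos sol"
proof -
  note D = is_factorizationD[OF assms] and S = is_factorizationD[OF is_factorization_sol]
  have "E a * E b * E c \<approx> E (neg sol) * E (pos sol) * E (zer sol)"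
    by (rule cong_trans[OF cong_sym[OF D(7)] S(7)])
  then show ?thesis using uniqueness D S by blast
qed

lemma indet_neq_empty [simp]: "indet j \<noteq> {#}"
  by (simp add: indet_def)

lemma pair_unique:
  assumes "j > 0" "m < 0" "i > 0" "n < 0" "indet i + indet n = indet j + indet m"
  shows "i = j \<and> n = m"
  using indet_pair_splits[OF assms(5)] assms(1-4) by (auto simp: indet_eq_iff)

text \<open>A monomial of size below three in which both kinds of variables occur is a product of
  one A and one B, so the two hypotheses leave only mixed terms of order three or more.\<close>

lemma remainder:
  fixes f g :: "'p series"
  assumes lin: "\<And>M. ordA M = 0 \<or> ordB M = 0 \<Longrightarrow> f M = g M"
    and pair: "\<And>j m. j > 0 \<Longrightarrow> m < 0 \<Longrightarrow> f (indet j + indet m) = g (indet j + indet m)"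
  shows "only_terms_from_order 3 (f - g) \<and> only_mixed_terms (f - g)"
proof -
  have mixed: "only_mixed_terms (f - g)" by (rule only_mixed_termsI) (simp add: lin)
  moreover have "size M \<ge> 3" if "f M \<noteq> g M" for M
  proof (rule ccontr)
    assume "\<not> size M \<ge> 3"
    then have "ordA M = 1" "ordB M = 1"
      using mixed that by (auto simp: size_eq_ord only_mixed_terms_def dest!: spec[of _ M])
    then show False using pair that by (metis ord_1_1)
  qed
  ultimately show ?thesis by (auto simp: only_terms_from_order_def)
qed

lemma formal_sum_pair:
  assumes "j > 0" "m < 0"
  shows "formal_sum {(j, m). j > 0 \<and> m < 0 \<and> Q j m} (\<lambda>(j, m). indet j + indet m) c (indet j + indet m) =
    (if Q j m then c (j, m) else 0)"
proof -
  have "{i \<in> {(j, m). j > 0 \<and> m < 0 \<and> Q j m}. (case i of (j, m) \<Rightarrow> indet j + indet m) = indet j + indet m} =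
      (if Q j m then {(j, m)} else {})"
    using assms pair_unique[OF assms] by (auto split: if_splits)
  then show ?thesis by (simp add: formal_sum_def)
qed

lemma formal_sum_pair_0:
  assumes "ordA M = 0 \<or> ordB M = 0"
  shows "formal_sum {(j, m). j > 0 \<and> m < 0 \<and> Q j m} (\<lambda>(j, m). indet j + indet m) c M = 0"
  using assms by (intro formal_sum_eq_0) (auto simp: ordA_indet ordB_indet)

text \<open>Indexing by pairs with j + m = 0 allows the zero part to be handled like the other
  two.\<close>

lemma formal_sum_opposite:
  "formal_sum {j. j > 0} (\<lambda>j. indet j + indet (- j)) (\<lambda>j. c (j, - j)) =
    formal_sum {(j, m). j > 0 \<and> m < 0 \<and> j + m = 0} (\<lambda>(j, m). indet j + indet m) c"
  unfolding formal_sum_def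
  by (intro ext sum.reindex_bij_witness[of _ fst "\<lambda>j. (j, - j)"]) (auto simp: add_eq_0_iff)

text \<open>The coefficient at A_j B_m is homogeneous of degree j + m, so a projection either keeps
  it or kills it.\<close>

lemma sol_low_order:
  assumes "j > 0" "m < 0"
  shows "series_proj P J sol (indet j + indet m) = (if j + m \<in> J then bracket (p j) (p m) else 0)"
  using assms by (simp add: series_proj_def sol_pair)
    (simp add: graded_proj_homogeneous[OF bracket_P[OF p_in p_in]])

lemma remainders:
  "\<exists>Rm R0 Rp.
      only_terms_from_order 3 Rm \<and> only_mixed_terms Rm \<and>
      only_terms_from_order 3 R0 \<and> only_mixed_terms R0 \<and>
      only_terms_from_order 3 Rp \<and> only_mixed_terms Rp \<and>
      neg sol = formal_sum {j. j < 0} indet p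
        + formal_sum {(j, m). j > 0 \<and> m < 0 \<and> j + m < 0}
            (\<lambda>(j, m). indet j + indet m) (\<lambda>(j, m). bracket (p j) (p m)) + Rm \<and>
      zer sol = formal_sum {j. j > 0} (\<lambda>j. indet j + indet (- j)) (\<lambda>j. bracket (p j) (p (- j))) + R0 \<and>
      pos sol = formal_sum {j. j > 0} indet p
        + formal_sum {(j, m). j > 0 \<and> m < 0 \<and> j + m > 0}
            (\<lambda>(j, m). indet j + indet m) (\<lambda>(j, m). bracket (p j) (p m)) + Rp"
proof -
  let ?F = "\<lambda>Q. formal_sum {(j, m). j > 0 \<and> m < 0 \<and> Q j m}
    (\<lambda>(j, m). indet j + indet m) (\<lambda>(j, m). bracket (p j) (p m))"
  have zero: "gm (indet j + indet m) = 0" "gp (indet j + indet m) = 0" if "j > 0" "m < 0" for j m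
    using that by (simp_all add: g_plus_eq_0 g_minus_eq_0 ordA_indet ordB_indet)
  have m: "only_terms_from_order 3 (neg sol - (gm + ?F (\<lambda>j m. j + m < 0))) \<and>
      only_mixed_terms (neg sol - (gm + ?F (\<lambda>j m. j + m < 0)))"
    by (rule remainder) (auto simp: series_proj_sol_nonmixed proj_g_plus proj_g_minus formal_sum_pair_0
        formal_sum_pair sol_low_order zero)
  have p: "only_terms_from_order 3 (pos sol - (gp + ?F (\<lambda>j m. j + m > 0))) \<and>
      only_mixed_terms (pos sol - (gp + ?F (\<lambda>j m. j + m > 0)))"
    by (rule remainder) (auto simp: series_proj_sol_nonmixed proj_g_plus proj_g_minus formal_sum_pair_0
        formal_sum_pair sol_low_order zero)
  have z: "only_terms_from_order 3 (zer sol - ?F (\<lambda>j m. j + m = 0)) \<and>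
      only_mixed_terms (zer sol - ?F (\<lambda>j m. j + m = 0))"
    by (rule remainder) (auto simp: series_proj_sol_nonmixed proj_g_plus proj_g_minus formal_sum_pair_0
        formal_sum_pair sol_low_order zero)
  have opp: "formal_sum {j. j > 0} (\<lambda>j. indet j + indet (- j)) (\<lambda>j. bracket (p j) (p (- j))) =
      ?F (\<lambda>j m. j + m = 0)"
    using formal_sum_opposite[of "\<lambda>(j, m). bracket (p j) (p m)"] by simp
  show ?thesis
    unfolding opp g_plus_def[symmetric] g_minus_def[symmetric]
    using m p z
    by (intro exI[of _ "neg sol - (gm + ?F (\<lambda>j m. j + m < 0))"] exI[of _ "zer sol - ?F (\<lambda>j m. j + m = 0)"]
        exI[of _ "pos sol - (gp + ?F (\<lambda>j m. j + m > 0))"]) simp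
qed

end

theorem corollary4p1:
  fixes scale :: "'f::field_char_0 \<Rightarrow> 'p::ab_group_add \<Rightarrow> 'p"
    and bracket :: "'p \<Rightarrow> 'p \<Rightarrow> 'p"
    and P :: "int \<Rightarrow> 'p set"
    and p :: "int \<Rightarrow> 'p"
  assumes "graded_lie_algebra scale bracket P"
    and "\<And>j. j \<noteq> 0 \<Longrightarrow> p j \<in> P j"
  shows "\<exists>\<Psi>m \<Psi>0 \<Psi>p.
    is_factorization scale bracket P p \<Psi>m \<Psi>0 \<Psi>p \<and>
    (\<forall>\<Phi>m \<Phi>0 \<Phi>p. is_factorization scale bracket P p \<Phi>m \<Phi>0 \<Phi>p \<longrightarrow>
      \<Phi>m = \<Psi>m \<and> \<Phi>0 = \<Psi>0 \<and> \<Phi>p = \<Psi>p) \<and>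
    \<Psi>m \<in> pword_series scale bracket P (g_minus p) (g_plus p) \<and>
    \<Psi>0 \<in> pword_series scale bracket P (g_minus p) (g_plus p) \<and>
    \<Psi>p \<in> pword_series scale bracket P (g_minus p) (g_plus p) \<and>
    (\<exists>Rm R0 Rp.
      only_terms_from_order 3 Rm \<and> only_mixed_terms Rm \<and>
      only_terms_from_order 3 R0 \<and> only_mixed_terms R0 \<and>
      only_terms_from_order 3 Rp \<and> only_mixed_terms Rp \<and>
      \<Psi>m = formal_sum {j. j < 0} indet p
        + formal_sum {(j, m). j > 0 \<and> m < 0 \<and> j + m < 0}
            (\<lambda>(j, m). indet j + indet m) (\<lambda>(j, m). bracket (p j) (p m)) + Rm \<and>
      \<Psi>0 = formal_sum {j. j > 0} (\<lambda>j. indet j + indet (- j)) (\<lambda>j. bracket (p j) (p (- j))) + R0 \<and>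
      \<Psi>p = formal_sum {j. j > 0} indet p
        + formal_sum {(j, m). j > 0 \<and> m < 0 \<and> j + m > 0}
            (\<lambda>(j, m). indet j + indet m) (\<lambda>(j, m). bracket (p j) (p m)) + Rp)"
proof -
  interpret graded_lie_algebra scale bracket P by (rule assms(1))
  interpret factorization_problem scale bracket P p
    by unfold_locales (rule assms(2))
  have words: "series_proj P J sol \<in> pword_series scale bracket P gm gp"
    if "J \<in> {{..<0}, {0}, {0<..}}" for J
    using word_series_imp[OF word_series_proj[OF word_series_sol that]] .
  show ?thesis
    by (intro exI[of _ "neg sol"] exI[of _ "zer sol"] exI[of _ "pos sol"] conjI
        is_factorization_sol remainders words allI impI) (auto dest: is_factorization_unique)
qed

end
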